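(* Let $(\Omega,\mathcal F,\mu,T)$ be an ergodic probability-preserving invertible dynamical system, $c:\Omega\to\,]0,+\infty[$ a measurable function, and let $(S_n)_{n\ge 0}$ be the associated random walk among conductances on $\mathbb Z$ (see context). If $\overline c$ and $1/c$ are $\mu$-integrable, then for $\mu$-almost every $\omega\in\Omega$ and for every real $x_0$, $$\lim_{n\to+\infty}\sqrt{2n}\,\frac{\mathbb P_0^\omega[S_{2n}=g_n(x_0)]}{\overline c(g_n(x_0))(\omega)}=\frac1{\sqrt\pi}\sqrt{\frac{\int\frac1c\,d\mu}{\int\overline c\,d\mu}}\;\exp\left(-\frac{\int\overline c\,d\mu\,\int\frac1c\,d\mu}{4}\,x_0^2\right),$$ where $g_n(x_0)$ denotes a nearest even integer to $x_0\sqrt{2n}$.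
   Context: $\mu$ is a probability measure on the measurable space $(\Omega,\mathcal F)$, and $T:\Omega\to\Omega$ is invertible, bi-measurable, preserves $\mu$, and is ergodic (every invariant measurable set has measure $0$ or $1$). For $\omega\in\Omega$ (the environment) and $x\in\mathbb Z$, the conductance of the edge $\{x,x+1\}$ is $c(x,x+1)(\omega)=c(x+1,x)(\omega):=c(T^x\omega)$. Put $\overline c(x)(\omega):=c(x-1,x)(\omega)+c(x,x+1)(\omega)$. As a function on $\Omega$, $\overline c$ denotes $\omega\mapsto\overline c(0)(\omega)=c(T^{-1}\omega)+c(\omega)$. For fixed $\omega$ and a starting point $y\in\mathbb Z$, under $\mathbb P^\omega_{y}$, $(S_n)_{n\ge0}$ is the Markov chain on $\mathbb Z$ with $S_0=y$ and transition probabilities $\mathbb P^\omega_{y}[S_{n+1}=x\pm1\mid S_n=x]=c(x,x\pm1)(\omega)/\overline c(x)(\omega)$. *)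

theory Defs
  imports "HOL-Probability.Probability"
begin

definition invertible_measure_preserving :: "'a measure \<Rightarrow> ('a \<Rightarrow> 'a) \<Rightarrow> bool" where
  "invertible_measure_preserving M T \<longleftrightarrow>
     bij_betw T (space M) (space M) \<and>
     T \<in> measurable M M \<and>
     the_inv_into (space M) T \<in> measurable M M \<and>
     distr M M T = M"

definition ergodic :: "'a measure \<Rightarrow> ('a \<Rightarrow> 'a) \<Rightarrow> bool" where
  "ergodic M T \<longleftrightarrow>
     (\<forall>A\<in>sets M. T -` A \<inter> space M = A \<longrightarrow> measure M A = 0 \<or> measure M A = 1)"

definition iterate :: "'a measure \<Rightarrow> ('a \<Rightarrow> 'a) \<Rightarrow> int \<Rightarrow> 'a \<Rightarrow> 'a" where
  "iterate M T x \<omega> =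
     (if 0 \<le> x then (T ^^ nat x) \<omega> else ((the_inv_into (space M) T) ^^ nat (- x)) \<omega>)"

text \<open>The conductance of \<open>{x, y}\<close>; pairs that are not edges of \<open>\<int>\<close> get conductance \<open>0\<close>.\<close>

definition conductance ::
    "'a measure \<Rightarrow> ('a \<Rightarrow> 'a) \<Rightarrow> ('a \<Rightarrow> real) \<Rightarrow> 'a \<Rightarrow> int \<Rightarrow> int \<Rightarrow> real" where
  "conductance M T c \<omega> x y =
     (if y = x + 1 then c (iterate M T x \<omega>)
      else if x = y + 1 then c (iterate M T y \<omega>)
      else 0)"

definition cbar :: "'a measure \<Rightarrow> ('a \<Rightarrow> 'a) \<Rightarrow> ('a \<Rightarrow> real) \<Rightarrow> 'a \<Rightarrow> int \<Rightarrow> real" where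
  "cbar M T c \<omega> x = conductance M T c \<omega> (x - 1) x + conductance M T c \<omega> x (x + 1)"

text \<open>Markov chains are taken up to realization: \<open>S\<close> is any process on any probability
  space \<open>P\<close>. The conditional probability given a history is only prescribed when that
  history has positive probability.\<close>

definition markov_chain ::
    "('s \<Rightarrow> 's \<Rightarrow> real) \<Rightarrow> 's \<Rightarrow> 'p measure \<Rightarrow> (nat \<Rightarrow> 'p \<Rightarrow> 's) \<Rightarrow> bool" where
  "markov_chain p y P S \<longleftrightarrow>
     prob_space P \<and>
     (\<forall>n. S n \<in> measurable P (count_space UNIV)) \<and>
     (AE w in P. S 0 w = y) \<and>
     (\<forall>n s z. \<P>(w in P. \<forall>k\<le>n. S k w = s k) > 0 \<longrightarrow>
        \<P>(w in P. S (Suc n) w = z \<bar> \<forall>k\<le>n. S k w = s k) = p (s n) z)"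

definition conductance_walk ::
    "'a measure \<Rightarrow> ('a \<Rightarrow> 'a) \<Rightarrow> ('a \<Rightarrow> real) \<Rightarrow> 'a \<Rightarrow> int \<Rightarrow> 'p measure \<Rightarrow> (nat \<Rightarrow> 'p \<Rightarrow> int) \<Rightarrow> bool"
  where
  "conductance_walk M T c \<omega> y P S \<longleftrightarrow>
     markov_chain (\<lambda>x z. conductance M T c \<omega> x z / cbar M T c \<omega> x) y P S"

definition nearest_even :: "int \<Rightarrow> real \<Rightarrow> bool" where
  "nearest_even k r \<longleftrightarrow>
     even k \<and> (\<forall>j::int. even j \<longrightarrow> \<bar>r - real_of_int k\<bar> \<le> \<bar>r - real_of_int j\<bar>)"


text \<open>The walk exists: it moves right from \<open>x\<close> at time \<open>n\<close> iff the coin with index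
  \<open>(n, x)\<close>, one of an independent family, shows \<open>True\<close>.\<close>

primrec coin_path :: "int \<Rightarrow> (nat \<times> int \<Rightarrow> bool) \<Rightarrow> nat \<Rightarrow> int" where
  "coin_path y b 0 = y"
| "coin_path y b (Suc n) =
     (if b (n, coin_path y b n) then coin_path y b n + 1 else coin_path y b n - 1)"

lemma coin_path_eq_iff:
  assumes "s 0 = y" and "\<And>k. k < n \<Longrightarrow> s (Suc k) = s k + 1 \<or> s (Suc k) = s k - 1"
  shows "(\<forall>k\<le>n. coin_path y b k = s k) \<longleftrightarrow> (\<forall>k<n. b (k, s k) = (s (Suc k) = s k + 1))"
  using assms(2)
proof (induction n)
  case 0
  then show ?case using assms(1) by simp
next
  case (Suc n)
  have IH: "(\<forall>k\<le>n. coin_path y b k = s k) \<longleftrightarrow> (\<forall>k<n. b (k, s k) = (s (Suc k) = s k + 1))"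
    using Suc by simp
  have step: "s (Suc n) = s n + 1 \<or> s (Suc n) = s n - 1"
    using Suc.prems by simp
  have "(\<forall>k\<le>Suc n. coin_path y b k = s k) \<longleftrightarrow>
      (\<forall>k\<le>n. coin_path y b k = s k) \<and> coin_path y b (Suc n) = s (Suc n)"
    by (auto simp: le_Suc_eq)
  also have "\<dots> \<longleftrightarrow> (\<forall>k\<le>n. coin_path y b k = s k) \<and> b (n, s n) = (s (Suc n) = s n + 1)"
    using step by auto
  also have "\<dots> \<longleftrightarrow> (\<forall>k<Suc n. b (k, s k) = (s (Suc k) = s k + 1))"
    unfolding IH by (auto simp: less_Suc_eq)
  finally show ?case .
qed

lemma markov_chain_coin_path:
  fixes q :: "int \<Rightarrow> real" and p :: "int \<Rightarrow> int \<Rightarrow> real"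
  assumes q: "\<And>x. 0 \<le> q x" "\<And>x. q x \<le> 1"
    and p: "\<And>x z. p x z = (if z = x + 1 then q x else if z = x - 1 then 1 - q x else 0)"
  shows "markov_chain p y (PiM UNIV (\<lambda>i. measure_pmf (bernoulli_pmf (q (snd i)))))
           (\<lambda>n b. coin_path y b n)"
    (is "markov_chain p y ?P ?S")
proof -
  interpret product_prob_space "\<lambda>i::nat \<times> int. measure_pmf (bernoulli_pmf (q (snd i)))" UNIV
    by (intro product_prob_spaceI) (rule prob_space_measure_pmf)
  have space: "space ?P = UNIV"
    by (simp add: space_PiM PiE_def extensional_def)
  have coin: "(\<lambda>b. b i) \<in> measurable ?P (count_space UNIV)" for i
    using measurable_component_singleton[of i UNIV "\<lambda>i. measure_pmf (bernoulli_pmf (q (snd i)))"]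
    by (simp add: measurable_cong_sets[OF refl sets_measure_pmf_count_space])
  have meas: "?S n \<in> measurable ?P (count_space UNIV)" for n
  proof (induction n)
    case (Suc n)
    have "(\<lambda>b. (\<lambda>x b. if b (n, x) then x + 1 else x - 1) (coin_path y b n) b)
        \<in> measurable ?P (count_space UNIV)"
    proof (rule measurable_compose_countable[OF _ Suc])
      fix x
      have "(\<lambda>b. (\<lambda>t. if t then x + 1 else x - 1) (b (n, x))) \<in> measurable ?P (count_space UNIV)"
        by (rule measurable_compose[OF coin]) simp
      then show "(\<lambda>b. if b (n, x) then x + 1 else x - 1) \<in> measurable ?P (count_space UNIV)"
        by simp
    qed
    then show ?case by simp
  qed simp
  have prob: "\<P>(b in ?P. \<forall>k\<le>n. coin_path y b k = s k) = (\<Prod>k<n. p (s k) (s (Suc k)))"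
    if s: "s 0 = y" "\<And>k. k < n \<Longrightarrow> s (Suc k) = s k + 1 \<or> s (Suc k) = s k - 1" for n s
  proof -
    let ?J = "(\<lambda>k. (k, s k)) ` {..<n}"
    let ?X = "\<lambda>i. {s (Suc (fst i)) = s (fst i) + 1}"
    have "{b \<in> space ?P. \<forall>k\<le>n. coin_path y b k = s k}
        = prod_emb UNIV (\<lambda>i. measure_pmf (bernoulli_pmf (q (snd i)))) ?J (Pi\<^sub>E ?J ?X)"
    proof (rule set_eqI)
      fix b
      have "(\<forall>k\<le>n. coin_path y b k = s k) \<longleftrightarrow>
          (\<forall>k<n. b (k, s k) = (s (Suc k) = s k + 1))"
        using s by (rule coin_path_eq_iff)
      moreover have "b \<in> prod_emb UNIV (\<lambda>i. measure_pmf (bernoulli_pmf (q (snd i)))) ?J (Pi\<^sub>E ?J ?X)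
          \<longleftrightarrow> (\<forall>k<n. b (k, s k) = (s (Suc k) = s k + 1))"
        by (simp add: prod_emb_def space_PiM Pi_iff Ball_def image_iff)
      ultimately show "b \<in> {b \<in> space ?P. \<forall>k\<le>n. coin_path y b k = s k}
          \<longleftrightarrow> b \<in> prod_emb UNIV (\<lambda>i. measure_pmf (bernoulli_pmf (q (snd i)))) ?J (Pi\<^sub>E ?J ?X)"
        unfolding space by simp
    qed
    then have "\<P>(b in ?P. \<forall>k\<le>n. coin_path y b k = s k)
        = (\<Prod>i\<in>?J. measure (measure_pmf (bernoulli_pmf (q (snd i)))) (?X i))"
      by (simp only:) (rule measure_PiM_emb, auto)
    also have "\<dots> = (\<Prod>k<n. p (s k) (s (Suc k)))"
      using s(2) q by (subst prod.reindex)
        (force simp: inj_on_def measure_pmf_single p intro!: prod.cong)+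
    finally show ?thesis .
  qed
  have step: "coin_path y b (Suc k) = coin_path y b k + 1 \<or>
      coin_path y b (Suc k) = coin_path y b k - 1" for b k
    by simp
  have trans: "\<P>(b in ?P. coin_path y b (Suc n) = z \<bar> \<forall>k\<le>n. coin_path y b k = s k) = p (s n) z"
    if pos: "\<P>(b in ?P. \<forall>k\<le>n. coin_path y b k = s k) > 0" for n s z
  proof -
    have "{b \<in> space ?P. \<forall>k\<le>n. coin_path y b k = s k} \<noteq> {}"
      using pos by (metis less_irrefl measure_empty)
    then obtain b where b: "\<And>k. k \<le> n \<Longrightarrow> coin_path y b k = s k" by auto
    have s0: "s 0 = y" using b[of 0] by simp
    have s1: "s (Suc k) = s k + 1 \<or> s (Suc k) = s k - 1" if "k < n" for k
      using step[of b k] b[of k] b[of "Suc k"] that by simp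
    show ?thesis
    proof (cases "z = s n + 1 \<or> z = s n - 1")
      case True
      let ?s = "s(Suc n := z)"
      have "\<P>(b in ?P. coin_path y b (Suc n) = z \<and> (\<forall>k\<le>n. coin_path y b k = s k))
          = \<P>(b in ?P. \<forall>k\<le>Suc n. coin_path y b k = ?s k)"
        by (rule arg_cong[where f="measure ?P"]) (auto simp: le_Suc_eq simp del: coin_path.simps)
      also have "\<dots> = (\<Prod>k<Suc n. p (?s k) (?s (Suc k)))"
        using s0 s1 True by (intro prob) (auto simp: less_Suc_eq)
      also have "\<dots> = (\<Prod>k<n. p (s k) (s (Suc k))) * p (s n) z"
        by simp
      also have "(\<Prod>k<n. p (s k) (s (Suc k))) = \<P>(b in ?P. \<forall>k\<le>n. coin_path y b k = s k)"
        using prob[OF s0 s1] by simp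
      finally show ?thesis
        using pos unfolding cond_prob_def by simp
    next
      case False
      have "{b \<in> space ?P. coin_path y b (Suc n) = z \<and> (\<forall>k\<le>n. coin_path y b k = s k)} = {}"
        using False step by (auto simp del: coin_path.simps) (metis order_refl)
      then have "\<P>(b in ?P. coin_path y b (Suc n) = z \<and> (\<forall>k\<le>n. coin_path y b k = s k)) = 0"
        by (metis (no_types, lifting) measure_empty)
      then show ?thesis
        using False unfolding cond_prob_def p by (simp only:) simp
    qed
  qed
  show ?thesis
    unfolding markov_chain_def using meas trans by (auto intro: P.prob_space_axioms)
qed

lemma markov_chain_canonical:
  fixes p :: "'s::countable \<Rightarrow> 's \<Rightarrow> real"
  assumes "markov_chain p y P S"
  shows "markov_chain p y (distr P (PiM UNIV (\<lambda>_. count_space UNIV)) (\<lambda>w n. S n w)) (\<lambda>n x. x n)"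
    (is "markov_chain p y ?D _")
proof -
  interpret prob_space P using assms unfolding markov_chain_def by blast
  have S [measurable]: "S n \<in> measurable P (count_space UNIV)" for n
    using assms unfolding markov_chain_def by blast
  have path [measurable]: "(\<lambda>w n. S n w) \<in> measurable P (PiM UNIV (\<lambda>_. count_space UNIV))"
    by (intro measurable_PiM_single') (auto simp: S)
  have coord [measurable]:
      "(\<lambda>x. x n) \<in> measurable (PiM UNIV (\<lambda>_. count_space UNIV)) (count_space (UNIV :: 's set))"
    for n :: nat
    by (rule measurable_component_singleton) simp
  have prob: "\<P>(x in ?D. Q x) = \<P>(w in P. Q (\<lambda>n. S n w))"
    if [measurable]: "Measurable.pred (PiM UNIV (\<lambda>_. count_space UNIV)) Q" for Q
    by (subst measure_distr) (use that in \<open>auto intro!: arg_cong[where f="measure P"]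
      simp: space_PiM pred_def\<close>)
  have hist: "\<P>(x in ?D. \<forall>k\<le>n. x k = s k) = \<P>(w in P. \<forall>k\<le>n. S k w = s k)"
    and hist': "\<P>(x in ?D. x (Suc n) = z \<and> (\<forall>k\<le>n. x k = s k))
      = \<P>(w in P. S (Suc n) w = z \<and> (\<forall>k\<le>n. S k w = s k))" for n s z
    by (subst prob; simp)+
  have "AE x in ?D. x 0 = y"
    using assms by (subst AE_distr_iff) (auto simp: markov_chain_def)
  then show ?thesis
    using assms unfolding markov_chain_def cond_prob_def hist hist'
    by (auto intro!: prob_space_distr)
qed

lemma conductance_walk_exists:
  assumes T: "bij_betw T (space M) (space M)" and c: "\<And>\<omega>. \<omega> \<in> space M \<Longrightarrow> 0 < c \<omega>"
  shows "\<exists>P :: 'a \<Rightarrow> int \<Rightarrow> (nat \<Rightarrow> int) measure. \<forall>\<omega>\<in>space M. \<forall>y.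
    conductance_walk M T c \<omega> y (P \<omega> y) (\<lambda>n x. x n)"
proof -
  have "\<exists>P :: (nat \<Rightarrow> int) measure. conductance_walk M T c \<omega> y P (\<lambda>n x. x n)"
    if \<omega>: "\<omega> \<in> space M" for \<omega> y
  proof -
    have T': "the_inv_into (space M) T x \<in> space M" if "x \<in> space M" for x
      using bij_betw_the_inv_into[OF T] that by (auto simp: bij_betw_def)
    have "(T ^^ n) \<omega> \<in> space M" "((the_inv_into (space M) T) ^^ n) \<omega> \<in> space M" for n
      by (induction n) (use \<omega> T T' in \<open>auto simp: bij_betw_def\<close>)
    then have pos: "0 < c (iterate M T x \<omega>)" for x
      using c by (simp add: iterate_def)
    let ?q = "\<lambda>x. conductance M T c \<omega> x (x + 1) / cbar M T c \<omega> x"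
    have eq: "conductance M T c \<omega> x (x + 1) = c (iterate M T x \<omega>)"
      "conductance M T c \<omega> (x - 1) x = c (iterate M T (x - 1) \<omega>)"
      "conductance M T c \<omega> x (x - 1) = c (iterate M T (x - 1) \<omega>)"
      "cbar M T c \<omega> x = c (iterate M T (x - 1) \<omega>) + c (iterate M T x \<omega>)" for x
      by (simp_all add: conductance_def cbar_def)
    have sum_pos: "0 < c (iterate M T (x - 1) \<omega>) + c (iterate M T x \<omega>)" for x
      using pos[of x] pos[of "x - 1"] by simp
    have "markov_chain (\<lambda>x z. conductance M T c \<omega> x z / cbar M T c \<omega> x) y
        (PiM UNIV (\<lambda>i. measure_pmf (bernoulli_pmf (?q (snd i))))) (\<lambda>n b. coin_path y b n)"
    proof (rule markov_chain_coin_path)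
      fix x z
      show "0 \<le> ?q x" "?q x \<le> 1"
        using pos[of x] pos[of "x - 1"] by (auto simp: eq)
      show "conductance M T c \<omega> x z / cbar M T c \<omega> x =
          (if z = x + 1 then ?q x else if z = x - 1 then 1 - ?q x else 0)"
      proof -
        have "1 - ?q x = conductance M T c \<omega> x (x - 1) / cbar M T c \<omega> x"
          using sum_pos[of x] unfolding eq by (simp add: diff_divide_eq_iff)
        then show ?thesis
          by (auto simp: conductance_def)
      qed
    qed
    then show ?thesis
      unfolding conductance_walk_def by (blast intro: markov_chain_canonical)
  qed
  then show ?thesis
    by metis
qed

end

theory Submission
  imports Defs "HOL-Real_Asymp.Real_Asymp"
begin

text \<open>For a fixed environment the walk is reversible with respect to \<open>m x = c (x - 1) + c x\<close>, so the
  theorem is about the kernel \<open>v n x\<close>, the probability of being at \<open>x\<close> at time \<open>n\<close> divided by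
  \<open>m x\<close>. The kernel arises by iterating an averaging operator that is a self-adjoint contraction of
  \<open>l\<^sup>2(m)\<close>. The only property of the environment that matters is that the averages of \<open>m\<close> and of
  \<open>1 / c\<close> over intervals with one end at \<open>0\<close> converge, to \<open>A\<close> and \<open>B\<close> respectively. This holds for
  almost every environment by Birkhoff's theorem, applied to \<open>T\<close> and to its inverse
  (\<open>birkhoff\<close>, \<open>invertible_averages\<close>).

  In dimension one the Laplace transform of the kernel in time, the Green function
  \<open>U x = (\<Sum>n. s ^ n * v n x)\<close>, is accessible under so weak an assumption. It solves a second-order
  difference equation with coefficients \<open>m\<close> and \<open>c\<close>, it is unimodal, and its flux
  \<open>c x * (U (x + 1) - U x)\<close> is bounded by \<open>1 / s\<close>. Green's identity between \<open>U\<close> and a corrected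
  version of the explicit Green function \<open>C * q ^ \<bar>x - z\<bar>\<close> of the homogeneous chain expresses their
  difference by sums of \<open>m - A\<close> and \<open>1 / c - B\<close> against functions of bounded variation. Summation by
  parts makes these sums \<open>o(sqrt n)\<close> when \<open>s = exp (- a / n)\<close> (\<open>green_homogenization\<close>,
  \<open>green_scaling\<close>). The limits are the Laplace transforms of the Gaussian kernel in its time variable
  (\<open>laplace_heat_kernel\<close>).

  It remains to return from the transforms to the value at one time. By Weierstrass approximation the
  averages of the rescaled kernel over short time intervals converge (\<open>tauberian\<close>), and they can be
  replaced by values as the kernel varies slowly in time. The latter follows from the operator
  structure: with \<open>v\<close> started at \<open>y\<close>, the return densities \<open>v (2 n) y\<close> are the square norms of \<open>v n\<close>, and
  their second differences are the square norms of \<open>v n - v (n + 2)\<close>. Both are nonincreasing, so one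
  step in time near \<open>n\<close> changes the kernel by the order of a return density divided by \<open>n\<close>
  (\<open>kernel_time_step\<close>). Finally the return densities are of order \<open>1 / sqrt n\<close>, because the Green
  function on the diagonal is at most its mean over a window plus its oscillation there
  (\<open>green_diag_le\<close>, \<open>return_density_bound\<close>).\<close>

section \<open>The transition operator and its kernel\<close>

text \<open>The environment is fixed: \<open>c x\<close> is the conductance of the edge \<open>{x, x + 1}\<close>. The kernel
  below is the transition probability divided by the reversible mass \<open>m\<close> of the end point. The reason to
  divide is that reversibility then makes it the iterate of a self-adjoint averaging operator.\<close>

locale conductances =
  fixes c :: "int \<Rightarrow> real"
  assumes c_pos: "0 < c x"
begin

definition m :: "int \<Rightarrow> real" where
  "m x = c (x - 1) + c x"

definition avg :: "(int \<Rightarrow> real) \<Rightarrow> int \<Rightarrow> real" where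
  "avg f x = (c (x - 1) * f (x - 1) + c x * f (x + 1)) / m x"

primrec kernel :: "int \<Rightarrow> nat \<Rightarrow> int \<Rightarrow> real" where
  "kernel y 0 = (\<lambda>x. if x = y then 1 / m y else 0)"
| "kernel y (Suc n) = avg (kernel y n)"

definition mass_inner :: "(int \<Rightarrow> real) \<Rightarrow> (int \<Rightarrow> real) \<Rightarrow> real" where
  "mass_inner f g = (\<Sum>\<^sub>\<infinity>x. m x * f x * g x)"

definition fin_supp :: "(int \<Rightarrow> real) \<Rightarrow> bool" where
  "fin_supp f \<longleftrightarrow> finite {x. f x \<noteq> 0}"

lemma m_pos: "0 < m x"
  using c_pos[of x] c_pos[of "x - 1"] by (simp add: m_def)

lemma m_nonzero [simp]: "m x \<noteq> 0"
  using m_pos[of x] by simp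

lemma m_avg: "m x * avg f x = c (x - 1) * f (x - 1) + c x * f (x + 1)"
  by (simp add: avg_def)

lemma summable_fin_supp: "fin_supp f \<Longrightarrow> f summable_on UNIV"
  unfolding fin_supp_def by (rule finite_nonzero_values_imp_summable_on) simp

lemma fin_supp_mult: "fin_supp f \<Longrightarrow> fin_supp (\<lambda>x. h x * f x)"
  "fin_supp f \<Longrightarrow> fin_supp (\<lambda>x. f x * h x)"
  unfolding fin_supp_def by (auto elim!: rev_finite_subset)

lemma fin_supp_add: "fin_supp f \<Longrightarrow> fin_supp g \<Longrightarrow> fin_supp (\<lambda>x. f x + g x)"
  unfolding fin_supp_def by (erule (1) finite_subset[rotated, OF finite_UnI]) auto

lemma fin_supp_diff: "fin_supp f \<Longrightarrow> fin_supp g \<Longrightarrow> fin_supp (\<lambda>x. f x - g x)"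
  unfolding fin_supp_def by (erule (1) finite_subset[rotated, OF finite_UnI]) auto

lemma fin_supp_shift: "fin_supp f \<Longrightarrow> fin_supp (\<lambda>x. f (x + k))"
proof -
  assume "fin_supp f"
  then have "finite ((\<lambda>x. x - k) ` {x. f x \<noteq> 0})"
    unfolding fin_supp_def by simp
  then show ?thesis
    unfolding fin_supp_def by (rule rev_finite_subset) force
qed

lemma infsum_shift: "(\<Sum>\<^sub>\<infinity>x. f (x + k)) = (\<Sum>\<^sub>\<infinity>x::int. f x :: real)"
proof (rule infsum_reindex_bij_betw)
  show "bij (\<lambda>x. x + k)" by (rule bij_plus_right)
qed

lemma fin_supp_avg: "fin_supp f \<Longrightarrow> fin_supp (avg f)"
proof -
  assume f: "fin_supp f"
  have "fin_supp (\<lambda>x. (1 / m x) * (c (x - 1) * f (x + - 1) + c x * f (x + 1)))"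
    by (intro fin_supp_mult fin_supp_add fin_supp_shift f)
  then show ?thesis
    by (simp add: avg_def[abs_def])
qed

lemma fin_supp_kernel: "fin_supp (kernel y n)"
  by (induction n) (auto simp: fin_supp_avg, simp add: fin_supp_def)

lemma mass_inner_commute: "mass_inner f g = mass_inner g f"
  by (simp add: mass_inner_def mult_ac)

lemma mass_inner_diff_left:
  assumes "fin_supp f" "fin_supp g"
  shows "mass_inner (\<lambda>x. f x - g x) h = mass_inner f h - mass_inner g h"
proof -
  have "mass_inner f h = (\<Sum>\<^sub>\<infinity>x. m x * (f x - g x) * h x + m x * g x * h x)"
    by (simp add: mass_inner_def algebra_simps)
  also have "\<dots> = mass_inner (\<lambda>x. f x - g x) h + mass_inner g h"
    unfolding mass_inner_def
    by (intro infsum_add summable_fin_supp fin_supp_mult fin_supp_diff assms)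
  finally show ?thesis by simp
qed

lemma mass_inner_diff_right:
  assumes "fin_supp f" "fin_supp g"
  shows "mass_inner h (\<lambda>x. f x - g x) = mass_inner h f - mass_inner h g"
  using mass_inner_diff_left[OF assms] by (simp add: mass_inner_commute)

lemma mass_inner_nonneg: "0 \<le> mass_inner f f"
  unfolding mass_inner_def
  by (intro infsum_nonneg) (metis m_pos less_imp_le mult.assoc mult_nonneg_nonneg zero_le_square)

lemma mass_inner_Cauchy_Schwarz:
  assumes f: "fin_supp f" and g: "fin_supp g"
  shows "\<bar>mass_inner f g\<bar> \<le> sqrt (mass_inner f f) * sqrt (mass_inner g g)"
proof -
  let ?W = "{x. f x \<noteq> 0} \<union> {x. g x \<noteq> 0}"
  have fin: "finite ?W"
    using f g by (simp add: fin_supp_def)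
  have mass_inner: "mass_inner u w = (\<Sum>x\<in>?W. (sqrt (m x) * u x) * (sqrt (m x) * w x))"
    if "{x. u x * w x \<noteq> 0} \<subseteq> ?W" for u w
  proof -
    have "mass_inner u w = (\<Sum>\<^sub>\<infinity>x\<in>?W. m x * u x * w x)"
      unfolding mass_inner_def using that by (intro infsum_cong_neutral) auto
    also have "\<dots> = (\<Sum>x\<in>?W. (sqrt (m x) * u x) * (sqrt (m x) * w x))"
    proof (simp only: infsum_finite[OF fin], rule sum.cong[OF refl])
      fix x
      have "(sqrt (m x) * u x) * (sqrt (m x) * w x) = (sqrt (m x) * sqrt (m x)) * (u x * w x)"
        by (simp only: mult_ac)
      also have "sqrt (m x) * sqrt (m x) = m x" using m_pos[of x] by (intro real_sqrt_mult_self[THEN trans] abs_of_pos)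
      finally show "m x * u x * w x = sqrt (m x) * u x * (sqrt (m x) * w x)"
        by (simp only: mult.assoc)
    qed
    finally show ?thesis .
  qed
  have sub: "{x. f x * g x \<noteq> 0} \<subseteq> ?W" "{x. f x * f x \<noteq> 0} \<subseteq> ?W"
    "{x. g x * g x \<noteq> 0} \<subseteq> ?W" by auto
  have "(mass_inner f g)\<^sup>2 \<le> mass_inner f f * mass_inner g g"
    using Cauchy_Schwarz_ineq_sum[of "\<lambda>x. sqrt (m x) * f x" "\<lambda>x. sqrt (m x) * g x" ?W]
      mass_inner[of f g, OF sub(1)] mass_inner[of f f, OF sub(2)] mass_inner[of g g, OF sub(3)]
    by (simp only: power2_eq_square)
  then have "sqrt ((mass_inner f g)\<^sup>2) \<le> sqrt (mass_inner f f * mass_inner g g)"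
    by (rule real_sqrt_le_mono)
  then show ?thesis by (simp add: real_sqrt_mult)
qed

text \<open>Each edge contributes once for each of its two directions, so the form is visibly symmetric.
  This is reversibility.\<close>

lemma mass_inner_avg:
  assumes f: "fin_supp f" and g: "fin_supp g"
  shows "mass_inner (avg f) g = (\<Sum>\<^sub>\<infinity>x. c x * (f x * g (x + 1) + f (x + 1) * g x))"
proof -
  let ?a = "\<lambda>x. c x * (f x * g (x + 1))"
  have a: "fin_supp ?a"
    by (intro fin_supp_mult f)
  have b: "fin_supp (\<lambda>x. c x * (f (x + 1) * g x))"
    by (intro fin_supp_mult g)
  have "mass_inner (avg f) g = (\<Sum>\<^sub>\<infinity>x. ?a (x + - 1) + c x * (f (x + 1) * g x))"
    unfolding mass_inner_def m_avg by (simp add: algebra_simps)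
  also have "\<dots> = (\<Sum>\<^sub>\<infinity>x. ?a (x + - 1)) + (\<Sum>\<^sub>\<infinity>x. c x * (f (x + 1) * g x))"
    by (intro infsum_add summable_fin_supp fin_supp_shift[OF a] b)
  also have "(\<Sum>\<^sub>\<infinity>x. ?a (x + - 1)) = (\<Sum>\<^sub>\<infinity>x. ?a x)"
    by (rule infsum_shift)
  also have "\<dots> + (\<Sum>\<^sub>\<infinity>x. c x * (f (x + 1) * g x)) = (\<Sum>\<^sub>\<infinity>x. ?a x + c x * (f (x + 1) * g x))"
    by (intro infsum_add[symmetric] summable_fin_supp a b)
  finally show ?thesis by (simp add: algebra_simps)
qed

lemma mass_inner_avg_swap:
  assumes "fin_supp f" "fin_supp g"
  shows "mass_inner (avg f) g = mass_inner f (avg g)"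
  using mass_inner_avg[OF assms] mass_inner_avg[OF assms(2,1)] by (simp add: mass_inner_commute[of f] algebra_simps)

text \<open>Convexity of the square at each site, and then every edge is counted once from each end.\<close>

lemma avg_contraction:
  assumes f: "fin_supp f"
  shows "mass_inner (avg f) (avg f) \<le> mass_inner f f"
proof -
  let ?a = "\<lambda>x. c x * (f x)\<^sup>2" and ?b = "\<lambda>x. c (x - 1) * (f x)\<^sup>2"
  have a: "fin_supp ?a" and b: "fin_supp ?b"
    unfolding power2_eq_square by (intro fin_supp_mult f)+
  have b1: "?b (x + 1) = c x * (f (x + 1))\<^sup>2" and a1: "?a (x + - 1) = c (x - 1) * (f (x - 1))\<^sup>2" for x
    by simp_all
  have pt: "m x * avg f x * avg f x \<le> ?a (x + - 1) + ?b (x + 1)" for x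
  proof -
    have "m x * (m x * avg f x * avg f x) = (c (x - 1) * f (x - 1) + c x * f (x + 1))\<^sup>2"
      unfolding m_avg[symmetric] by (simp add: power2_eq_square)
    also have "\<dots> \<le> m x * (c (x - 1) * (f (x - 1))\<^sup>2 + c x * (f (x + 1))\<^sup>2)"
    proof -
      have "m x * (c (x - 1) * (f (x - 1))\<^sup>2 + c x * (f (x + 1))\<^sup>2)
          - (c (x - 1) * f (x - 1) + c x * f (x + 1))\<^sup>2 = c (x - 1) * c x * (f (x - 1) - f (x + 1))\<^sup>2"
        by (simp add: m_def power2_eq_square algebra_simps)
      moreover have "0 \<le> c (x - 1) * c x * (f (x - 1) - f (x + 1))\<^sup>2"
        using c_pos[of x] c_pos[of "x - 1"] by simp
      ultimately show ?thesis by linarith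
    qed
    finally show ?thesis
      using m_pos[of x] unfolding b1 a1 by simp
  qed
  have "mass_inner (avg f) (avg f) \<le> (\<Sum>\<^sub>\<infinity>x. ?a (x + - 1) + ?b (x + 1))"
    unfolding mass_inner_def
    by (intro infsum_mono pt summable_fin_supp fin_supp_mult fin_supp_add
        fin_supp_avg f fin_supp_shift[OF a] fin_supp_shift[OF b])
  also have "\<dots> = (\<Sum>\<^sub>\<infinity>x. ?a (x + - 1)) + (\<Sum>\<^sub>\<infinity>x. ?b (x + 1))"
    by (intro infsum_add summable_fin_supp fin_supp_shift[OF a] fin_supp_shift[OF b])
  also have "\<dots> = (\<Sum>\<^sub>\<infinity>x. ?a x) + (\<Sum>\<^sub>\<infinity>x. ?b x)"
    using infsum_shift[of ?a "- 1"] infsum_shift[of ?b 1] by simp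
  also have "\<dots> = (\<Sum>\<^sub>\<infinity>x. ?a x + ?b x)"
    by (intro infsum_add[symmetric] summable_fin_supp a b)
  also have "\<dots> = mass_inner f f"
    by (simp add: mass_inner_def m_def power2_eq_square algebra_simps)
  finally show ?thesis .
qed

lemma mass_inner_kernel_0: "mass_inner f (kernel y 0) = f y"
proof -
  have "mass_inner f (kernel y 0) = (\<Sum>\<^sub>\<infinity>x\<in>{y}. m x * f x * kernel y 0 x)"
    unfolding mass_inner_def by (rule infsum_cong_neutral) auto
  then show ?thesis by simp
qed

text \<open>The Chapman--Kolmogorov equation. It makes the value at an even time a square norm, or an inner
  product of kernels started from the two ends.\<close>

lemma mass_inner_kernel: "mass_inner (kernel y i) (kernel x j) = kernel y (i + j) x"
proof (induction j arbitrary: i)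
  case 0
  then show ?case by (simp del: kernel.simps add: mass_inner_kernel_0)
next
  case (Suc j)
  have "mass_inner (kernel y i) (kernel x (Suc j)) = mass_inner (kernel y (Suc i)) (kernel x j)"
    by (simp add: mass_inner_avg_swap fin_supp_kernel)
  then show ?case using Suc.IH[of "Suc i"] by simp
qed

lemma kernel_nonneg: "0 \<le> kernel y n x"
proof (induction n arbitrary: x)
  case (Suc n)
  then show ?case
    using less_imp_le[OF c_pos] less_imp_le[OF m_pos] by (simp add: avg_def)
qed (use less_imp_le[OF m_pos] in simp)

lemma kernel_parity: "odd (x - y + int n) \<Longrightarrow> kernel y n x = 0"
proof (induction n arbitrary: x)
  case (Suc n)
  then have "odd (x - 1 - y + int n)" "odd (x + 1 - y + int n)" by presburger+
  then show ?case using Suc.IH by (simp add: avg_def)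
qed auto

lemma mass_avg:
  assumes "fin_supp f"
  shows "(\<Sum>\<^sub>\<infinity>x. m x * avg f x) = (\<Sum>\<^sub>\<infinity>x. m x * f x)"
proof -
  let ?a = "\<lambda>x. c x * f x" and ?b = "\<lambda>x. c (x - 1) * f x"
  have a: "fin_supp ?a" and b: "fin_supp ?b"
    by (intro fin_supp_mult assms)+
  have "(\<Sum>\<^sub>\<infinity>x. m x * avg f x) = (\<Sum>\<^sub>\<infinity>x. ?a (x + - 1) + ?b (x + 1))"
    by (simp add: m_avg)
  also have "\<dots> = (\<Sum>\<^sub>\<infinity>x. ?a (x + - 1)) + (\<Sum>\<^sub>\<infinity>x. ?b (x + 1))"
    by (intro infsum_add summable_fin_supp fin_supp_shift[OF a] fin_supp_shift[OF b])
  also have "\<dots> = (\<Sum>\<^sub>\<infinity>x. ?a x) + (\<Sum>\<^sub>\<infinity>x. ?b x)"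
    by (simp only: infsum_shift[of ?a "- 1"] infsum_shift[of ?b 1])
  also have "\<dots> = (\<Sum>\<^sub>\<infinity>x. ?a x + ?b x)"
    by (intro infsum_add[symmetric] summable_fin_supp a b)
  finally show ?thesis
    by (simp add: m_def algebra_simps)
qed

lemma kernel_mass: "(\<Sum>\<^sub>\<infinity>x. m x * kernel y n x) = 1"
proof (induction n)
  case 0
  have "(\<Sum>\<^sub>\<infinity>x. m x * kernel y 0 x) = (\<Sum>\<^sub>\<infinity>x\<in>{y}. m x * kernel y 0 x)"
    by (rule infsum_cong_neutral) auto
  then show ?case by simp
qed (simp add: mass_avg fin_supp_kernel)

lemma kernel_mass_le:
  assumes "finite W"
  shows "(\<Sum>x\<in>W. m x * kernel y n x) \<le> 1"
proof -
  have "(\<Sum>x\<in>W. m x * kernel y n x) \<le> (\<Sum>\<^sub>\<infinity>x. m x * kernel y n x)"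
    using assms kernel_nonneg less_imp_le[OF m_pos]
    by (intro finite_sum_le_infsum summable_fin_supp fin_supp_mult fin_supp_kernel) auto
  then show ?thesis by (simp add: kernel_mass)
qed

lemma avg_diff: "avg (\<lambda>x. f x - g x) = (\<lambda>x. avg f x - avg g x)"
  by (rule ext) (simp add: avg_def diff_divide_distrib add_divide_distrib algebra_simps)

end

section \<open>Regularity of the kernel in time\<close>

text \<open>A nonincreasing sequence that sums to at most \<open>a\<close> over \<open>k\<close> steps has terms at most \<open>a / k\<close>
  after these steps. This is used twice: to pass from \<open>a\<close> to its differences, and from these to the second
  differences.\<close>

lemma second_difference_bound:
  fixes a :: "nat \<Rightarrow> real"
  assumes nonneg: "\<And>n. 0 \<le> a n" and anti: "\<And>n. a (Suc n) \<le> a n"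
    and dd: "\<And>n. a (Suc n) - 2 * a (Suc (Suc n)) + a (Suc (Suc (Suc n))) \<le> a n - 2 * a (Suc n) + a (Suc (Suc n))"
    and pos: "\<And>n. 0 \<le> a n - 2 * a (Suc n) + a (Suc (Suc n))"
    and "3 * k \<le> j"
  shows "(real k)\<^sup>2 * (a j - 2 * a (Suc j) + a (Suc (Suc j))) \<le> a k"
proof -
  define d where "d n = a n - a (Suc n)" for n
  define b where "b n = d n - d (Suc n)" for n
  have b: "a n - 2 * a (Suc n) + a (Suc (Suc n)) = b n" for n
    by (simp add: b_def d_def)
  have key: "real i * f (n + i) \<le> g n - g (n + i)"
    if "\<And>n. f (Suc n) \<le> f n" "\<And>n. f n = g n - g (Suc n)" for f g :: "nat \<Rightarrow> real" and i n
  proof (induction i)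
    case (Suc i)
    have "f (n + Suc i) \<le> f (n + i)" using that(1) by simp
    then have "real i * f (n + Suc i) \<le> real i * f (n + i)" by (simp add: mult_left_mono)
    with Suc have "real i * f (n + Suc i) \<le> g n - g (n + i)" by linarith
    moreover have "f (n + Suc i) \<le> g (n + i) - g (n + Suc i)"
      using that(1)[of "n + i"] that(2)[of "n + i"] by simp
    ultimately show ?case by (simp add: algebra_simps)
  qed simp
  have b_anti: "b (Suc n) \<le> b n" and b_nonneg: "0 \<le> b n" and d_nonneg: "0 \<le> d n" for n
    using dd[of n] pos[of n] anti[of n] by (simp_all only: b d_def diff_ge_0_iff_ge)
  have d_anti: "d (Suc n) \<le> d n" for n
    using b_nonneg[of n] by (simp add: b_def)
  have "b j \<le> b (2 * k + k)"
    using \<open>3 * k \<le> j\<close> by (intro lift_Suc_antimono_le[of b, OF b_anti]) simp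
  then have "real k * b j \<le> real k * b (2 * k + k)" by (simp add: mult_left_mono)
  also have "\<dots> \<le> d (2 * k) - d (2 * k + k)"
    by (rule key[of b d, OF b_anti b_def])
  also have "\<dots> \<le> d (k + k)" using d_nonneg[of "2 * k + k"] by (simp add: mult_2)
  finally have "real k * (real k * b j) \<le> real k * d (k + k)" by (simp add: mult_left_mono)
  also have "\<dots> \<le> a k - a (k + k)"
    by (rule key[of d a, OF d_anti d_def])
  also have "\<dots> \<le> a k" using nonneg[of "k + k"] by simp
  finally show ?thesis by (simp add: b power2_eq_square)
qed

context conductances
begin

definition return_density :: "int \<Rightarrow> nat \<Rightarrow> real" where
  "return_density y n = kernel y (2 * n) y"

definition return_diff2 :: "int \<Rightarrow> nat \<Rightarrow> real" where
  "return_diff2 y n = return_density y n - 2 * return_density y (Suc n) + return_density y (Suc (Suc n))"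

lemma return_density_eq_mass_inner: "return_density y n = mass_inner (kernel y n) (kernel y n)"
  by (simp add: return_density_def mass_inner_kernel mult_2)

lemma return_density_nonneg: "0 \<le> return_density y n"
  by (simp add: return_density_def kernel_nonneg)

lemma return_density_antimono: "return_density y (Suc n) \<le> return_density y n"
  by (simp add: return_density_eq_mass_inner avg_contraction fin_supp_kernel)

definition kernel_diff :: "int \<Rightarrow> nat \<Rightarrow> int \<Rightarrow> real" where
  "kernel_diff y n = (\<lambda>x. kernel y n x - kernel y (n + 2) x)"

lemma fin_supp_kernel_diff: "fin_supp (kernel_diff y n)"
  unfolding kernel_diff_def by (intro fin_supp_diff fin_supp_kernel)

lemma return_diff2_eq_mass_inner: "return_diff2 y n = mass_inner (kernel_diff y n) (kernel_diff y n)"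
proof -
  have "mass_inner (kernel_diff y n) (kernel_diff y n) = kernel y (n + n) y - kernel y (n + (n + 2)) y
     - (kernel y ((n + 2) + n) y - kernel y ((n + 2) + (n + 2)) y)"
    unfolding kernel_diff_def
    by (simp only: mass_inner_diff_left mass_inner_diff_right fin_supp_diff fin_supp_kernel mass_inner_kernel)
  moreover have "(n + 2) + n = 2 * Suc n" "n + (n + 2) = 2 * Suc n" "n + n = 2 * n"
    "(n + 2) + (n + 2) = 2 * Suc (Suc n)" by simp_all
  ultimately show ?thesis
    unfolding return_diff2_def return_density_def by simp
qed

lemma return_diff2_nonneg: "0 \<le> return_diff2 y n"
  by (simp add: return_diff2_eq_mass_inner mass_inner_nonneg)

lemma return_diff2_antimono: "return_diff2 y (Suc n) \<le> return_diff2 y n"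
proof -
  have "kernel_diff y (Suc n) = avg (kernel_diff y n)"
    by (simp add: kernel_diff_def avg_diff)
  then show ?thesis
    by (simp add: return_diff2_eq_mass_inner avg_contraction fin_supp_kernel_diff)
qed

text \<open>The increment is the inner product of \<open>kernel y j - kernel y (j + 2)\<close> with
  \<open>kernel z j\<close>. The square norm of the first factor is a second difference of return densities,
  hence at most the return density at time \<open>k\<close> over \<open>k\<^sup>2\<close>.\<close>

lemma kernel_time_step:
  assumes "3 * k \<le> j" "0 < k"
  shows "\<bar>kernel y (2 * j) z - kernel y (2 * Suc j) z\<bar> \<le> sqrt (return_density y k) * sqrt (return_density z k) / real k"
proof -
  have "(real k)\<^sup>2 * return_diff2 y j \<le> return_density y k"
    unfolding return_diff2_def
    by (rule second_difference_bound[of "return_density y", OF return_density_nonneg return_density_antimono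
        return_diff2_antimono[unfolded return_diff2_def] return_diff2_nonneg[unfolded return_diff2_def] assms(1)])
  then have "sqrt ((real k)\<^sup>2 * return_diff2 y j) \<le> sqrt (return_density y k)"
    by (rule real_sqrt_le_mono)
  then have 1: "sqrt (return_diff2 y j) \<le> sqrt (return_density y k) / real k"
    using assms(2) by (simp add: real_sqrt_mult pos_le_divide_eq) (simp only: mult.commute)
  have 2: "sqrt (return_density z j) \<le> sqrt (return_density z k)"
    using assms by (intro real_sqrt_le_mono lift_Suc_antimono_le[of "return_density z", OF return_density_antimono]) simp
  have "kernel y (2 * j) z - kernel y (2 * Suc j) z = mass_inner (kernel_diff y j) (kernel z j)"
  proof -
    have "j + j = 2 * j" "j + 2 + j = 2 * Suc j" by simp_all
    then show ?thesis
      unfolding kernel_diff_def mass_inner_diff_left[OF fin_supp_kernel fin_supp_kernel] mass_inner_kernel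
      by (simp only:)
  qed
  also have "\<bar>\<dots>\<bar> \<le> sqrt (return_diff2 y j) * sqrt (return_density z j)"
    using mass_inner_Cauchy_Schwarz[OF fin_supp_kernel_diff fin_supp_kernel, of y j z j]
    by (simp add: return_diff2_eq_mass_inner return_density_eq_mass_inner)
  also have "\<dots> \<le> (sqrt (return_density y k) / real k) * sqrt (return_density z k)"
    by (intro mult_mono 1 2) (simp_all add: return_density_nonneg)
  finally show ?thesis by simp
qed

end

section \<open>Sums over intervals of integers\<close>

lemma sum_int_Suc: "(a::int) \<le> b \<Longrightarrow> sum f {a..<b + 1} = sum f {a..<b} + (f b :: real)"
proof -
  assume "a \<le> b"
  then have "{a..<b + 1} = insert b {a..<b}" by auto
  then show ?thesis by (simp add: add.commute)
qed

lemma sum_int_telescope: "(a::int) \<le> b \<Longrightarrow> (\<Sum>x\<in>{a..<b}. f (x + 1) - f x) = f b - (f a :: real)"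
  by (induction b rule: int_ge_induct) (simp_all add: sum_int_Suc)

lemma sum_int_by_parts:
  fixes D f :: "int \<Rightarrow> real"
  assumes "a \<le> b"
  shows "(\<Sum>x\<in>{a..<b}. (D (x + 1) - D x) * f x)
    = D b * f b - D a * f a - (\<Sum>x\<in>{a..<b}. D (x + 1) * (f (x + 1) - f x))"
  using assms by (induction b rule: int_ge_induct) (simp_all add: sum_int_Suc algebra_simps)

definition variation :: "(int \<Rightarrow> real) \<Rightarrow> int \<Rightarrow> int \<Rightarrow> real" where
  "variation f a b = (\<Sum>x\<in>{a..<b}. \<bar>f (x + 1) - f x\<bar>)"

text \<open>This is how averages enter: \<open>D\<close> will be the deviation of the sums of \<open>m\<close> or
  \<open>1 / c\<close> from linear growth, of which only the size is known, and \<open>f\<close> a function of bounded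
  variation.\<close>

lemma abs_sum_by_parts_le:
  fixes D f :: "int \<Rightarrow> real"
  assumes "a \<le> b" and D: "\<And>x. a \<le> x \<Longrightarrow> x \<le> b \<Longrightarrow> \<bar>D x\<bar> \<le> E"
  shows "\<bar>\<Sum>x\<in>{a..<b}. (D (x + 1) - D x) * f x\<bar> \<le> E * (\<bar>f a\<bar> + \<bar>f b\<bar> + variation f a b)"
proof -
  have "\<bar>\<Sum>x\<in>{a..<b}. D (x + 1) * (f (x + 1) - f x)\<bar> \<le> (\<Sum>x\<in>{a..<b}. E * \<bar>f (x + 1) - f x\<bar>)"
    by (intro sum_abs[THEN order_trans] sum_mono) (auto simp: abs_mult intro!: mult_right_mono D)
  moreover have "\<bar>D b * f b\<bar> \<le> E * \<bar>f b\<bar>" "\<bar>D a * f a\<bar> \<le> E * \<bar>f a\<bar>"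
    using assms(1) by (auto simp: abs_mult intro!: mult_right_mono D)
  ultimately show ?thesis
    unfolding sum_int_by_parts[OF assms(1)] variation_def sum_distrib_left distrib_left by linarith
qed

lemma variation_mult_le:
  fixes f g :: "int \<Rightarrow> real"
  assumes "\<And>x. \<bar>f x\<bar> \<le> F" "\<And>x. \<bar>g x\<bar> \<le> G"
  shows "variation (\<lambda>x. f x * g x) a b \<le> F * variation g a b + G * variation f a b"
proof -
  have "\<bar>f (x + 1) * g (x + 1) - f x * g x\<bar> \<le> F * \<bar>g (x + 1) - g x\<bar> + G * \<bar>f (x + 1) - f x\<bar>" for x
  proof -
    have "f (x + 1) * g (x + 1) - f x * g x = f (x + 1) * (g (x + 1) - g x) + g x * (f (x + 1) - f x)"
      by (simp add: algebra_simps)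
    also have "\<bar>\<dots>\<bar> \<le> \<bar>f (x + 1)\<bar> * \<bar>g (x + 1) - g x\<bar> + \<bar>g x\<bar> * \<bar>f (x + 1) - f x\<bar>"
      by (simp add: abs_triangle_ineq[THEN order_trans] abs_mult)
    also have "\<dots> \<le> F * \<bar>g (x + 1) - g x\<bar> + G * \<bar>f (x + 1) - f x\<bar>"
      by (intro add_mono mult_right_mono assms) auto
    finally show ?thesis .
  qed
  then show ?thesis
    unfolding variation_def sum_distrib_left sum.distrib[symmetric] by (intro sum_mono) auto
qed

lemma unimodal_le_peak:
  fixes f :: "int \<Rightarrow> real"
  assumes R: "\<And>x. p \<le> x \<Longrightarrow> f (x + 1) \<le> f x" and L: "\<And>x. x < p \<Longrightarrow> f x \<le> f (x + 1)"
  shows "f x \<le> f p"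
proof (cases "p \<le> x")
  case True
  then show ?thesis
    by (induction x rule: int_ge_induct) (auto intro: order_trans[OF R])
next
  case False
  then have "x \<le> p" by simp
  then show ?thesis
  proof (induction x rule: int_le_induct)
    case (step i)
    then show ?case using L[of "i - 1"] by simp
  qed simp
qed

text \<open>Reflecting the decreasing branch at the level of the peak gives a monotone function with the
  same increments in absolute value.\<close>

lemma variation_unimodal:
  fixes f :: "int \<Rightarrow> real"
  assumes R: "\<And>x. p \<le> x \<Longrightarrow> f (x + 1) \<le> f x" and L: "\<And>x. x < p \<Longrightarrow> f x \<le> f (x + 1)"
    and nonneg: "\<And>x. 0 \<le> f x" and "a \<le> b"
  shows "variation f a b \<le> 2 * f p"
proof -
  define h where "h x = (if x \<le> p then f x else 2 * f p - f x)" for x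
  have "variation f a b = (\<Sum>x\<in>{a..<b}. h (x + 1) - h x)"
    unfolding variation_def
  proof (rule sum.cong[OF refl])
    fix x
    consider "x < p" | "x = p" | "x > p" by linarith
    then show "\<bar>f (x + 1) - f x\<bar> = h (x + 1) - h x"
      by cases (use R[of x] L[of x] in \<open>auto simp: h_def\<close>)
  qed
  also have "\<dots> = h b - h a" by (rule sum_int_telescope[OF \<open>a \<le> b\<close>])
  also have "\<dots> \<le> 2 * f p"
    using unimodal_le_peak[of p f, OF R L, of a] unimodal_le_peak[of p f, OF R L, of b]
      nonneg[of a] nonneg[of b] by (auto simp: h_def)
  finally show ?thesis .
qed

text \<open>The primitive of \<open>f\<close> that vanishes at \<open>0\<close>, on both half-lines at once.\<close>

definition isum :: "(int \<Rightarrow> real) \<Rightarrow> int \<Rightarrow> real" where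
  "isum f x = (if 0 \<le> x then \<Sum>i\<in>{0..<x}. f i else - (\<Sum>i\<in>{x..<0}. f i))"

lemma isum_Suc: "isum f (x + 1) = isum f x + f x"
proof (cases "0 \<le> x")
  case False
  then have "{x..<0} = insert x {x + 1..<0}" by auto
  then show ?thesis using False by (auto simp: isum_def)
qed (simp add: isum_def sum_int_Suc)

lemma isum_0 [simp]: "isum f 0 = 0"
  by (simp add: isum_def)

lemma isum_diff: "a \<le> b \<Longrightarrow> (\<Sum>x\<in>{a..<b}. f x) = isum f b - isum f a"
  using sum_int_telescope[of a b "isum f"] by (simp add: isum_Suc)

section \<open>The Green function\<close>

text \<open>The flux \<open>cc n * (u (Suc n) - u n)\<close> is nondecreasing. If it were positive somewhere,
  then \<open>u\<close> would increase from there on and stay away from \<open>0\<close>, which an infinite total mass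
  forbids when \<open>u\<close> is summable against \<open>mm\<close>.\<close>

lemma decreasing_of_flux:
  fixes cc mm u :: "nat \<Rightarrow> real"
  assumes cc: "\<And>n. 0 < cc n" and mm: "\<And>n. 0 < mm n" and u: "\<And>n. 0 \<le> u n" and \<theta>: "0 \<le> \<theta>"
    and flux: "\<And>n. cc (Suc n) * (u (Suc (Suc n)) - u (Suc n)) - cc n * (u (Suc n) - u n)
      = \<theta> * mm (Suc n) * u (Suc n)"
    and fin: "\<And>N. (\<Sum>i\<le>N. mm i * u i) \<le> K"
    and inf: "\<And>K. \<exists>N. K < (\<Sum>i\<le>N. mm i)"
  shows "u (Suc n) \<le> u n"
proof (rule ccontr)
  assume "\<not> ?thesis"
  then have less: "u n < u (Suc n)" by simp
  define F where "F n = cc n * (u (Suc n) - u n)" for n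
  have F0: "0 < F n" using less cc by (simp add: F_def)
  have mono: "F i \<le> F (Suc i)" for i
    using flux[of i] mult_nonneg_nonneg[OF mult_nonneg_nonneg[OF \<theta> less_imp_le[OF mm]] u, of "Suc i" "Suc i"]
    by (simp add: F_def)
  have Fpos: "0 < F i" if "n \<le> i" for i
    using lift_Suc_mono_le[of F, OF mono that] F0 by simp
  have uS: "u i \<le> u (Suc i)" if "n \<le> i" for i
    using Fpos[OF that] cc[of i] by (simp add: F_def zero_less_mult_iff)
  have ui: "u (Suc n) \<le> u i" if "Suc n \<le> i" for i
    using that
  proof (induction i rule: dec_induct)
    case (step i)
    then show ?case using uS[of i] by simp
  qed simp
  have upos: "0 < u (Suc n)" using less u[of n] by simp
  obtain N where N: "K / u (Suc n) + (\<Sum>i\<le>n. mm i) < (\<Sum>i\<le>N. mm i)" using inf by blast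
  have split: "(\<Sum>i\<le>N. mm i) \<le> (\<Sum>i\<le>n. mm i) + (\<Sum>i\<in>{Suc n..N}. mm i)"
  proof -
    have "(\<Sum>i\<le>N. mm i) \<le> (\<Sum>i\<in>{..n} \<union> {Suc n..N}. mm i)"
      by (intro sum_mono2) (auto simp: less_imp_le[OF mm])
    also have "\<dots> = (\<Sum>i\<le>n. mm i) + (\<Sum>i\<in>{Suc n..N}. mm i)"
      by (intro sum.union_disjoint) auto
    finally show ?thesis .
  qed
  have "K / u (Suc n) < (\<Sum>i\<in>{Suc n..N}. mm i)" using N split by linarith
  then have "K < (\<Sum>i\<in>{Suc n..N}. mm i) * u (Suc n)"
    using upos by (simp add: pos_divide_less_eq)
  also have "\<dots> \<le> (\<Sum>i\<in>{Suc n..N}. mm i * u i)"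
    unfolding sum_distrib_right
    by (intro sum_mono mult_left_mono ui) (auto simp: less_imp_le[OF mm])
  also have "\<dots> \<le> (\<Sum>i\<le>N. mm i * u i)"
    by (intro sum_mono2) (auto simp: less_imp_le[OF mm] u)
  finally show False using fin[of N] by simp
qed

context conductances
begin

text \<open>The resolvent, i.e. the Laplace transform of the kernel in discrete time.\<close>

definition green :: "real \<Rightarrow> int \<Rightarrow> int \<Rightarrow> real" where
  "green s y x = (\<Sum>n. s ^ n * kernel y n x)"

lemma kernel_le: "kernel y n x \<le> 1 / m x"
  using kernel_mass_le[of "{x}" y n] m_pos[of x] by (simp add: pos_le_divide_eq mult.commute)

context
  fixes s :: real
  assumes s: "0 < s" "s < 1"
begin

lemma summable_green: "summable (\<lambda>n. s ^ n * kernel y n x)"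
proof (rule summable_comparison_test')
  show "summable (\<lambda>n. s ^ n * (1 / m x))"
    using s by (intro summable_mult2 summable_geometric) simp
  show "norm (s ^ n * kernel y n x) \<le> s ^ n * (1 / m x)" if "0 \<le> n" for n
    using s kernel_nonneg[of y n x] mult_left_mono[OF kernel_le[of y n x], of "s ^ n"]
    by (simp add: abs_mult)
qed

lemma green_nonneg: "0 \<le> green s y x"
  unfolding green_def using s by (intro suminf_nonneg summable_green) (simp add: kernel_nonneg)

lemma avg_green: "avg (green s y) x = (\<Sum>n. s ^ n * kernel y (Suc n) x)"
proof -
  have "(\<lambda>n. (c (x - 1) * (s ^ n * kernel y n (x - 1)) + c x * (s ^ n * kernel y n (x + 1))) / m x)
    sums avg (green s y) x"
    unfolding avg_def green_def
    by (intro sums_divide sums_add sums_mult summable_sums summable_green)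
  then show ?thesis
    by (simp add: avg_def sums_unique algebra_simps)
qed

lemma green_eq: "green s y x = kernel y 0 x + s * avg (green s y) x"
proof -
  have "summable (\<lambda>n. s ^ n * kernel y (Suc n) x)"
    using summable_mult[OF summable_green[of y x, THEN summable_Suc_iff[THEN iffD2]], of "1 / s"] s
    by (simp del: kernel.simps add: divide_simps)
  then have "s * avg (green s y) x = (\<Sum>n. s ^ Suc n * kernel y (Suc n) x)"
    unfolding avg_green by (simp del: kernel.simps add: suminf_mult[symmetric] mult.assoc)
  moreover have "green s y x = kernel y 0 x + (\<Sum>n. s ^ Suc n * kernel y (Suc n) x)"
    unfolding green_def using suminf_split_head[OF summable_green, of y x] by (simp del: kernel.simps)
  ultimately show ?thesis by simp
qed

definition flux :: "int \<Rightarrow> int \<Rightarrow> real" where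
  "flux y x = c x * (green s y (x + 1) - green s y x)"

text \<open>The resolvent equation \<open>U = kernel y 0 + s * avg U\<close>, written as a second-order
  difference equation with a source at \<open>y\<close>.\<close>

lemma flux_diff:
  "flux y x - flux y (x - 1) = (1 / s - 1) * m x * green s y x - (if x = y then 1 / s else 0)"
proof -
  have "flux y x - flux y (x - 1) = m x * avg (green s y) x - m x * green s y x"
    unfolding m_avg by (simp add: flux_def m_def algebra_simps)
  moreover have "avg (green s y) x = (green s y x - kernel y 0 x) / s"
    using green_eq[of y x] s by (simp add: field_simps)
  ultimately show ?thesis using s by (auto simp: field_simps)
qed

lemma green_mass_le:
  assumes "finite W"
  shows "(\<Sum>x\<in>W. m x * green s y x) \<le> 1 / (1 - s)"
proof -
  have "(\<lambda>n. \<Sum>x\<in>W. m x * (s ^ n * kernel y n x)) sums (\<Sum>x\<in>W. m x * green s y x)"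
    unfolding green_def by (intro sums_sum sums_mult summable_sums summable_green)
  moreover have "(\<lambda>n. s ^ n) sums (1 / (1 - s))"
    using s by (intro geometric_sums) simp
  moreover have "(\<Sum>x\<in>W. m x * (s ^ n * kernel y n x)) \<le> s ^ n" for n
  proof -
    have "(\<Sum>x\<in>W. m x * (s ^ n * kernel y n x)) = s ^ n * (\<Sum>x\<in>W. m x * kernel y n x)"
      by (simp add: sum_distrib_left mult_ac)
    then show ?thesis using kernel_mass_le[OF assms, of y n] s by (simp add: mult_left_le)
  qed
  ultimately show ?thesis by (rule sums_le[rotated])
qed

end

end

locale recurrent_conductances = conductances +
  assumes mass_right: "\<exists>N. K < (\<Sum>i\<le>N. m (y + int i))"
    and mass_left: "\<exists>N. K < (\<Sum>i\<le>N. m (y - int i))"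
begin

context
  fixes s :: real
  assumes s: "0 < s" "s < 1"
begin

lemma theta_nonneg: "0 \<le> 1 / s - 1"
  using s by simp

lemma green_decreasing_right:
  assumes "y \<le> x"
  shows "green s y (x + 1) \<le> green s y x"
proof -
  let ?u = "\<lambda>n. green s y (y + int n)"
  have "?u (Suc (nat (x - y))) \<le> ?u (nat (x - y))"
  proof (rule decreasing_of_flux[where cc = "\<lambda>n. c (y + int n)" and mm = "\<lambda>n. m (y + int n)"])
    show "c (y + int (Suc n)) * (?u (Suc (Suc n)) - ?u (Suc n)) - c (y + int n) * (?u (Suc n) - ?u n)
      = (1 / s - 1) * m (y + int (Suc n)) * ?u (Suc n)" for n
      using flux_diff[OF s, of y "y + int (Suc n)"] by (simp add: flux_def[OF s] algebra_simps)
    show "(\<Sum>i\<le>N. m (y + int i) * ?u i) \<le> 1 / (1 - s)" for N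
    proof -
      have "(\<Sum>x\<in>(\<lambda>i. y + int i) ` {..N}. m x * green s y x) \<le> 1 / (1 - s)"
        by (intro green_mass_le s) simp
      then show ?thesis by (subst (asm) sum.reindex) (auto simp: inj_on_def)
    qed
  qed (use c_pos m_pos green_nonneg[OF s] theta_nonneg mass_right in auto)
  then show ?thesis using assms by (simp add: algebra_simps)
qed

lemma green_increasing_left:
  assumes "x < y"
  shows "green s y x \<le> green s y (x + 1)"
proof -
  let ?u = "\<lambda>n. green s y (y - int n)"
  have "?u (Suc (nat (y - x - 1))) \<le> ?u (nat (y - x - 1))"
  proof (rule decreasing_of_flux[where cc = "\<lambda>n. c (y - int n - 1)" and mm = "\<lambda>n. m (y - int n)"])
    show "c (y - int (Suc n) - 1) * (?u (Suc (Suc n)) - ?u (Suc n)) - c (y - int n - 1) * (?u (Suc n) - ?u n)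
      = (1 / s - 1) * m (y - int (Suc n)) * ?u (Suc n)" for n
      using flux_diff[OF s, of y "y - int (Suc n)"] by (simp add: flux_def[OF s] algebra_simps)
    show "(\<Sum>i\<le>N. m (y - int i) * ?u i) \<le> 1 / (1 - s)" for N
    proof -
      have "(\<Sum>x\<in>(\<lambda>i. y - int i) ` {..N}. m x * green s y x) \<le> 1 / (1 - s)"
        by (intro green_mass_le s) simp
      then show ?thesis by (subst (asm) sum.reindex) (auto simp: inj_on_def)
    qed
  qed (use c_pos m_pos green_nonneg[OF s] theta_nonneg mass_left in auto)
  then show ?thesis using assms by (simp add: algebra_simps)
qed

lemma green_le_diag: "green s y x \<le> green s y y"
  by (rule unimodal_le_peak) (auto intro: green_decreasing_right green_increasing_left)

lemma variation_green: "a \<le> b \<Longrightarrow> variation (green s y) a b \<le> 2 * green s y y"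
  by (rule variation_unimodal) (auto intro: green_decreasing_right green_increasing_left green_nonneg s)

text \<open>The flux is nondecreasing on each side of \<open>y\<close>, it is nonnegative on the left and nonpositive
  on the right, and at \<open>y\<close> it falls by at most \<open>1 / s\<close>.\<close>

lemma flux_bound: "\<bar>flux s y x\<bar> \<le> 1 / s"
proof -
  have mono: "flux s y x \<le> flux s y (x + 1)" if "x + 1 \<noteq> y" for x
    using flux_diff[OF s, of y "x + 1"] that
      mult_nonneg_nonneg[OF mult_nonneg_nonneg[OF theta_nonneg less_imp_le[OF m_pos]] green_nonneg[OF s],
        of "x + 1" y "x + 1"] by simp
  have jump: "flux s y (y - 1) - 1 / s \<le> flux s y y"
  proof -
    have "0 \<le> (1 / s - 1) * m y * green s y y"
      using theta_nonneg m_pos[of y] green_nonneg[OF s, of y y] by (simp add: mult_nonneg_nonneg less_imp_le)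
    then show ?thesis using flux_diff[OF s, of y y] by simp
  qed
  have right: "flux s y x \<le> 0" if "y \<le> x" for x
    using green_decreasing_right[OF that] c_pos[of x] by (simp add: flux_def[OF s] mult_le_0_iff)
  have left: "0 \<le> flux s y x" if "x < y" for x
    using green_increasing_left[OF that] c_pos[of x] by (simp add: flux_def[OF s])
  have lower: "flux s y y \<le> flux s y x" if "y \<le> x" for x
    using that
  proof (induction x rule: int_ge_induct)
    case (step i)
    then show ?case using mono[of i] by simp
  qed simp
  have upper: "flux s y x \<le> flux s y (y - 1)" if "x \<le> y - 1" for x
    using that
  proof (induction x rule: int_le_induct)
    case (step i)
    then show ?case using mono[of "i - 1"] by simp
  qed simp
  have "0 \<le> 1 / s" using s by simp
  show ?thesis
  proof (cases "y \<le> x")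
    case True
    then show ?thesis
      using right[OF True] lower[OF True] left[of "y - 1"] jump \<open>0 \<le> 1 / s\<close> by simp
  next
    case False
    then have "x < y" "x \<le> y - 1" by simp_all
    then show ?thesis
      using left[of x] upper[of x] right[of y] jump \<open>0 \<le> 1 / s\<close> by simp
  qed
qed

text \<open>On \<open>{a..b}\<close> the minimum of the Green function is at most its mean, which the total mass
  \<open>1 / (1 - s)\<close> controls, and the bound on the flux controls its oscillation.\<close>

lemma green_diag_le:
  assumes "a \<le> y" "y \<le> b"
  shows "green s y y \<le> 1 / ((1 - s) * (\<Sum>x\<in>{a..b}. m x)) + (\<Sum>x\<in>{a..<b}. 1 / c x) / s"
proof -
  let ?M = "\<Sum>x\<in>{a..b}. m x" and ?R = "(\<Sum>x\<in>{a..<b}. 1 / c x) / s"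
  have diff: "green s y y - ?R \<le> green s y x" if "x \<in> {a..b}" for x
  proof -
    have step: "\<bar>green s y (i + 1) - green s y i\<bar> \<le> (1 / c i) / s" for i
    proof -
      have "c i * \<bar>green s y (i + 1) - green s y i\<bar> \<le> 1 / s"
        using flux_bound[of y i] c_pos[of i] by (simp add: flux_def[OF s] abs_mult)
      then show ?thesis using c_pos[of i] s by (simp add: field_simps)
    qed
    have "\<bar>green s y q - green s y p\<bar> \<le> ?R" if "a \<le> p" "p \<le> q" "q \<le> b" for p q
    proof -
      have "\<bar>green s y q - green s y p\<bar> = \<bar>\<Sum>i\<in>{p..<q}. green s y (i + 1) - green s y i\<bar>"
        using that by (simp add: sum_int_telescope)
      also have "\<dots> \<le> (\<Sum>i\<in>{p..<q}. (1 / c i) / s)"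
        by (intro sum_abs[THEN order_trans] sum_mono step)
      also have "\<dots> \<le> (\<Sum>i\<in>{a..<b}. (1 / c i) / s)"
        using that c_pos s by (intro sum_mono2) (auto simp: less_imp_le)
      finally show ?thesis by (simp add: sum_divide_distrib)
    qed
    from this[of x y] this[of y x] that assms show ?thesis by (cases "x \<le> y") auto
  qed
  have Mpos: "0 < ?M" using assms m_pos by (intro sum_pos) auto
  have "(\<Sum>x\<in>{a..b}. m x * (green s y y - ?R)) \<le> (\<Sum>x\<in>{a..b}. m x * green s y x)"
    by (intro sum_mono mult_left_mono diff) (auto simp: less_imp_le[OF m_pos])
  also have "\<dots> \<le> 1 / (1 - s)" by (intro green_mass_le s) simp
  finally have "?M * (green s y y - ?R) \<le> 1 / (1 - s)"
    by (simp add: sum_distrib_right)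
  then have "green s y y - ?R \<le> 1 / (1 - s) / ?M"
    unfolding pos_le_divide_eq[OF Mpos] by (simp only: mult.commute)
  then show ?thesis unfolding divide_divide_eq_left by linarith
qed

section \<open>Comparison with the homogeneous chain\<close>

text \<open>Here \<open>C * q ^ nat \<bar>x - z\<bar>\<close> is the Green function with pole \<open>z\<close> of the
  homogeneous chain with mass \<open>A\<close> and resistance \<open>B\<close> at every site. Its flux \<open>w\<close> is kept and
  integrated against the true resistances \<open>1 / c\<close>, which gives \<open>\<psi>\<close>. Then \<open>\<psi>\<close> is exact for the
  divergence part of the equation, and it is close to the homogeneous solution since only the sums of
  \<open>1 / c\<close> matter. Green's second identity for \<open>\<psi>\<close> and the true Green function on \<open>{- N..N}\<close>
  leaves the value at \<open>z\<close>, boundary terms, a term with the difference of \<open>\<psi>\<close> and the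
  homogeneous solution, and sums of \<open>m - A\<close> against a product of two unimodal
  functions. Summation by parts bounds the latter by \<open>E\<close> times a variation.\<close>

lemma green_homogenization:
  fixes A B q E :: real and N z :: int
  assumes AB: "0 < A" "0 < B" and q: "0 < q" "q < 1" and q_eq: "q + 1 / q - 2 = (1 / s - 1) * A * B"
    and z: "\<bar>z\<bar> \<le> N"
    and E_m: "\<And>x. \<bar>x\<bar> \<le> N + 1 \<Longrightarrow> \<bar>isum m x - A * x\<bar> \<le> E"
    and E_r: "\<And>x. \<bar>x\<bar> \<le> N + 1 \<Longrightarrow> \<bar>isum (\<lambda>x. 1 / c x) x - B * x\<bar> \<le> E"
  defines "C \<equiv> B / (1 / q - q)"
  shows "\<bar>green s 0 z - C * q ^ nat \<bar>z\<bar> / s\<bar>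
    \<le> 2 * (C * q ^ nat (N - \<bar>z\<bar>) + 4 * E) / s + green s 0 0 * q ^ nat (N - \<bar>z\<bar>)
      + 4 * E / s + 6 * (1 / s - 1) * E * C * green s 0 0"
proof -
  define \<theta> where "\<theta> = 1 / s - 1"
  define U where "U = green s 0"
  define F where "F = flux s 0"
  define gh where "gh x = C * q ^ nat \<bar>x - z\<bar>" for x
  define w where "w x = (gh (x + 1) - gh x) / B" for x
  define \<xi> where "\<xi> = isum (\<lambda>x. (1 / c x - B) * w x)"
  define \<psi> where "\<psi> x = gh x + \<xi> x" for x
  have \<theta>: "0 \<le> \<theta>" using theta_nonneg by (simp add: \<theta>_def)
  have N: "0 \<le> N" using z by simp
  have E: "0 \<le> E" using E_m[of 0] N by simp
  have q1: "q\<^sup>2 < 1" using q by (simp add: power_less_one_iff)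
  have C_eq: "C = B * q / (1 - q\<^sup>2)"
  proof -
    have "1 / q - q = (1 - q\<^sup>2) / q" using q by (simp add: diff_divide_distrib power2_eq_square)
    then show ?thesis unfolding C_def by (simp only: divide_divide_eq_right)
  qed
  have C: "0 < C" unfolding C_eq using AB q q1 by (intro divide_pos_pos mult_pos_pos) auto
  have CB_eq: "C / B * (1 - q) = q / (1 + q)"
  proof -
    have "C = B * q / ((1 - q) * (1 + q))"
      unfolding C_eq by (simp add: algebra_simps power2_eq_square)
    moreover have "B * q / ((1 - q) * (1 + q)) / B * (1 - q) = q / (1 + q)"
      using AB q by (simp add: divide_simps)
    ultimately show ?thesis by (simp only:)
  qed
  have CB: "C / B * (1 - q) \<le> 1 / 2" "0 \<le> C / B * (1 - q)"
    unfolding CB_eq using q by (simp_all add: divide_le_eq)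
  have gh_nonneg: "0 \<le> gh x" for x using C q by (simp add: gh_def)
  have gh_le: "gh x \<le> C" for x using C q by (simp add: gh_def power_le_one mult_left_le)
  have gh_right: "gh (x + 1) = q * gh x" if "z \<le> x" for x
  proof -
    have "nat \<bar>x + 1 - z\<bar> = Suc (nat \<bar>x - z\<bar>)" using that by simp
    then have "q ^ nat \<bar>x + 1 - z\<bar> = q * q ^ nat \<bar>x - z\<bar>" by (simp only: power_Suc)
    then show ?thesis unfolding gh_def by simp
  qed
  have gh_left: "gh x = q * gh (x + 1)" if "x < z" for x
  proof -
    have "nat \<bar>x - z\<bar> = Suc (nat \<bar>x + 1 - z\<bar>)" using that by simp
    then have "q ^ nat \<bar>x - z\<bar> = q * q ^ nat \<bar>x + 1 - z\<bar>" by (simp only: power_Suc)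
    then show ?thesis unfolding gh_def by simp
  qed
  have w_right: "w x = - ((1 - q) / B * gh x)" if "z \<le> x" for x
    unfolding w_def gh_right[OF that] by (simp add: left_diff_distrib diff_divide_distrib)
  have w_left: "w x = (1 - q) / B * gh (x + 1)" if "x < z" for x
    unfolding w_def by (subst gh_left[OF that]) (simp add: left_diff_distrib diff_divide_distrib)
  have w_diff: "w x - w (x - 1) = \<theta> * A * gh x - (if x = z then 1 else 0)" for x
  proof -
    have \<theta>A: "\<theta> * A = (q + 1 / q - 2) / B" using q_eq AB by (simp add: \<theta>_def)
    consider "z < x" | "x < z" | "x = z" by linarith
    then show ?thesis
    proof cases
      case 1
      then have "w x = - ((1 - q) / B * gh x)" "w (x - 1) = - ((1 - q) / B * gh (x - 1))" "gh x = q * gh (x - 1)"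
        using w_right[of x] w_right[of "x - 1"] gh_right[of "x - 1"] by simp_all
      then show ?thesis
        unfolding \<theta>A using 1 by (simp only:) (use q AB in \<open>simp add: field_simps\<close>)
    next
      case 2
      then have "w x = (1 - q) / B * gh (x + 1)" "w (x - 1) = (1 - q) / B * gh x" "gh x = q * gh (x + 1)"
        using w_left[of x] w_left[of "x - 1"] gh_left[of x] by simp_all
      then show ?thesis
        unfolding \<theta>A using 2 by (simp only:) (use q AB in \<open>simp add: field_simps\<close>)
    next
      case 3
      then have "w x = - ((1 - q) / B * C)" "w (x - 1) = (1 - q) / B * C" "gh x = C"
        using w_right[of x] w_left[of "x - 1"] by (simp_all add: gh_def)
      then have "w x - w (x - 1) = - (2 * (C / B * (1 - q)))" by simp
      moreover have "\<theta> * A * gh x = C / B * (1 - q) * ((1 - q) / q)"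
        unfolding \<theta>A \<open>gh x = C\<close> using q AB by (simp add: field_simps)
      moreover have "- (2 * (q / (1 + q))) = q / (1 + q) * ((1 - q) / q) - 1"
      proof -
        have "1 + q \<noteq> 0" using q by simp
        then have "- (2 * (q / (1 + q))) = (1 - q) / (1 + q) - 1"
          by (simp add: divide_simps)
        then show ?thesis using q by simp
      qed
      ultimately show ?thesis using 3 unfolding CB_eq by simp
    qed
  qed
  have gh_w_nonneg: "0 \<le> (1 - q) / B * gh x" and gh_w_le: "(1 - q) / B * gh x \<le> (1 - q) / B * C" for x
    using gh_nonneg[of x] q AB by (simp, intro mult_left_mono gh_le, simp)
  have w_le: "\<bar>w x\<bar> \<le> 1 / 2" for x
  proof -
    have "\<bar>w x\<bar> \<le> (1 - q) / B * C"
      using w_right[of x] w_left[of x] gh_w_nonneg[of x] gh_w_nonneg[of "x + 1"]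
        gh_w_le[of x] gh_w_le[of "x + 1"] by (cases "z \<le> x") simp_all
    then show ?thesis using CB by (simp add: mult.commute)
  qed
  have var_w: "variation w a b \<le> 3" if "a \<le> b" for a b
  proof -
    have "variation w a b \<le> (\<Sum>x\<in>{a..<b}. (w (x + 1) - w x) + 2 * (if x = z - 1 then 1 else 0))"
      unfolding variation_def
    proof (rule sum_mono)
      fix x
      have "0 \<le> \<theta> * A * gh (x + 1)" using \<theta> AB gh_nonneg by simp
      then show "\<bar>w (x + 1) - w x\<bar> \<le> (w (x + 1) - w x) + 2 * (if x = z - 1 then 1 else 0)"
        using w_diff[of "x + 1"] by (cases "x = z - 1") auto
    qed
    also have "\<dots> \<le> (w b - w a) + 2"
      unfolding sum.distrib sum_int_telescope[OF that] sum_distrib_left[symmetric] by (simp add: sum.delta)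
    also have "\<dots> \<le> 3" using w_le[of b] w_le[of a] by linarith
    finally show ?thesis .
  qed
  have \<xi>_le: "\<bar>\<xi> x\<bar> \<le> 4 * E" if "\<bar>x\<bar> \<le> N + 1" for x
  proof -
    let ?D = "\<lambda>x. isum (\<lambda>x. 1 / c x) x - B * x"
    have D: "?D (x + 1) - ?D x = 1 / c x - B" for x unfolding isum_Suc by (simp add: algebra_simps)
    have bound: "\<bar>\<Sum>x\<in>{a..<b}. (1 / c x - B) * w x\<bar> \<le> 4 * E" if "a \<le> b" "- N - 1 \<le> a" "b \<le> N + 1" for a b
    proof -
      have "\<bar>\<Sum>x\<in>{a..<b}. (?D (x + 1) - ?D x) * w x\<bar> \<le> E * (\<bar>w a\<bar> + \<bar>w b\<bar> + variation w a b)"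
        using that by (intro abs_sum_by_parts_le E_r) auto
      also have "\<dots> \<le> E * 4"
        using var_w[OF that(1)] w_le[of a] w_le[of b] by (intro mult_left_mono E) linarith
      finally show ?thesis unfolding D by simp
    qed
    show ?thesis
      using bound[of 0 x] bound[of x 0] that unfolding \<xi>_def isum_def by auto
  qed
  have flux\<psi>: "c x * (\<psi> (x + 1) - \<psi> x) = w x" for x
  proof -
    have "\<psi> (x + 1) - \<psi> x = B * w x + (1 / c x - B) * w x"
      using AB by (simp add: \<psi>_def \<xi>_def isum_Suc w_def)
    then show ?thesis using c_pos[of x] by (simp add: field_simps)
  qed
  \<comment> \<open>the Wronskian of \<open>\<psi>\<close> and \<open>U\<close>, whose increments are the terms of Green's identity\<close>
  define H where "H x = \<psi> x * F (x - 1) - U x * w (x - 1)" for x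
  have H_Suc: "H (x + 1) = \<psi> x * F x - U x * w x" for x
    unfolding H_def F_def flux_def[OF s] flux\<psi>[symmetric] U_def by (simp add: algebra_simps)
  have H_diff: "H (x + 1) - H x = \<theta> * m x * \<xi> x * U x + \<theta> * ((m x - A) * (gh x * U x))
      + (if x = z then U z else 0) - (if x = 0 then \<psi> 0 / s else 0)" for x
  proof -
    have "H (x + 1) - H x = \<psi> x * (F x - F (x - 1)) - U x * (w x - w (x - 1))"
      unfolding H_Suc by (simp add: H_def algebra_simps)
    then show ?thesis
      unfolding w_diff F_def flux_diff[OF s] U_def[symmetric] \<theta>_def[symmetric]
      by (auto simp: \<psi>_def algebra_simps add_divide_distrib)
  qed
  let ?I = "{- N..<N + 1}"
  have I: "- N \<le> N + 1" "0 \<in> ?I" "z \<in> ?I" using N z by auto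
  let ?S1 = "\<Sum>x\<in>?I. \<theta> * m x * \<xi> x * U x" and ?S2 = "\<Sum>x\<in>?I. (m x - A) * (gh x * U x)"
  have "H (N + 1) - H (- N) = ?S1 + \<theta> * ?S2 + U z - \<psi> 0 / s"
    unfolding sum_int_telescope[OF I(1), of H, symmetric] H_diff
    using I by (simp add: sum.distrib sum_subtractf sum_distrib_left sum.delta)
  moreover have "\<psi> 0 = C * q ^ nat \<bar>z\<bar>"
    by (simp add: \<psi>_def \<xi>_def gh_def)
  ultimately have eq: "U z - C * q ^ nat \<bar>z\<bar> / s = H (N + 1) - H (- N) - ?S1 - \<theta> * ?S2" by simp
  have U_nonneg: "0 \<le> U x" and U_le: "U x \<le> U 0" for x
    using green_nonneg[OF s] green_le_diag by (auto simp: U_def)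
  have S1: "\<bar>?S1\<bar> \<le> 4 * E / s"
  proof -
    have "\<bar>?S1\<bar> \<le> (\<Sum>x\<in>?I. \<theta> * (4 * E) * (m x * U x))"
    proof (intro sum_abs[THEN order_trans] sum_mono)
      fix x assume "x \<in> ?I"
      then have "\<bar>\<xi> x\<bar> \<le> 4 * E" by (intro \<xi>_le) auto
      then have "\<bar>\<xi> x\<bar> * (\<theta> * (m x * U x)) \<le> (4 * E) * (\<theta> * (m x * U x))"
        using \<theta> U_nonneg[of x] m_pos[of x] by (intro mult_right_mono) auto
      then show "\<bar>\<theta> * m x * \<xi> x * U x\<bar> \<le> \<theta> * (4 * E) * (m x * U x)"
        using \<theta> U_nonneg[of x] m_pos[of x] by (simp add: abs_mult mult_ac)
    qed
    also have "\<dots> \<le> \<theta> * (4 * E) * (1 / (1 - s))"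
      unfolding sum_distrib_left[symmetric] U_def
      using \<theta> E by (intro mult_left_mono green_mass_le s) auto
    also have "\<dots> = 4 * E / s" using s by (simp add: \<theta>_def field_simps)
    finally show ?thesis .
  qed
  have S2: "\<bar>?S2\<bar> \<le> 6 * E * C * U 0"
  proof -
    let ?D = "\<lambda>x. isum m x - A * x" and ?f = "\<lambda>x. gh x * U x"
    have D: "?D (x + 1) - ?D x = m x - A" for x unfolding isum_Suc by (simp add: algebra_simps)
    have f_le: "\<bar>?f x\<bar> \<le> C * U 0" for x
      using gh_nonneg[of x] gh_le[of x] U_nonneg[of x] U_le[of x] by (simp add: abs_mult mult_mono)
    have var_gh: "variation gh (- N) (N + 1) \<le> 2 * gh z"
    proof (rule variation_unimodal)
      show "gh (x + 1) \<le> gh x" if "z \<le> x" for x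
        using gh_right[OF that] gh_nonneg[of x] q by (simp add: mult_left_le_one_le)
      show "gh x \<le> gh (x + 1)" if "x < z" for x
        using gh_left[OF that] gh_nonneg[of "x + 1"] q by (simp add: mult_left_le_one_le)
    qed (use gh_nonneg I in auto)
    have "variation ?f (- N) (N + 1) \<le> C * variation U (- N) (N + 1) + U 0 * variation gh (- N) (N + 1)"
      using gh_nonneg gh_le U_nonneg U_le by (intro variation_mult_le) auto
    also have "\<dots> \<le> C * (2 * U 0) + U 0 * (2 * C)"
      using variation_green[OF I(1), of 0] var_gh gh_le[of z] C U_nonneg[of 0]
      by (intro add_mono mult_left_mono) (auto simp: U_def)
    finally have var: "variation ?f (- N) (N + 1) \<le> 4 * C * U 0" by simp
    have "\<bar>\<Sum>x\<in>?I. (?D (x + 1) - ?D x) * ?f x\<bar>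
        \<le> E * (\<bar>?f (- N)\<bar> + \<bar>?f (N + 1)\<bar> + variation ?f (- N) (N + 1))"
      using I by (intro abs_sum_by_parts_le E_m) auto
    also have "\<dots> \<le> E * (6 * C * U 0)"
      using var f_le[of "- N"] f_le[of "N + 1"] by (intro mult_left_mono E) linarith
    finally show ?thesis unfolding D by (simp add: mult_ac)
  qed
  let ?e = "q ^ nat (N - \<bar>z\<bar>)"
  have gh_end: "gh x \<le> C * ?e" if "nat (N - \<bar>z\<bar>) \<le> nat \<bar>x - z\<bar>" for x
    using C q power_decreasing[OF that, of q] by (simp add: gh_def)
  have H_le: "\<bar>H y\<bar> \<le> (C * ?e + 4 * E) / s + U 0 * (?e / 2)"
    if y: "\<bar>y\<bar> \<le> N + 1" "nat (N - \<bar>z\<bar>) \<le> nat \<bar>y - z\<bar>" and w: "\<bar>w (y - 1)\<bar> \<le> ?e / 2" for y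
  proof -
    have "\<bar>\<psi> y\<bar> \<le> C * ?e + 4 * E"
      using gh_end[OF y(2)] \<xi>_le[OF y(1)] gh_nonneg[of y] unfolding \<psi>_def by linarith
    then have "\<bar>\<psi> y * F (y - 1)\<bar> \<le> (C * ?e + 4 * E) * (1 / s)"
      unfolding abs_mult F_def by (intro mult_mono flux_bound) auto
    moreover have "\<bar>U y * w (y - 1)\<bar> \<le> U 0 * (?e / 2)"
      using U_nonneg[of y] U_le[of y] w unfolding abs_mult by (intro mult_mono) auto
    moreover have "(C * ?e + 4 * E) * (1 / s) = (C * ?e + 4 * E) / s" by simp
    ultimately show ?thesis unfolding H_def by linarith
  qed
  have gh_w: "(1 - q) / B * gh x \<le> ?e / 2" if "nat (N - \<bar>z\<bar>) \<le> nat \<bar>x - z\<bar>" for x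
  proof -
    have "(1 - q) / B * gh x \<le> (1 - q) / B * (C * ?e)"
      using gh_end[OF that] q AB by (intro mult_left_mono) auto
    also have "\<dots> = (C / B * (1 - q)) * ?e" by simp
    also have "\<dots> \<le> 1 / 2 * ?e" using CB(1) q by (intro mult_right_mono) auto
    finally show ?thesis by simp
  qed
  have H1: "\<bar>H (N + 1)\<bar> \<le> (C * ?e + 4 * E) / s + U 0 * (?e / 2)"
  proof (rule H_le)
    have "z \<le> N" using z by simp
    have "\<bar>w N\<bar> \<le> ?e / 2"
      unfolding w_right[OF \<open>z \<le> N\<close>] abs_minus_cancel abs_of_nonneg[OF gh_w_nonneg] by (intro gh_w) simp
    then show "\<bar>w (N + 1 - 1)\<bar> \<le> ?e / 2" by simp
  qed (use z in auto)
  have H2: "\<bar>H (- N)\<bar> \<le> (C * ?e + 4 * E) / s + U 0 * (?e / 2)"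
  proof (rule H_le)
    have "- N - 1 < z" using z by simp
    show "\<bar>w (- N - 1)\<bar> \<le> ?e / 2"
      unfolding w_left[OF \<open>- N - 1 < z\<close>] abs_of_nonneg[OF gh_w_nonneg] by (intro gh_w) simp
  qed (use z in auto)
  have "\<bar>\<theta> * ?S2\<bar> \<le> \<theta> * (6 * E * C * U 0)"
    using mult_left_mono[OF S2 \<theta>] \<theta> by (simp add: abs_mult)
  note S2' = this
  have "\<bar>U z - C * q ^ nat \<bar>z\<bar> / s\<bar> \<le> \<bar>H (N + 1)\<bar> + \<bar>H (- N)\<bar> + \<bar>?S1\<bar> + \<bar>\<theta> * ?S2\<bar>"
    unfolding eq by linarith
  also have "\<dots> \<le> ((C * ?e + 4 * E) / s + U 0 * (?e / 2)) + ((C * ?e + 4 * E) / s + U 0 * (?e / 2))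
      + 4 * E / s + \<theta> * (6 * E * C * U 0)"
    by (intro add_mono H1 H2 S1 S2')
  finally have "\<bar>U z - C * q ^ nat \<bar>z\<bar> / s\<bar> \<le> ((C * ?e + 4 * E) / s + U 0 * (?e / 2)) + ((C * ?e + 4 * E) / s + U 0 * (?e / 2))
      + 4 * E / s + \<theta> * (6 * E * C * U 0)" .
  then show ?thesis by (simp add: U_def \<theta>_def algebra_simps add_divide_distrib)
qed

end

end

section \<open>Scaling limit of the Green function\<close>

lemma isum_right: "(\<Sum>i\<le>N. f (y + int i)) = isum f (y + int N + 1) - isum f y"
proof (induction N)
  case (Suc N)
  have "y + int (Suc N) + 1 = (y + int N + 1) + 1" by simp
  then show ?case using Suc isum_Suc[of f "y + int N + 1"] by (simp add: add_ac)
qed (simp add: isum_Suc)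

lemma isum_left: "(\<Sum>i\<le>N. f (y - int i)) = isum f (y + 1) - isum f (y - int N)"
proof (induction N)
  case (Suc N)
  then show ?case using isum_Suc[of f "y - int (Suc N)"] by simp
qed (simp add: isum_Suc)

lemma eventually_scale: "eventually (\<lambda>n. K \<le> e * sqrt (real n)) sequentially" if "0 < e" for e K :: real
proof -
  have "filterlim (\<lambda>n. e * sqrt (real n)) at_top sequentially"
    by (intro filterlim_tendsto_pos_mult_at_top[OF tendsto_const that]
        filterlim_compose[OF sqrt_at_top filterlim_real_sequentially])
  then show ?thesis by (simp add: filterlim_at_top)
qed

locale averaged_conductances = conductances +
  fixes A B :: real
  assumes A_pos: "0 < A" and B_pos: "0 < B"
    and avg_m: "0 < e \<Longrightarrow> \<exists>K. \<forall>x. \<bar>isum m x - A * x\<bar> \<le> e * \<bar>real_of_int x\<bar> + K"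
    and avg_r: "0 < e \<Longrightarrow> \<exists>K. \<forall>x. \<bar>isum (\<lambda>x. 1 / c x) x - B * x\<bar> \<le> e * \<bar>real_of_int x\<bar> + K"
begin

lemma mass_unbounded:
  shows "\<exists>N. K < (\<Sum>i\<le>N. m (y + int i))" and "\<exists>N. K < (\<Sum>i\<le>N. m (y - int i))"
proof -
  obtain K0 where K0: "\<And>x. \<bar>isum m x - A * x\<bar> \<le> A / 2 * \<bar>real_of_int x\<bar> + K0"
    using avg_m[of "A / 2"] A_pos by auto
  have big: "\<exists>N. A / 2 * real N > K1" for K1
    using reals_Archimedean2[of "K1 / (A / 2)"] A_pos by (auto simp: pos_divide_less_eq mult.commute)
  obtain N where N: "A / 2 * real N > K + K0 + \<bar>isum m y\<bar> + A / 2 * \<bar>real_of_int (y + 1)\<bar>" using big by blast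
  let ?N = "N + nat (- y)"
  show "\<exists>N. K < (\<Sum>i\<le>N. m (y + int i))"
  proof
    have pos: "0 \<le> y + int ?N + 1" by simp
    have "int N \<le> y + int ?N + 1" by (cases "y \<le> 0") auto
    then have "real_of_int (y + int ?N + 1) \<ge> real N" by linarith
    then have "A / 2 * real N \<le> A / 2 * real_of_int (y + int ?N + 1)" using A_pos by (intro mult_left_mono) auto
    moreover have "isum m (y + int ?N + 1) \<ge> A / 2 * real_of_int (y + int ?N + 1) - K0"
      using K0[of "y + int ?N + 1"] pos by (simp add: abs_le_iff algebra_simps)
    moreover have "0 \<le> A / 2 * \<bar>real_of_int (y + 1)\<bar>" using A_pos by simp
    ultimately show "K < (\<Sum>i\<le>?N. m (y + int i))"
      unfolding isum_right using N by linarith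
  qed
  obtain N where N: "A / 2 * real N > K + K0 + \<bar>isum m (y + 1)\<bar>" using big by blast
  let ?N = "N + nat y"
  show "\<exists>N. K < (\<Sum>i\<le>N. m (y - int i))"
  proof
    have neg: "y - int ?N \<le> 0" by simp
    have "int N \<le> - (y - int ?N)" by (cases "y \<le> 0") auto
    then have "- real_of_int (y - int ?N) \<ge> real N" by linarith
    then have "A / 2 * real N \<le> A / 2 * (- real_of_int (y - int ?N))" using A_pos by (intro mult_left_mono) auto
    moreover have "isum m (y - int ?N) \<le> A / 2 * real_of_int (y - int ?N) + K0"
      using K0[of "y - int ?N"] neg by (simp add: abs_le_iff algebra_simps)
    ultimately show "K < (\<Sum>i\<le>?N. m (y - int i))"
      unfolding isum_left using N by linarith
  qed
qed

end

sublocale averaged_conductances \<subseteq> recurrent_conductances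
  by unfold_locales (fact mass_unbounded)+

context averaged_conductances
begin

text \<open>Windows of length of order \<open>sqrt n\<close> have mass and resistance of order \<open>sqrt n\<close>, and
  \<open>1 - s\<close> is of order \<open>1 / n\<close>. So both terms of \<open>green_diag_le\<close> are of order \<open>sqrt n\<close>.\<close>

lemma green_diag_bound:
  assumes a: "0 < a"
  shows "\<exists>C>0. eventually (\<lambda>n. \<forall>y. \<bar>real_of_int y\<bar> \<le> L * sqrt (real n) \<longrightarrow>
    green (exp (- a / real n)) y y \<le> C * sqrt (real n)) sequentially"
proof -
  define l where "l = \<bar>L\<bar> + 2"
  obtain K1 where K1: "\<And>x. \<bar>isum m x - A * x\<bar> \<le> A / 2 * \<bar>real_of_int x\<bar> + K1"
    using avg_m[of "A / 2"] A_pos by auto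
  obtain K2 where K2: "\<And>x. \<bar>isum (\<lambda>x. 1 / c x) x - B * x\<bar> \<le> B * \<bar>real_of_int x\<bar> + K2"
    using avg_r[OF B_pos] by auto
  have low: "A / 2 * x - K1 \<le> isum m x" if "0 \<le> x" for x
    using K1[of x] that by (simp add: abs_le_iff)
  have up: "isum m x \<le> A / 2 * x + K1" if "x \<le> 0" for x
    using K1[of x] that by (simp add: abs_le_iff)
  define C where "C = 4 / (a * A) + 3 * (5 * B * l)"
  have "0 < C" using a A_pos B_pos by (simp add: C_def l_def add_pos_nonneg)
  moreover have scale: "eventually (\<lambda>n. 2 * K1 \<le> A / 2 * sqrt (real n)) sequentially"
    "eventually (\<lambda>n. 2 * K2 \<le> B * l * sqrt (real n)) sequentially"
    "eventually (\<lambda>n. 1 \<le> 1 * sqrt (real n)) sequentially"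
    using A_pos B_pos by (intro eventually_scale; simp add: l_def add_nonneg_pos)+
  have "eventually (\<lambda>n. \<forall>y. \<bar>real_of_int y\<bar> \<le> L * sqrt (real n) \<longrightarrow>
    green (exp (- a / real n)) y y \<le> C * sqrt (real n)) sequentially"
    using scale eventually_ge_at_top[of "nat \<lceil>a\<rceil> + 1"]
  proof eventually_elim
    case (elim n)
    have n: "a \<le> real n" "0 < real n" using elim(4) by linarith+
    define s where "s = exp (- a / real n)"
    have s01: "0 < s" "s < 1" using a n by (auto simp: s_def)
    have un: "0 \<le> a / real n" "a / real n \<le> 1" using a n by auto
    have s1: "a / (2 * real n) \<le> 1 - s"
    proof -
      have "s = 1 / exp (a / real n)" by (simp add: s_def exp_minus field_simps)
      also have "\<dots> \<le> 1 / (1 + a / real n)"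
        using un exp_ge_add_one_self[of "a / real n"] by (intro divide_left_mono) auto
      also have "\<dots> \<le> 1 - (a / real n) / 2"
      proof -
        have inv: "1 / (1 + v) \<le> 1 - v / 2" if "0 \<le> v" "v \<le> 1" for v :: real
        proof -
          have "v * v \<le> v" using that by (simp add: mult_left_le)
          then have "1 \<le> (1 - v / 2) * (1 + v)" by (simp add: algebra_simps)
          then show ?thesis using that by (simp add: pos_divide_le_eq)
        qed
        show ?thesis by (rule inv[OF un])
      qed
      finally show ?thesis by simp
    qed
    have s3: "1 / s \<le> 3"
    proof -
      have "1 / s = exp (a / real n)" by (simp add: s_def exp_minus field_simps)
      also have "\<dots> \<le> exp 1" using un by simp
      also have "\<dots> \<le> 3" by (rule exp_le)
      finally show ?thesis .
    qed
    define N where "N = \<lceil>(\<bar>L\<bar> + 1) * sqrt (real n)\<rceil>"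
    have sq: "1 \<le> sqrt (real n)" using elim(3) A_pos by simp
    have N_ge: "(\<bar>L\<bar> + 1) * sqrt (real n) \<le> real_of_int N" by (simp add: N_def)
    have N_le: "real_of_int N \<le> l * sqrt (real n)"
    proof -
      have "real_of_int N \<le> (\<bar>L\<bar> + 1) * sqrt (real n) + 1" unfolding N_def by linarith
      also have "\<dots> \<le> l * sqrt (real n)" using sq by (simp add: l_def distrib_right)
      finally show ?thesis .
    qed
    have N_sq: "sqrt (real n) \<le> real_of_int N"
    proof -
      have "1 * sqrt (real n) \<le> (\<bar>L\<bar> + 1) * sqrt (real n)" by (intro mult_right_mono) auto
      then show ?thesis using N_ge by linarith
    qed
    then have N1: "1 \<le> real_of_int N" using sq by linarith
    have M: "A / 2 * sqrt (real n) \<le> (\<Sum>x\<in>{- N..N}. m x)"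
    proof -
      have "{- N..N} = {- N..<N + 1}" by auto
      then have "(\<Sum>x\<in>{- N..N}. m x) = isum m (N + 1) - isum m (- N)"
        using N1 by (simp add: isum_diff)
      moreover have "isum m (N + 1) \<ge> A / 2 * real_of_int (N + 1) - K1"
        using N1 by (intro low) simp
      moreover have "isum m (- N) \<le> A / 2 * real_of_int (- N) + K1"
        using N1 by (intro up) simp
      moreover have "A * sqrt (real n) \<le> A * real_of_int N"
        using N_sq A_pos by (intro mult_left_mono) auto
      moreover have "A / 2 * real_of_int (N + 1) - A / 2 * real_of_int (- N) = A * real_of_int N + A / 2"
        by (simp add: algebra_simps add_divide_distrib)
      moreover have "A / 2 * sqrt (real n) = A * sqrt (real n) / 2" by simp
      ultimately show ?thesis using elim(1) A_pos by linarith
    qed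
    have R: "(\<Sum>x\<in>{- N..<N}. 1 / c x) \<le> 5 * B * l * sqrt (real n)"
    proof -
      have "(\<Sum>x\<in>{- N..<N}. 1 / c x) = isum (\<lambda>x. 1 / c x) N - isum (\<lambda>x. 1 / c x) (- N)"
        using N1 by (intro isum_diff) simp
      moreover have "isum (\<lambda>x. 1 / c x) N \<le> 2 * (B * real_of_int N) + K2"
        using K2[of N] N1 by (simp add: abs_le_iff)
      moreover have "isum (\<lambda>x. 1 / c x) (- N) \<ge> - (2 * (B * real_of_int N) + K2)"
        using K2[of "- N"] N1 by (simp add: abs_le_iff)
      moreover have "B * real_of_int N \<le> B * (l * sqrt (real n))"
        using N_le B_pos by (intro mult_left_mono) auto
      ultimately show ?thesis using elim(2) by (simp add: mult.assoc)
    qed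
    show ?case
    proof (intro allI impI)
      fix y assume y: "\<bar>real_of_int y\<bar> \<le> L * sqrt (real n)"
      also have "\<dots> \<le> (\<bar>L\<bar> + 1) * sqrt (real n)" by (intro mult_right_mono) auto
      also have "\<dots> \<le> real_of_int N" by (rule N_ge)
      finally have "- N \<le> y" "y \<le> N" by linarith+
      then have "green s y y \<le> 1 / ((1 - s) * (\<Sum>x\<in>{- N..N}. m x)) + (\<Sum>x\<in>{- N..<N}. 1 / c x) / s"
        by (rule green_diag_le[OF s01])
      also have "\<dots> \<le> 1 / (a / (2 * real n) * (A / 2 * sqrt (real n))) + 3 * (5 * B * l * sqrt (real n))"
      proof (intro add_mono)
        show "1 / ((1 - s) * (\<Sum>x\<in>{- N..N}. m x)) \<le> 1 / (a / (2 * real n) * (A / 2 * sqrt (real n)))"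
        proof -
          have "0 < A / 2 * sqrt (real n)" using A_pos n by simp
          moreover from this M have "0 < (\<Sum>x\<in>{- N..N}. m x)" by linarith
          ultimately show ?thesis
            using s01 s1 M a n A_pos by (intro divide_left_mono mult_mono mult_pos_pos) simp_all
        qed
        have "0 \<le> (\<Sum>x\<in>{- N..<N}. 1 / c x)" by (intro sum_nonneg) (simp add: less_imp_le[OF c_pos])
        then have "(1 / s) * (\<Sum>x\<in>{- N..<N}. 1 / c x) \<le> 3 * (5 * B * l * sqrt (real n))"
          using s3 R s01 by (intro mult_mono) auto
        then show "(\<Sum>x\<in>{- N..<N}. 1 / c x) / s \<le> 3 * (5 * B * l * sqrt (real n))" by simp
      qed
      also have "1 / (a / (2 * real n) * (A / 2 * sqrt (real n))) = 4 / (a * A) * sqrt (real n)"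
      proof -
        have "real n = sqrt (real n) * sqrt (real n)" using n by simp
        then show ?thesis using a A_pos sq n by (simp add: field_simps)
      qed
      finally show "green (exp (- a / real n)) y y \<le> C * sqrt (real n)"
        by (simp add: s_def C_def algebra_simps)
    qed
  qed
  ultimately show ?thesis by blast
qed

lemma green_sums_even:
  assumes s: "0 < s" "s < 1" and even: "even (z - y)"
  shows "(\<lambda>j. s ^ (2 * j) * kernel y (2 * j) z) sums green s y z"
proof -
  have "(\<lambda>n. s ^ n * kernel y n z) sums green s y z"
    unfolding green_def by (intro summable_sums summable_green s)
  moreover have "s ^ n * kernel y n z = 0" if "n \<notin> range (\<lambda>j. 2 * j)" for n
  proof -
    have "odd n" using that by (auto elim: evenE)
    then show ?thesis using kernel_parity[of z y n] even by simp
  qed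
  ultimately show ?thesis
    by (subst sums_mono_reindex[of "\<lambda>j. 2 * j"]) (auto simp: strict_mono_def)
qed

text \<open>The Green function is the sum of at least \<open>n\<close> terms that are no smaller than the return density at
  time \<open>n\<close>, up to the factor \<open>exp 1\<close>.\<close>

lemma return_density_bound:
  "\<exists>C>0. eventually (\<lambda>n. \<forall>y. \<bar>real_of_int y\<bar> \<le> L * sqrt (real n) \<longrightarrow> return_density y n \<le> C / sqrt (real n)) sequentially"
proof -
  obtain C where C: "0 < C" "eventually (\<lambda>n. \<forall>y. \<bar>real_of_int y\<bar> \<le> L * sqrt (real n) \<longrightarrow>
    green (exp (- (1/2) / real n)) y y \<le> C * sqrt (real n)) sequentially"
    using green_diag_bound[of "1/2" L] by auto
  have "eventually (\<lambda>n. \<forall>y. \<bar>real_of_int y\<bar> \<le> L * sqrt (real n) \<longrightarrow> return_density y n \<le> (3 * C) / sqrt (real n)) sequentially"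
    using C(2) eventually_gt_at_top[of 0]
  proof eventually_elim
    case (elim n)
    show ?case
    proof (intro allI impI)
      fix y assume "\<bar>real_of_int y\<bar> \<le> L * sqrt (real n)"
      define s where "s = exp (- (1/2) / real n)"
      have s: "0 < s" "s < 1" using elim(2) by (auto simp: s_def)
      have s2: "s ^ (2 * n) = exp (- 1)"
        using elim(2) exp_of_nat_mult[of "2 * n" "- (1/2) / real n"] by (simp add: s_def)
      have "real n * (exp (- 1) * return_density y n) \<le> (\<Sum>j<n. s ^ (2 * j) * kernel y (2 * j) y)"
      proof -
        have "(\<Sum>j<n. exp (- 1) * return_density y n) \<le> (\<Sum>j<n. s ^ (2 * j) * kernel y (2 * j) y)"
        proof (rule sum_mono)
          fix j assume j: "j \<in> {..<n}"
          have "exp (- 1) \<le> s ^ (2 * j)"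
            unfolding s2[symmetric] using s j by (intro power_decreasing) auto
          moreover have "return_density y n \<le> kernel y (2 * j) y"
            unfolding return_density_def[symmetric] using j by (intro lift_Suc_antimono_le[of "return_density y", OF return_density_antimono]) auto
          ultimately show "exp (- 1) * return_density y n \<le> s ^ (2 * j) * kernel y (2 * j) y"
            using s by (intro mult_mono) (auto simp: return_density_nonneg)
        qed
        then show ?thesis by simp
      qed
      also have "\<dots> \<le> green s y y"
      proof -
        have sums: "(\<lambda>j. s ^ (2 * j) * kernel y (2 * j) y) sums green s y y"
          by (rule green_sums_even[OF s]) simp
        show ?thesis
          unfolding sums_unique[OF sums]
          using s by (intro sum_le_suminf sums_summable[OF sums]) (auto simp: kernel_nonneg)
      qed
      finally have "real n * (exp (- 1) * return_density y n) \<le> C * sqrt (real n)"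
        using elim(1) \<open>\<bar>real_of_int y\<bar> \<le> L * sqrt (real n)\<close> by (auto simp: s_def intro: order_trans)
      moreover have "real n * Y = sqrt (real n) * (sqrt (real n) * Y)" for Y by (simp flip: mult.assoc)
      ultimately have "sqrt (real n) * (sqrt (real n) * (exp (- 1) * return_density y n)) \<le> sqrt (real n) * C"
        by (simp only: mult.commute[of C])
      then have "sqrt (real n) * (exp (- 1) * return_density y n) \<le> C" using elim(2) by simp
      then have "exp 1 * (exp (- 1) * (sqrt (real n) * return_density y n)) \<le> exp 1 * C"
        by (simp add: mult_ac)
      also have "exp 1 * C \<le> 3 * C" using exp_le C(1) by simp
      also have "exp 1 * (exp (- 1) * (sqrt (real n) * return_density y n)) = sqrt (real n) * return_density y n"
        by (simp flip: mult.assoc exp_add)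
      finally have "sqrt (real n) * return_density y n \<le> 3 * C" .
      then show "return_density y n \<le> (3 * C) / sqrt (real n)" using elim(2) by (simp add: pos_le_divide_eq mult.commute)
    qed
  qed
  then show ?thesis using C(1) by (intro exI[of _ "3 * C"]) auto
qed

text \<open>The parameter \<open>u\<close> is the solution of \<open>4 * (sinh (u / 2))\<^sup>2 = (exp (a / n) - 1) * (A * B)\<close>,
  i.e. \<open>exp (- u)\<close> is the ratio \<open>q\<close> of the homogeneous Green function.\<close>

lemma u_scaling:
  assumes "0 < a"
  shows "(\<lambda>n. sqrt (real n) * (2 * arsinh (sqrt ((exp (a / real n) - 1) * (A * B)) / 2))) \<longlonglongrightarrow> sqrt (a * (A * B))"
proof -
  define D where "D = A * B"
  have D: "0 < D" using A_pos B_pos by (simp add: D_def)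
  define x where "x n = sqrt ((exp (a / real n) - 1) * D) / 2" for n
  have x_pos: "0 < x n" if "0 < n" for n using assms D that by (simp add: x_def)
  have lim: "(\<lambda>n. real n * (exp (a / real n) - 1)) \<longlonglongrightarrow> a"
    using assms by real_asymp
  have "(\<lambda>n. exp (a / real n) - 1) \<longlonglongrightarrow> 0"
    using assms by real_asymp
  then have "(\<lambda>n. sqrt ((exp (a / real n) - 1) * D) / 2) \<longlonglongrightarrow> sqrt (0 * D) / 2"
    by (intro tendsto_intros) simp_all
  then have "x \<longlonglongrightarrow> 0" by (simp add: x_def[abs_def])
  moreover have "eventually (\<lambda>n. 0 < x n) sequentially"
    using eventually_gt_at_top[of 0] by eventually_elim (rule x_pos)
  ultimately have x0: "filterlim x (at_right 0) sequentially"
    by (rule tendsto_imp_filterlim_at_right)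
  have "((\<lambda>x. arsinh x / x) \<longlongrightarrow> (1::real)) (at_right 0)"
    unfolding arsinh_real_def by real_asymp
  then have "(\<lambda>n. arsinh (x n) / x n) \<longlonglongrightarrow> 1"
    by (rule filterlim_compose[OF _ x0])
  moreover have "(\<lambda>n. sqrt (real n * (exp (a / real n) - 1) * D)) \<longlonglongrightarrow> sqrt (a * D)"
    by (intro tendsto_intros lim)
  ultimately have "(\<lambda>n. sqrt (real n * (exp (a / real n) - 1) * D) * (arsinh (x n) / x n)) \<longlonglongrightarrow> sqrt (a * D) * 1"
    by (intro tendsto_mult)
  moreover have "eventually (\<lambda>n. sqrt (real n * (exp (a / real n) - 1) * D) * (arsinh (x n) / x n)
      = sqrt (real n) * (2 * arsinh (sqrt ((exp (a / real n) - 1) * (A * B)) / 2))) sequentially"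
    using eventually_gt_at_top[of 0]
  proof eventually_elim
    case (elim n)
    have "sqrt (real n * (exp (a / real n) - 1) * D) = sqrt (real n) * (2 * x n)"
      by (simp add: x_def real_sqrt_mult)
    then show ?case using x_pos[OF elim] by (simp add: x_def D_def)
  qed
  ultimately show ?thesis using Lim_transform_eventually by (fastforce simp: D_def)
qed

text \<open>The error terms of \<open>green_homogenization\<close> are of two kinds. Those with \<open>E\<close> are \<open>o(sqrt n)\<close>
  for a fixed window \<open>\<bar>x\<bar> \<le> L * sqrt n\<close> by the convergence of averages. Those from the boundary are of
  order \<open>sqrt n * exp (- \<kappa> * (L - \<bar>\<zeta>\<bar>))\<close>, which is small when \<open>L\<close> is large.\<close>

lemma green_scaling:
  fixes z :: "nat \<Rightarrow> int"
  assumes a: "0 < a" and z: "(\<lambda>n. real_of_int (z n) / sqrt (real n)) \<longlonglongrightarrow> \<zeta>"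
  shows "(\<lambda>n. green (exp (- a / real n)) 0 (z n) / sqrt (real n))
    \<longlonglongrightarrow> sqrt (B / (A * a)) / 2 * exp (- \<bar>\<zeta>\<bar> * sqrt (a * (A * B)))"
proof -
  define s where "s n = exp (- a / real n)" for n
  define \<theta> where "\<theta> n = exp (a / real n) - 1" for n
  define u where "u n = 2 * arsinh (sqrt (\<theta> n * (A * B)) / 2)" for n
  define q where "q n = exp (- u n)" for n
  define C where "C n = B / (1 / q n - q n)" for n
  define \<kappa> where "\<kappa> = sqrt (a * (A * B))"
  have AB: "0 < A * B" using A_pos B_pos by simp
  have \<kappa>: "0 < \<kappa>" using a AB by (simp add: \<kappa>_def)
  have s: "0 < s n" "s n < 1" if "0 < n" for n using a that by (auto simp: s_def)
  have \<theta>_eq: "1 / s n - 1 = \<theta> n" for n by (simp add: s_def \<theta>_def exp_minus field_simps)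
  have \<theta>_pos: "0 < \<theta> n" if "0 < n" for n using a that by (simp add: \<theta>_def)
  have u_pos: "0 < u n" if "0 < n" for n using \<theta>_pos[OF that] AB by (simp add: u_def)
  have q: "0 < q n" "q n < 1" if "0 < n" for n using u_pos[OF that] by (auto simp: q_def)
  have q_eq: "q n + 1 / q n - 2 = (1 / s n - 1) * A * B" if "0 < n" for n
  proof -
    have "q n + 1 / q n - 2 = 4 * (sinh (u n / 2))\<^sup>2"
    proof -
      have "exp (u n) = exp (u n / 2) * exp (u n / 2)" "exp (- u n) = exp (- (u n / 2)) * exp (- (u n / 2))"
        "exp (u n / 2) * exp (- (u n / 2)) = 1"
        by (simp_all flip: exp_add)
      then show ?thesis
        by (simp add: q_def sinh_def exp_minus power2_eq_square field_simps)
    qed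
    also have "\<dots> = \<theta> n * (A * B)" using \<theta>_pos[OF that] AB by (simp add: u_def power_divide)
    finally show ?thesis unfolding \<theta>_eq by simp
  qed
  have u_lim: "(\<lambda>n. sqrt (real n) * u n) \<longlonglongrightarrow> \<kappa>"
    using u_scaling[OF a] by (simp add: u_def \<theta>_def \<kappa>_def)
  have s_lim: "s \<longlonglongrightarrow> 1" unfolding s_def[abs_def] using a by real_asymp
  have \<theta>_lim: "(\<lambda>n. real n * \<theta> n) \<longlonglongrightarrow> a" unfolding \<theta>_def using a by real_asymp
  have sqrt_top: "filterlim (\<lambda>n. sqrt (real n)) at_top sequentially"
    by (rule filterlim_compose[OF sqrt_at_top filterlim_real_sequentially])
  have C_lim: "(\<lambda>n. C n / sqrt (real n)) \<longlonglongrightarrow> B / (2 * \<kappa>)"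
  proof -
    have "(\<lambda>n. sqrt (real n) * u n / sqrt (real n)) \<longlonglongrightarrow> 0"
      by (rule real_tendsto_divide_at_top[OF u_lim sqrt_top])
    moreover have "eventually (\<lambda>n. sqrt (real n) * u n / sqrt (real n) = u n) sequentially"
      using eventually_gt_at_top[of 0] by eventually_elim simp
    ultimately have "u \<longlonglongrightarrow> 0" by (rule Lim_transform_eventually)
    moreover have "eventually (\<lambda>n. 0 < u n) sequentially"
      using eventually_gt_at_top[of 0] by eventually_elim (rule u_pos)
    ultimately have u0: "filterlim u (at_right 0) sequentially"
      by (rule tendsto_imp_filterlim_at_right)
    have "((\<lambda>u. (exp u - exp (- u)) / u) \<longlongrightarrow> (2::real)) (at_right 0)" by real_asymp
    then have "(\<lambda>n. (exp (u n) - exp (- u n)) / u n) \<longlonglongrightarrow> 2" by (rule filterlim_compose[OF _ u0])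
    then have "(\<lambda>n. B / ((sqrt (real n) * u n) * ((exp (u n) - exp (- u n)) / u n))) \<longlonglongrightarrow> B / (\<kappa> * 2)"
      using \<kappa> by (intro tendsto_divide tendsto_mult tendsto_const u_lim) simp_all
    moreover have "eventually (\<lambda>n. B / ((sqrt (real n) * u n) * ((exp (u n) - exp (- u n)) / u n)) = C n / sqrt (real n)) sequentially"
      using eventually_gt_at_top[of 0]
    proof eventually_elim
      case (elim n)
      have "1 / q n - q n = exp (u n) - exp (- u n)" by (simp add: q_def exp_minus field_simps)
      then show ?case using u_pos[OF elim] by (simp add: C_def mult.commute)
    qed
    ultimately show ?thesis using Lim_transform_eventually by (fastforce simp: mult.commute)
  qed
  have q_lim: "(\<lambda>n. q n ^ nat (k n)) \<longlonglongrightarrow> exp (- \<kappa> * y)"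
    if k: "(\<lambda>n. real_of_int (k n) / sqrt (real n)) \<longlonglongrightarrow> y" and pos: "eventually (\<lambda>n. 0 \<le> k n) sequentially"
    for k :: "nat \<Rightarrow> int" and y
  proof -
    have "(\<lambda>n. exp (- (sqrt (real n) * u n) * (real_of_int (k n) / sqrt (real n)))) \<longlonglongrightarrow> exp (- \<kappa> * y)"
      by (intro tendsto_exp tendsto_mult tendsto_minus u_lim k)
    moreover have "eventually (\<lambda>n. exp (- (sqrt (real n) * u n) * (real_of_int (k n) / sqrt (real n))) = q n ^ nat (k n)) sequentially"
      using pos eventually_gt_at_top[of 0]
    proof eventually_elim
      case (elim n)
      have "q n ^ nat (k n) = exp (real (nat (k n)) * - u n)" unfolding q_def by (rule exp_of_nat_mult[symmetric])
      also have "real (nat (k n)) * - u n = - (sqrt (real n) * u n) * (real_of_int (k n) / sqrt (real n))"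
        using elim by (simp add: field_simps)
      finally show ?case by simp
    qed
    ultimately show ?thesis by (rule Lim_transform_eventually)
  qed
  have z_abs: "(\<lambda>n. real_of_int \<bar>z n\<bar> / sqrt (real n)) \<longlonglongrightarrow> \<bar>\<zeta>\<bar>"
    using tendsto_rabs[OF z] by (simp add: abs_divide)
  have main: "(\<lambda>n. C n / sqrt (real n) * q n ^ nat \<bar>z n\<bar> / s n) \<longlonglongrightarrow> B / (2 * \<kappa>) * exp (- \<kappa> * \<bar>\<zeta>\<bar>) / 1"
    by (intro tendsto_divide tendsto_mult C_lim q_lim[OF z_abs] s_lim) auto
  obtain C2 where C2: "0 < C2" and ev_C2: "eventually (\<lambda>n. \<forall>y. \<bar>real_of_int y\<bar> \<le> 0 * sqrt (real n) \<longrightarrow>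
    green (exp (- a / real n)) y y \<le> C2 * sqrt (real n)) sequentially"
    using green_diag_bound[OF a, of 0] by blast
  define C1 where "C1 = B / (2 * \<kappa>) + 1"
  have C1: "0 < C1" using B_pos \<kappa> by (simp add: C1_def add_nonneg_pos)
  define K where "K = 4 * (C1 + 4) + C2 + 8 + 12 * a * C1 * C2"
  have K: "0 < K" using C1 C2 a by (simp add: K_def add_pos_pos)
  have err: "eventually (\<lambda>n. \<bar>green (s n) 0 (z n) / sqrt (real n) - C n / sqrt (real n) * q n ^ nat \<bar>z n\<bar> / s n\<bar> \<le> K * e) sequentially"
    if e: "0 < e" for e
  proof -
    \<comment> \<open>large enough to make the boundary terms smaller than \<open>e\<close>, see \<open>Le\<close>\<close>
    define L where "L = \<bar>\<zeta>\<bar> + 1 + \<bar>ln e\<bar> / \<kappa>"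
    have L: "\<bar>\<zeta>\<bar> < L" "0 < L" using \<kappa> by (auto simp: L_def add_pos_nonneg add_nonneg_pos)
    have Le: "exp (- \<kappa> * (L - \<bar>\<zeta>\<bar>)) < e"
    proof -
      have "- \<kappa> * (L - \<bar>\<zeta>\<bar>) = - \<kappa> - \<bar>ln e\<bar>" using \<kappa> by (simp add: L_def field_simps)
      also have "\<dots> < ln e" using \<kappa> by linarith
      finally show ?thesis using e by (metis exp_less_mono exp_ln)
    qed
    define N where "N n = \<lfloor>L * sqrt (real n)\<rfloor>" for n
    have N_lim: "(\<lambda>n. real_of_int (N n) / sqrt (real n)) \<longlonglongrightarrow> L"
    proof (rule tendsto_sandwich)
      show "eventually (\<lambda>n. L - 1 / sqrt (real n) \<le> real_of_int (N n) / sqrt (real n)) sequentially"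
        using eventually_gt_at_top[of 0]
      proof eventually_elim
        case (elim n)
        have "L * sqrt (real n) - 1 \<le> real_of_int (N n)" unfolding N_def by linarith
        then have "(L * sqrt (real n) - 1) / sqrt (real n) \<le> real_of_int (N n) / sqrt (real n)"
          by (rule divide_right_mono) simp
        then show ?case using elim by (simp add: diff_divide_distrib)
      qed
      show "eventually (\<lambda>n. real_of_int (N n) / sqrt (real n) \<le> L) sequentially"
        using eventually_gt_at_top[of 0]
        by eventually_elim (simp add: N_def pos_divide_le_eq)
      show "(\<lambda>n. L - 1 / sqrt (real n)) \<longlonglongrightarrow> L"
        using tendsto_diff[OF tendsto_const real_tendsto_divide_at_top[OF tendsto_const sqrt_top], of L 1] by simp
    qed simp
    have Nz: "eventually (\<lambda>n. \<bar>z n\<bar> \<le> N n) sequentially"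
    proof -
      have "eventually (\<lambda>n. 0 < real_of_int (N n) / sqrt (real n) - real_of_int \<bar>z n\<bar> / sqrt (real n)) sequentially"
        using order_tendstoD(1)[OF tendsto_diff[OF N_lim z_abs], of 0] L by simp
      then show ?thesis
        using eventually_gt_at_top[of 0]
      proof eventually_elim
        case (elim n)
        then have "real_of_int \<bar>z n\<bar> < real_of_int (N n)" by (simp add: divide_less_cancel)
        then show ?case by linarith
      qed
    qed
    have "(\<lambda>n. q n ^ nat (N n - \<bar>z n\<bar>)) \<longlonglongrightarrow> exp (- \<kappa> * (L - \<bar>\<zeta>\<bar>))"
    proof (rule q_lim)
      show "(\<lambda>n. real_of_int (N n - \<bar>z n\<bar>) / sqrt (real n)) \<longlonglongrightarrow> L - \<bar>\<zeta>\<bar>"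
        using tendsto_diff[OF N_lim z_abs] by (simp add: diff_divide_distrib)
      show "eventually (\<lambda>n. 0 \<le> N n - \<bar>z n\<bar>) sequentially" using Nz by eventually_elim simp
    qed
    then have ev_q: "eventually (\<lambda>n. q n ^ nat (N n - \<bar>z n\<bar>) < e) sequentially"
      using Le by (rule order_tendstoD)
    define e0 where "e0 = e / (2 * (L + 1))"
    have e0: "0 < e0" using e L by (simp add: e0_def)
    obtain Km where Km: "\<And>x. \<bar>isum m x - A * x\<bar> \<le> e0 * \<bar>real_of_int x\<bar> + Km" using avg_m[OF e0] by blast
    obtain Kr where Kr: "\<And>x. \<bar>isum (\<lambda>x. 1 / c x) x - B * x\<bar> \<le> e0 * \<bar>real_of_int x\<bar> + Kr" using avg_r[OF e0] by blast
    have ev_C: "eventually (\<lambda>n. C n / sqrt (real n) < C1) sequentially"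
      by (rule order_tendstoD(2)[OF C_lim]) (simp add: C1_def)
    have ev_s: "eventually (\<lambda>n. 1 / 2 < s n) sequentially"
      by (rule order_tendstoD(1)[OF s_lim]) simp
    have ev_\<theta>: "eventually (\<lambda>n. real n * \<theta> n < 2 * a) sequentially"
      by (rule order_tendstoD(2)[OF \<theta>_lim]) (use a in simp)
    have e2: "0 < e / 2" using e by simp
    show ?thesis
      using Nz ev_q ev_C ev_s ev_\<theta> ev_C2 eventually_gt_at_top[of 0] eventually_scale[OF e2, of Km]
        eventually_scale[OF e2, of Kr] eventually_scale[OF zero_less_one, of 1]
    proof eventually_elim
      case (elim n)
      note n = \<open>0 < n\<close>
      define E where "E = e * sqrt (real n)"
      define U0 where "U0 = green (s n) 0 0"
      define p where "p = q n ^ nat (N n - \<bar>z n\<bar>)"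
      have sq: "0 < sqrt (real n)" "1 \<le> sqrt (real n)" using elim by auto
      have E_bound: "e0 * \<bar>real_of_int x\<bar> + K \<le> E" if x: "\<bar>x\<bar> \<le> N n + 1" and K: "K \<le> e / 2 * sqrt (real n)" for x K
      proof -
        have "\<bar>real_of_int x\<bar> \<le> real_of_int (N n) + 1" using x by linarith
        also have "\<dots> \<le> (L + 1) * sqrt (real n)"
        proof -
          have "real_of_int (N n) \<le> L * sqrt (real n)" unfolding N_def by linarith
          then show ?thesis using sq(2) unfolding distrib_right by linarith
        qed
        finally have "e0 * \<bar>real_of_int x\<bar> \<le> e0 * ((L + 1) * sqrt (real n))" using e0 by (intro mult_left_mono) auto
        also have "\<dots> = e / 2 * sqrt (real n)"
        proof -
          have "e0 * (L + 1) = e / 2" unfolding e0_def using L(2) by (simp add: field_simps)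
          then show ?thesis by (simp only: mult.assoc[symmetric])
        qed
        finally show ?thesis using K unfolding E_def by linarith
      qed
      have "\<bar>green (s n) 0 (z n) - C n * q n ^ nat \<bar>z n\<bar> / s n\<bar>
        \<le> 2 * (C n * p + 4 * E) / s n + U0 * p + 4 * E / s n + 6 * (1 / s n - 1) * E * C n * U0"
        unfolding C_def U0_def p_def
      proof (rule green_homogenization[OF s[OF n] A_pos B_pos q[OF n] q_eq[OF n] \<open>\<bar>z n\<bar> \<le> N n\<close>])
        show "\<bar>isum m x - A * x\<bar> \<le> E" if "\<bar>x\<bar> \<le> N n + 1" for x
          using Km[of x] E_bound[OF that, of Km] elim by linarith
        show "\<bar>isum (\<lambda>x. 1 / c x) x - B * x\<bar> \<le> E" if "\<bar>x\<bar> \<le> N n + 1" for x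
          using Kr[of x] E_bound[OF that, of Kr] elim by linarith
      qed
      also have "\<dots> \<le> 2 * (C1 * sqrt (real n) * e + 4 * E) * 2 + C2 * sqrt (real n) * e + 4 * E * 2
          + 6 * (2 * a / real n) * E * (C1 * sqrt (real n)) * (C2 * sqrt (real n))"
      proof -
        have s2: "1 / s n \<le> 2" using elim s[OF n] by (simp add: divide_le_eq)
        have C0: "0 \<le> C n" "C n \<le> C1 * sqrt (real n)"
        proof -
          have "1 < 1 / q n" using q[OF n] by simp
          then have "0 \<le> 1 / q n - q n" using q[OF n] by linarith
          then show "0 \<le> C n" using B_pos unfolding C_def by (intro divide_nonneg_nonneg) simp_all
          show "C n \<le> C1 * sqrt (real n)" using elim sq by (simp add: pos_divide_less_eq)
        qed
        have U: "0 \<le> U0" "U0 \<le> C2 * sqrt (real n)"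
          using green_nonneg[OF s[OF n]] elim by (auto simp: U0_def s_def)
        have p: "0 \<le> p" "p \<le> e" using q[OF n] elim by (auto simp: p_def)
        have E: "0 \<le> E" using e by (simp add: E_def)
        have th: "0 \<le> 1 / s n - 1" "1 / s n - 1 \<le> 2 * a / real n"
          unfolding \<theta>_eq using \<theta>_pos[OF n] elim n by (auto simp: pos_le_divide_eq mult.commute)
        have 1: "2 * (C n * p + 4 * E) * (1 / s n) \<le> 2 * (C1 * sqrt (real n) * e + 4 * E) * 2"
          using C0 p E s2 s[OF n] C1 sq e by (intro mult_mono add_mono order_refl) auto
        have 2: "U0 * p \<le> C2 * sqrt (real n) * e"
          using U p by (intro mult_mono) auto
        have 3: "4 * E * (1 / s n) \<le> 4 * E * 2"
          using E s2 by (intro mult_left_mono) auto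
        have 4: "6 * (1 / s n - 1) * E * C n * U0 \<le> 6 * (2 * a / real n) * E * (C1 * sqrt (real n)) * (C2 * sqrt (real n))"
          using th E C0 U a C1 C2 n by (intro mult_mono mult_nonneg_nonneg order_refl) auto
        show ?thesis using 1 2 3 4 by simp
      qed
      also have "\<dots> = K * e * sqrt (real n)"
      proof -
        have "real n = sqrt (real n) * sqrt (real n)" using n by simp
        then have "6 * (2 * a / real n) * E * (C1 * sqrt (real n)) * (C2 * sqrt (real n)) = 12 * a * C1 * C2 * E"
          using n by (simp add: field_simps)
        then show ?thesis unfolding E_def K_def by (simp add: algebra_simps)
      qed
      finally have "\<bar>green (s n) 0 (z n) - C n * q n ^ nat \<bar>z n\<bar> / s n\<bar> / sqrt (real n) \<le> K * e"
        using sq by (simp add: pos_divide_le_eq)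
      moreover have "green (s n) 0 (z n) / sqrt (real n) - C n / sqrt (real n) * q n ^ nat \<bar>z n\<bar> / s n
        = (green (s n) 0 (z n) - C n * q n ^ nat \<bar>z n\<bar> / s n) / sqrt (real n)"
        by (simp add: diff_divide_distrib)
      ultimately show ?case using sq by (simp add: abs_divide)
    qed
  qed
  have "(\<lambda>n. green (s n) 0 (z n) / sqrt (real n) - C n / sqrt (real n) * q n ^ nat \<bar>z n\<bar> / s n) \<longlonglongrightarrow> 0"
  proof (rule tendstoI)
    fix e :: real assume "0 < e"
    then have "0 < e / (2 * K)" using K by simp
    from err[OF this] show "eventually (\<lambda>n. dist (green (s n) 0 (z n) / sqrt (real n) - C n / sqrt (real n) * q n ^ nat \<bar>z n\<bar> / s n) 0 < e) sequentially"
    proof eventually_elim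
      case (elim n)
      have "K * (e / (2 * K)) = e / 2" using K by simp
      then show ?case using elim \<open>0 < e\<close> by (simp add: dist_real_def)
    qed
  qed
  from tendsto_add[OF this main]
  have "(\<lambda>n. green (s n) 0 (z n) / sqrt (real n)) \<longlonglongrightarrow> B / (2 * \<kappa>) * exp (- \<kappa> * \<bar>\<zeta>\<bar>)" by simp
  moreover have "B / (2 * \<kappa>) = sqrt (B / (A * a)) / 2"
  proof -
    have "B / \<kappa> = sqrt (B\<^sup>2) / sqrt (a * (A * B))" using B_pos by (simp add: \<kappa>_def)
    also have "\<dots> = sqrt (B / (A * a))"
    proof -
      have "B\<^sup>2 / (a * (A * B)) = B / (A * a)"
        using B_pos A_pos a by (simp add: power2_eq_square field_simps)
      then show ?thesis by (simp only: real_sqrt_divide[symmetric])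
    qed
    finally show ?thesis by simp
  qed
  ultimately have "(\<lambda>n. green (s n) 0 (z n) / sqrt (real n))
    \<longlonglongrightarrow> sqrt (B / (A * a)) / 2 * exp (- \<kappa> * \<bar>\<zeta>\<bar>)"
    by (simp only:)
  then show ?thesis by (simp add: s_def[abs_def] \<kappa>_def mult.commute)
qed

end

section \<open>The Laplace transform of the heat kernel\<close>

definition gauss_integral :: "real \<Rightarrow> real" where
  "gauss_integral x = (LBINT y=0..x. exp (- y\<^sup>2))"

lemma gauss_integral_deriv: "(gauss_integral has_real_derivative exp (- x\<^sup>2)) (at x)"
proof -
  let ?a = "- \<bar>x\<bar> - 1" and ?b = "\<bar>x\<bar> + 1"
  have "((\<lambda>u. LBINT y=0..u. exp (- y\<^sup>2)) has_vector_derivative exp (- x\<^sup>2)) (at x within {?a..?b})"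
    unfolding zero_ereal_def
    by (rule interval_integral_FTC2) (auto intro!: continuous_intros)
  moreover have "at x within {?a..?b} = at x"
    by (rule at_within_interior) (simp add: abs_less_iff, arith?)
  ultimately show ?thesis
    by (simp add: gauss_integral_def[abs_def] has_real_derivative_iff_has_vector_derivative)
qed

lemma gauss_integral_minus: "gauss_integral (- x) = - gauss_integral x"
proof -
  have "gauss_integral (- x) = (LBINT y=- 0..- ereal x. exp (- y\<^sup>2))"
    by (simp add: gauss_integral_def)
  also have "\<dots> = (LBINT y=ereal x..0. exp (- y\<^sup>2))"
    by (subst interval_integral_reflect) simp
  also have "\<dots> = - gauss_integral x"
    unfolding gauss_integral_def by (rule interval_integral_endpoints_reverse)
  finally show ?thesis .
qed

lemma gauss_integral_at_top: "(gauss_integral \<longlongrightarrow> sqrt pi / 2) at_top"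
proof -
  let ?f = "\<lambda>x::real. indicator {0..} x *\<^sub>R exp (- x\<^sup>2)"
  have f: "integrable lborel ?f" "integral\<^sup>L lborel ?f = sqrt pi / 2"
    using gaussian_moment_0 by (auto simp: has_bochner_integral_iff)
  have "((\<lambda>y. \<integral>x. indicator {..y} x *\<^sub>R ?f x \<partial>lborel) \<longlongrightarrow> sqrt pi / 2) at_top"
    using tendsto_integral_at_top[of lborel ?f, OF _ f(1)] unfolding f(2) by simp
  moreover have "eventually (\<lambda>y. (\<integral>x. indicator {..y} x *\<^sub>R ?f x \<partial>lborel) = gauss_integral y) at_top"
    using eventually_ge_at_top[of 0]
  proof eventually_elim
    case (elim y)
    have "gauss_integral y = (LBINT x:{0..y}. exp (- x\<^sup>2))"
      unfolding gauss_integral_def zero_ereal_def using elim by (rule interval_integral_Icc)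
    also have "\<dots> = (\<integral>x. indicator {..y} x *\<^sub>R ?f x \<partial>lborel)"
      unfolding set_lebesgue_integral_def by (intro Bochner_Integration.integral_cong) (auto simp: indicator_def)
    finally show ?case by simp
  qed
  ultimately show ?thesis by (rule Lim_transform_eventually)
qed

lemma gauss_integral_at_bot: "(gauss_integral \<longlongrightarrow> - (sqrt pi / 2)) at_bot"
proof -
  have "((\<lambda>x. - gauss_integral (- x)) \<longlongrightarrow> - (sqrt pi / 2)) at_bot"
    by (intro tendsto_minus filterlim_compose[OF gauss_integral_at_top] filterlim_uminus_at_top_at_bot)
  then show ?thesis by (simp add: gauss_integral_minus)
qed

lemma gauss_integral_0 [simp]: "gauss_integral 0 = 0"
  using gauss_integral_minus[of 0] by simp

lemma tendsto_gauss_integral: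
  "(f \<longlongrightarrow> x) F \<Longrightarrow> ((\<lambda>t. gauss_integral (f t)) \<longlongrightarrow> gauss_integral x) F"
  by (rule isCont_tendsto_compose[OF DERIV_isCont[OF gauss_integral_deriv]])

text \<open>With \<open>p = sqrt (l * t) + sqrt (b / t)\<close> and \<open>r = sqrt (l * t) - sqrt (b / t)\<close> one has
  \<open>p\<^sup>2 = l * t + b / t + 2 * sqrt (b * l)\<close> and
  \<open>r\<^sup>2 = l * t + b / t - 2 * sqrt (b * l)\<close>. So a suitable combination of the error function at
  \<open>p\<close> and at \<open>r\<close> is a primitive of the integrand. The limit at \<open>0\<close> differs when \<open>b = 0\<close>, as then
  \<open>r\<close> does not go to \<open>- \<infinity>\<close>, but the value of the integral does not.\<close>

lemma laplace_heat_kernel: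
  fixes l b :: real
  assumes l: "0 < l" and b: "0 \<le> b"
  shows "set_integrable lborel {0<..} (\<lambda>t. exp (- l * t) * (exp (- b / t) / sqrt t))"
    and "(LBINT t:{0<..}. exp (- l * t) * (exp (- b / t) / sqrt t)) = sqrt (pi / l) * exp (- 2 * sqrt (b * l))"
proof -
  define p where "p t = sqrt l * sqrt t + sqrt b / sqrt t" for t
  define r where "r t = sqrt l * sqrt t - sqrt b / sqrt t" for t
  define e where "e = exp (2 * sqrt (b * l))"
  define F where "F t = (e * gauss_integral (p t) + inverse e * gauss_integral (r t)) / sqrt l" for t
  let ?f = "\<lambda>t. exp (- l * t) * (exp (- b / t) / sqrt t)"
  let ?h = "sqrt pi / 2"
  have e: "0 < e" by (simp add: e_def)
  have sl: "0 < sqrt l" using l by simp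
  have deriv: "(F has_real_derivative ?f t) (at t)" if t: "0 < t" for t
  proof -
    have st: "0 < sqrt t" "sqrt t * sqrt t = t" using t by auto
    have dp: "(p has_real_derivative (sqrt l - sqrt b / t) / (2 * sqrt t)) (at t)"
      unfolding p_def[abs_def]
      by (rule derivative_eq_intros refl | use t in \<open>simp; fail\<close>)+
        (use t in \<open>simp add: field_simps power2_eq_square\<close>)
    have dr: "(r has_real_derivative (sqrt l + sqrt b / t) / (2 * sqrt t)) (at t)"
      unfolding r_def[abs_def]
      by (rule derivative_eq_intros refl | use t in \<open>simp; fail\<close>)+
        (use t in \<open>simp add: field_simps power2_eq_square\<close>)
    have "(F has_real_derivative (e * (exp (- (p t)\<^sup>2) * ((sqrt l - sqrt b / t) / (2 * sqrt t)))
        + inverse e * (exp (- (r t)\<^sup>2) * ((sqrt l + sqrt b / t) / (2 * sqrt t)))) / sqrt l) (at t)"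
      unfolding F_def[abs_def]
      by (intro DERIV_cdivide DERIV_add DERIV_cmult DERIV_chain2[OF gauss_integral_deriv] dp dr)
    moreover have "e * exp (- (p t)\<^sup>2) = exp (- l * t) * exp (- b / t)"
    proof -
      have "(p t)\<^sup>2 = l * t + b / t + 2 * sqrt (b * l)"
        using t l b by (simp add: p_def power2_eq_square field_simps real_sqrt_mult)
      then show ?thesis by (simp add: e_def flip: exp_add)
    qed
    moreover have "inverse e * exp (- (r t)\<^sup>2) = exp (- l * t) * exp (- b / t)"
    proof -
      have "(r t)\<^sup>2 = l * t + b / t - 2 * sqrt (b * l)"
        using t l b by (simp add: r_def power2_eq_square field_simps real_sqrt_mult)
      then show ?thesis by (simp add: e_def flip: exp_add exp_minus)
    qed
    moreover have "(E * ((sqrt l - sqrt b / t) / (2 * sqrt t)) + E * ((sqrt l + sqrt b / t) / (2 * sqrt t))) / sqrt l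
       = E / sqrt t" for E
    proof -
      have "(E * ((sqrt l - sqrt b / t) / (2 * sqrt t)) + E * ((sqrt l + sqrt b / t) / (2 * sqrt t)))
        = E * (sqrt l / sqrt t)"
        by (simp add: algebra_simps flip: add_divide_distrib distrib_left)
      then show ?thesis using sl by simp
    qed
    ultimately show ?thesis
      by (simp only: mult.assoc[symmetric] times_divide_eq_right)
  qed
  have at_0: "(F \<longlongrightarrow> (e * ?h + inverse e * (- ?h)) / sqrt l) (at_right 0)" if "0 < b"
  proof -
    have s0: "filterlim sqrt (at_right 0) (at_right (0::real))"
      unfolding filterlim_at by (intro conjI tendsto_eq_intros) (auto simp: eventually_at_filter)
    have l0: "((\<lambda>t. sqrt l * sqrt t) \<longlongrightarrow> sqrt l * sqrt 0) (at_right 0)"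
      by (intro tendsto_intros)
    have inv: "filterlim (\<lambda>t. sqrt b / sqrt t) at_top (at_right 0)"
      unfolding divide_inverse
      by (intro filterlim_tendsto_pos_mult_at_top[OF tendsto_const] filterlim_compose[OF filterlim_inverse_at_top_right s0])
        (use that in simp)
    have "filterlim p at_top (at_right 0)"
      unfolding p_def by (rule filterlim_tendsto_add_at_top[OF l0 inv])
    moreover have "filterlim (\<lambda>t. - (sqrt b / sqrt t) + sqrt l * sqrt t) at_bot (at_right 0)"
      using filterlim_tendsto_add_at_top[OF tendsto_minus[OF l0] inv]
      by (simp add: filterlim_uminus_at_bot)
    then have "filterlim r at_bot (at_right 0)"
      by (simp add: r_def[abs_def])
    ultimately have "filterlim p at_top (at_right 0)" "filterlim r at_bot (at_right 0)" .
    then show ?thesis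
      unfolding F_def
      by (intro tendsto_divide tendsto_add tendsto_mult tendsto_const filterlim_compose[OF gauss_integral_at_top]
        filterlim_compose[OF gauss_integral_at_bot]) (use sl in auto)
  qed
  have at_0': "(F \<longlongrightarrow> 0) (at_right 0)" if "b = 0"
  proof -
    have "((\<lambda>t. (e * gauss_integral (sqrt l * sqrt t) + inverse e * gauss_integral (sqrt l * sqrt t)) / sqrt l)
        \<longlongrightarrow> (e * gauss_integral (sqrt l * sqrt 0) + inverse e * gauss_integral (sqrt l * sqrt 0)) / sqrt l) (at_right 0)"
      by (intro tendsto_divide tendsto_add tendsto_mult tendsto_const tendsto_gauss_integral tendsto_real_sqrt tendsto_ident_at)
        (use sl in auto)
    then show ?thesis using that by (simp add: F_def[abs_def] p_def r_def)
  qed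
  have at_top: "(F \<longlongrightarrow> (e * ?h + inverse e * ?h) / sqrt l) at_top"
  proof -
    have l_top: "filterlim (\<lambda>t. sqrt l * sqrt t) at_top at_top"
      by (intro filterlim_tendsto_pos_mult_at_top[OF tendsto_const] sl sqrt_at_top)
    have b_0: "((\<lambda>t. sqrt b / sqrt t) \<longlongrightarrow> 0) at_top"
      by (intro tendsto_divide_0[OF tendsto_const] filterlim_at_top_imp_at_infinity sqrt_at_top)
    have "filterlim p at_top at_top"
      unfolding p_def using filterlim_tendsto_add_at_top[OF b_0 l_top] by (simp add: add.commute)
    moreover have "filterlim r at_top at_top"
      unfolding r_def using filterlim_tendsto_add_at_top[OF tendsto_minus[OF b_0] l_top] by simp
    ultimately have "filterlim p at_top at_top" "filterlim r at_top at_top" .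
    then show ?thesis
      unfolding F_def
      by (intro tendsto_divide tendsto_add tendsto_mult tendsto_const filterlim_compose[OF gauss_integral_at_top])
        (use sl in auto)
  qed
  define A where "A = (if b = 0 then 0 else (e * ?h + inverse e * (- ?h)) / sqrt l)"
  have A: "(F \<longlongrightarrow> A) (at_right 0)"
    using at_0 at_0' b by (auto simp: A_def)
  have ei: "einterval 0 \<infinity> = {0::real<..}" by (auto simp: einterval_def)
  have lim_0: "((F \<circ> real_of_ereal) \<longlongrightarrow> A) (at_right 0)"
    using A unfolding zero_ereal_def ereal_tendsto_simps .
  have lim_top: "((F \<circ> real_of_ereal) \<longlongrightarrow> (e * ?h + inverse e * ?h) / sqrt l) (at_left \<infinity>)"
    using at_top unfolding ereal_tendsto_simps .
  have "set_integrable lborel (einterval 0 \<infinity>) ?f"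
    by (rule interval_integral_FTC_nonneg(1)[OF _ _ _ _ lim_0 lim_top])
      (use deriv in \<open>auto intro!: continuous_intros AE_I2\<close>)
  moreover have "(LBINT t=0..\<infinity>. ?f t) = (e * ?h + inverse e * ?h) / sqrt l - A"
    by (rule interval_integral_FTC_nonneg(2)[OF _ _ _ _ lim_0 lim_top])
      (use deriv in \<open>auto intro!: continuous_intros AE_I2\<close>)
  moreover have "(e * ?h + inverse e * ?h) / sqrt l - A = sqrt (pi / l) * inverse e"
  proof (cases "b = 0")
    case True
    then have "e = 1" by (simp add: e_def)
    then show ?thesis using True by (simp add: A_def real_sqrt_divide)
  next
    case False
    then show ?thesis
      using sl by (simp add: A_def real_sqrt_divide field_simps)
  qed
  moreover have "inverse e = exp (- 2 * sqrt (b * l))" by (simp add: e_def exp_minus)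
  moreover have "(LBINT t=0..\<infinity>. ?f t) = (LBINT t:{0<..}. ?f t)"
    by (simp add: interval_lebesgue_integral_def ei)
  ultimately show "set_integrable lborel {0<..} ?f"
    "(LBINT t:{0<..}. ?f t) = sqrt (pi / l) * exp (- 2 * sqrt (b * l))"
    by (simp_all add: ei)
qed

section \<open>A Tauberian theorem\<close>

lemma set_lebesgue_integral_sum:
  fixes f :: "'i \<Rightarrow> 'a \<Rightarrow> real"
  assumes "finite I" "\<And>i. i \<in> I \<Longrightarrow> set_integrable M S (f i)"
  shows "set_integrable M S (\<lambda>x. \<Sum>i\<in>I. f i x)"
    and "(LINT x:S|M. (\<Sum>i\<in>I. f i x)) = (\<Sum>i\<in>I. LINT x:S|M. f i x)"
proof -
  have I: "integrable M (\<lambda>x. indicator S x *\<^sub>R f i x)" if "i \<in> I" for i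
    using assms(2)[OF that] by (simp add: set_integrable_def)
  show "set_integrable M S (\<lambda>x. \<Sum>i\<in>I. f i x)"
    unfolding set_integrable_def scaleR_sum_right by (intro Bochner_Integration.integrable_sum I)
  show "(LINT x:S|M. (\<Sum>i\<in>I. f i x)) = (\<Sum>i\<in>I. LINT x:S|M. f i x)"
    unfolding set_lebesgue_integral_def scaleR_sum_right by (intro Bochner_Integration.integral_sum I)
qed

text \<open>The measures with mass \<open>\<alpha> n j / n\<close> at \<open>j / n\<close> are nonnegative, and their Laplace transforms
  at the positive integers converge to those of the density \<open>f\<close>. As in Karamata's method, a function
  \<open>exp (- t) * \<phi> (exp (- t))\<close> is tested: transforms at positive integers are the case where \<open>\<phi>\<close> is a power.\<close>

locale laplace_convergence =
  fixes \<alpha> :: "nat \<Rightarrow> nat \<Rightarrow> real" and f :: "real \<Rightarrow> real"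
  assumes nonneg: "0 \<le> \<alpha> n j" and f_nonneg: "0 < t \<Longrightarrow> 0 \<le> f t"
    and integrable: "set_integrable lborel {0<..} (\<lambda>t. exp (- t) * f t)"
    and summable: "0 < n \<Longrightarrow> summable (\<lambda>j. exp (- (real j / real n)) * \<alpha> n j)"
    and limit: "(\<lambda>n. (\<Sum>j. exp (- (real j / real n)) ^ Suc k * \<alpha> n j) / real n)
      \<longlonglongrightarrow> (LBINT t:{0<..}. exp (- t) ^ Suc k * f t)"
begin

definition approx :: "(real \<Rightarrow> real) \<Rightarrow> nat \<Rightarrow> real" where
  "approx \<phi> n = (\<Sum>j. exp (- (real j / real n)) * \<phi> (exp (- (real j / real n))) * \<alpha> n j) / real n"

definition lim_val :: "(real \<Rightarrow> real) \<Rightarrow> real" where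
  "lim_val \<phi> = (LBINT t:{0<..}. exp (- t) * \<phi> (exp (- t)) * f t)"

definition tested :: "(real \<Rightarrow> real) \<Rightarrow> bool" where
  "tested \<phi> \<longleftrightarrow> \<phi> \<in> borel_measurable borel \<and> (\<exists>B. \<forall>u\<in>{0..1}. \<bar>\<phi> u\<bar> \<le> B)"

lemma summable_tested:
  assumes "tested \<phi>" "0 < n"
  shows "summable (\<lambda>j. exp (- (real j / real n)) * \<phi> (exp (- (real j / real n))) * \<alpha> n j)"
proof -
  obtain B where B: "\<And>u. u \<in> {0..1} \<Longrightarrow> \<bar>\<phi> u\<bar> \<le> B" using assms unfolding tested_def by blast
  show ?thesis
  proof (rule summable_comparison_test')
    show "summable (\<lambda>j. B * (exp (- (real j / real n)) * \<alpha> n j))"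
      by (intro summable_mult summable assms)
    show "norm (exp (- (real j / real n)) * \<phi> (exp (- (real j / real n))) * \<alpha> n j)
        \<le> B * (exp (- (real j / real n)) * \<alpha> n j)" for j
      using mult_right_mono[OF B[of "exp (- (real j / real n))"], of "exp (- (real j / real n)) * \<alpha> n j"] nonneg[of n j]
      by (simp add: abs_mult mult_ac)
  qed
qed

lemma integrable_tested:
  assumes "tested \<phi>"
  shows "set_integrable lborel {0<..} (\<lambda>t. exp (- t) * \<phi> (exp (- t)) * f t)"
proof -
  obtain B where B: "\<And>u. u \<in> {0..1} \<Longrightarrow> \<bar>\<phi> u\<bar> \<le> B" using assms unfolding tested_def by blast
  have [measurable]: "\<phi> \<in> borel_measurable borel" using assms by (simp add: tested_def)
  have m: "(\<lambda>t. indicator {0<..} t *\<^sub>R (exp (- t) * f t)) \<in> borel_measurable lborel"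
    using integrable unfolding set_integrable_def by (rule borel_measurable_integrable)
  have "integrable lborel (\<lambda>t. (indicator {0<..} t *\<^sub>R (exp (- t) * f t)) * (B::real))"
    using integrable unfolding set_integrable_def by simp
  then have "integrable lborel (\<lambda>t. \<phi> (exp (- t)) * (indicator {0<..} t *\<^sub>R (exp (- t) * f t)))"
  proof (rule Bochner_Integration.integrable_bound)
    show "(\<lambda>t. \<phi> (exp (- t)) * (indicator {0<..} t *\<^sub>R (exp (- t) * f t))) \<in> borel_measurable lborel"
      by (intro borel_measurable_times m) measurable
    show "AE t in lborel. norm (\<phi> (exp (- t)) * (indicator {0<..} t *\<^sub>R (exp (- t) * f t)))
        \<le> norm ((indicator {0<..} t *\<^sub>R (exp (- t) * f t)) * B)"
    proof (rule AE_I2)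
      fix t :: real
      show "norm (\<phi> (exp (- t)) * (indicator {0<..} t *\<^sub>R (exp (- t) * f t)))
        \<le> norm ((indicator {0<..} t *\<^sub>R (exp (- t) * f t)) * B)"
      proof (cases "0 < t")
        case True
        then have "\<bar>\<phi> (exp (- t))\<bar> \<le> \<bar>B\<bar>" using B[of "exp (- t)"] by simp
        then have "\<bar>\<phi> (exp (- t))\<bar> * \<bar>exp (- t) * f t\<bar> \<le> \<bar>B\<bar> * \<bar>exp (- t) * f t\<bar>"
          by (rule mult_right_mono) simp
        then show ?thesis using True by (simp add: abs_mult mult_ac)
      qed simp
    qed
  qed
  then show ?thesis unfolding set_integrable_def by (simp add: mult_ac)
qed

lemma tested_poly: "tested (\<lambda>u. \<Sum>i\<le>d. a i * u ^ i)"
proof -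
  have "bounded ((\<lambda>u. \<Sum>i\<le>d. a i * u ^ i) ` {0..1::real})"
    by (intro compact_imp_bounded compact_continuous_image continuous_intros) simp
  then show ?thesis
    unfolding tested_def bounded_iff by auto
qed

lemma tested_power: "tested (\<lambda>u. u ^ i)"
  using tested_poly[of "\<lambda>k. if k = i then 1 else 0" i] by (simp add: sum.delta if_distrib[of "\<lambda>x. x * _"] cong: if_cong)

lemma approx_power: "approx (\<lambda>u. u ^ i) \<longlonglongrightarrow> lim_val (\<lambda>u. u ^ i)"
  using limit[of i] by (simp add: approx_def[abs_def] lim_val_def)

lemma approx_poly:
  "approx (\<lambda>u. \<Sum>i\<le>d. a i * u ^ i) \<longlonglongrightarrow> lim_val (\<lambda>u. \<Sum>i\<le>d. a i * u ^ i)"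
proof -
  have "lim_val (\<lambda>u. \<Sum>i\<le>d. a i * u ^ i) = (\<Sum>i\<le>d. a i * lim_val (\<lambda>u. u ^ i))"
  proof -
    have "lim_val (\<lambda>u. \<Sum>i\<le>d. a i * u ^ i)
        = (LBINT t:{0<..}. \<Sum>i\<le>d. a i * (exp (- t) * exp (- t) ^ i * f t))"
      unfolding lim_val_def by (simp add: sum_distrib_left sum_distrib_right mult_ac)
    also have "\<dots> = (\<Sum>i\<le>d. LBINT t:{0<..}. a i * (exp (- t) * exp (- t) ^ i * f t))"
      by (intro set_lebesgue_integral_sum set_integrable_mult_right integrable_tested tested_power) simp
    finally show ?thesis by (simp add: lim_val_def)
  qed
  moreover have "eventually (\<lambda>n. (\<Sum>i\<le>d. a i * approx (\<lambda>u. u ^ i) n) = approx (\<lambda>u. \<Sum>i\<le>d. a i * u ^ i) n) sequentially"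
    using eventually_gt_at_top[of 0]
  proof eventually_elim
    case (elim n)
    have "(\<lambda>j. \<Sum>i\<le>d. a i * (exp (- (real j / real n)) * exp (- (real j / real n)) ^ i * \<alpha> n j))
      sums (\<Sum>i\<le>d. a i * (\<Sum>j. exp (- (real j / real n)) * exp (- (real j / real n)) ^ i * \<alpha> n j))"
      by (intro sums_sum sums_mult summable_sums summable_tested tested_power elim)
    then have "(\<Sum>j. exp (- (real j / real n)) * (\<Sum>i\<le>d. a i * exp (- (real j / real n)) ^ i) * \<alpha> n j)
      = (\<Sum>i\<le>d. a i * (\<Sum>j. exp (- (real j / real n)) * exp (- (real j / real n)) ^ i * \<alpha> n j))"
      by (simp add: sums_iff sum_distrib_left sum_distrib_right mult_ac)
    then show ?case by (simp add: approx_def sum_divide_distrib)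
  qed
  ultimately show ?thesis
    by (simp only:) (rule Lim_transform_eventually[rotated], assumption, intro tendsto_sum tendsto_mult tendsto_const approx_power)
qed

lemma approx_close:
  assumes "tested \<phi>" "tested \<psi>" "0 < n" and e: "\<And>u. u \<in> {0..1} \<Longrightarrow> \<bar>\<phi> u - \<psi> u\<bar> \<le> e"
  shows "\<bar>approx \<phi> n - approx \<psi> n\<bar> \<le> e * approx (\<lambda>_. 1) n"
proof -
  let ?E = "\<lambda>j. exp (- (real j / real n))"
  have t1: "tested (\<lambda>_. 1)" using tested_power[of 0] by simp
  note S = summable_tested[OF assms(1,3)] summable_tested[OF assms(2,3)] summable_tested[OF t1 assms(3)]
  have pt: "norm (?E j * \<phi> (?E j) * \<alpha> n j - ?E j * \<psi> (?E j) * \<alpha> n j) \<le> e * (?E j * 1 * \<alpha> n j)" for j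
    using mult_right_mono[OF e[of "?E j"], of "?E j * \<alpha> n j"] nonneg[of n j]
    by (simp add: abs_mult mult_ac flip: right_diff_distrib left_diff_distrib)
  have "\<bar>(\<Sum>j. ?E j * \<phi> (?E j) * \<alpha> n j - ?E j * \<psi> (?E j) * \<alpha> n j)\<bar> \<le> (\<Sum>j. e * (?E j * 1 * \<alpha> n j))"
    using norm_suminf_le[OF pt summable_mult[OF S(3)]] by simp
  then have "\<bar>(\<Sum>j. ?E j * \<phi> (?E j) * \<alpha> n j) - (\<Sum>j. ?E j * \<psi> (?E j) * \<alpha> n j)\<bar> \<le> e * (\<Sum>j. ?E j * 1 * \<alpha> n j)"
    using suminf_diff[OF S(1,2)] suminf_mult[OF S(3), of e] by simp
  then show ?thesis
    unfolding approx_def using assms(3) by (simp add: divide_right_mono flip: diff_divide_distrib)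
qed

lemma lim_val_close:
  assumes "tested \<phi>" "tested \<psi>" and e: "\<And>u. u \<in> {0..1} \<Longrightarrow> \<bar>\<phi> u - \<psi> u\<bar> \<le> e"
  shows "\<bar>lim_val \<phi> - lim_val \<psi>\<bar> \<le> e * lim_val (\<lambda>_. 1)"
proof -
  have t1: "tested (\<lambda>_. 1)" using tested_power[of 0] by simp
  note I = integrable_tested[OF assms(1)] integrable_tested[OF assms(2)] integrable_tested[OF t1]
  have "lim_val \<phi> - lim_val \<psi> = (LBINT t:{0<..}. exp (- t) * \<phi> (exp (- t)) * f t - exp (- t) * \<psi> (exp (- t)) * f t)"
    unfolding lim_val_def by (rule set_integral_diff(2)[OF I(1,2), symmetric])
  also have "\<bar>\<dots>\<bar> \<le> (LBINT t:{0<..}. e * (exp (- t) * 1 * f t))"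
    unfolding set_lebesgue_integral_def real_norm_def[symmetric]
  proof (rule Bochner_Integration.integral_norm_bound_integral)
    show "integrable lborel (\<lambda>t. indicator {0<..} t *\<^sub>R (exp (- t) * \<phi> (exp (- t)) * f t - exp (- t) * \<psi> (exp (- t)) * f t))"
      using set_integral_diff(1)[OF I(1,2)] by (simp add: set_integrable_def)
    show "integrable lborel (\<lambda>t. indicator {0<..} t *\<^sub>R (e * (exp (- t) * 1 * f t)))"
      using set_integrable_mult_right[OF I(3), of e] by (simp add: set_integrable_def)
    fix t :: real
    show "norm (indicator {0<..} t *\<^sub>R (exp (- t) * \<phi> (exp (- t)) * f t - exp (- t) * \<psi> (exp (- t)) * f t))
      \<le> indicator {0<..} t *\<^sub>R (e * (exp (- t) * 1 * f t))"
      using mult_right_mono[OF e[of "exp (- t)"], of "exp (- t) * f t"] f_nonneg[of t]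
      by (cases "0 < t") (simp_all add: abs_mult mult_ac flip: right_diff_distrib left_diff_distrib)
  qed
  finally show ?thesis by (simp add: lim_val_def)
qed

text \<open>Weierstrass approximation of \<open>\<phi>\<close> on \<open>{0..1}\<close>. As the weights are nonnegative, the error is at most
  \<open>e\<close> times the transform at \<open>1\<close>, which converges and so is bounded in \<open>n\<close>.\<close>

lemma approx_tendsto:
  assumes cont: "continuous_on {0..1} \<phi>" and \<phi>: "tested \<phi>"
  shows "approx \<phi> \<longlonglongrightarrow> lim_val \<phi>"
proof (rule LIMSEQ_I)
  fix r :: real assume r: "0 < r"
  have t1: "tested (\<lambda>_. 1)" using tested_power[of 0] by simp
  define K where "K = \<bar>lim_val (\<lambda>_. 1)\<bar> + 1"
  have K: "0 < K" by (simp add: K_def)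
  define e where "e = r / (3 * K)"
  have e: "0 < e" using r K by (simp add: e_def)
  obtain g where g: "real_polynomial_function g" "\<And>u. u \<in> {0..1} \<Longrightarrow> \<bar>\<phi> u - g u\<bar> < e"
    using Stone_Weierstrass_real_polynomial_function[OF compact_Icc cont e] by blast
  obtain a d where ad: "g = (\<lambda>u. \<Sum>i\<le>d. a i * u ^ i)"
    using g(1) real_polynomial_function_iff_sum by blast
  have g_test: "tested g" and g_lim: "approx g \<longlonglongrightarrow> lim_val g"
    unfolding ad by (rule tested_poly, rule approx_poly)
  have close: "\<bar>\<phi> u - g u\<bar> \<le> e" if "u \<in> {0..1}" for u using g(2)[OF that] by simp
  have one: "approx (\<lambda>_. 1) \<longlonglongrightarrow> lim_val (\<lambda>_. 1)"
    using approx_power[of 0] by simp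
  have "eventually (\<lambda>n. approx (\<lambda>_. 1) n < K) sequentially"
    using order_tendstoD(2)[OF one, of K] by (simp add: K_def)
  moreover have "eventually (\<lambda>n. \<bar>approx g n - lim_val g\<bar> < r / 3) sequentially"
    using tendstoD[OF g_lim, of "r / 3"] r by (simp add: dist_real_def)
  ultimately have "eventually (\<lambda>n. \<bar>approx \<phi> n - lim_val \<phi>\<bar> < r) sequentially"
    using eventually_gt_at_top[of 0]
  proof eventually_elim
    case (elim n)
    have "e * approx (\<lambda>_. 1) n \<le> e * K" "e * lim_val (\<lambda>_. 1) \<le> e * K"
      using elim e by (auto intro!: mult_left_mono simp: K_def)
    moreover have "e * K = r / 3" using K by (simp add: e_def)
    ultimately show ?case
      using approx_close[OF \<phi> g_test elim(3) close] lim_val_close[OF \<phi> g_test close] elim(2)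
      by linarith
  qed
  then show "\<exists>no. \<forall>n\<ge>no. norm (approx \<phi> n - lim_val \<phi>) < r"
    by (simp add: eventually_sequentially)
qed

end

text \<open>A tent at \<open>1\<close> localizes at \<open>t = 1\<close>. The truncation of \<open>u\<close> at \<open>exp (- 2)\<close> in
  \<open>tent_test\<close> makes it continuous at \<open>0\<close>. It changes nothing at \<open>u = exp (- t)\<close>, because for
  \<open>\<delta> \<le> 1\<close> the tent vanishes when \<open>t \<ge> 2\<close>.\<close>

definition tent :: "real \<Rightarrow> real \<Rightarrow> real" where
  "tent \<delta> t = max 0 (1 - \<bar>t - 1\<bar> / \<delta>)"

definition tent_test :: "real \<Rightarrow> real \<Rightarrow> real" where
  "tent_test \<delta> u = tent \<delta> (- ln (max u (exp (- 2)))) / max u (exp (- 2))"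

lemma tent_nonneg: "0 \<le> tent \<delta> t"
  by (auto simp: tent_def)

lemma tent_eq_0: "0 < \<delta> \<Longrightarrow> \<delta> \<le> \<bar>t - 1\<bar> \<Longrightarrow> tent \<delta> t = 0"
  by (simp add: tent_def)

lemma tent_test_exp:
  assumes "0 < \<delta>" "\<delta> \<le> 1"
  shows "exp (- t) * tent_test \<delta> (exp (- t)) = tent \<delta> t"
proof (cases "t \<le> 2")
  case True
  then have "max (exp (- t)) (exp (- 2)) = exp (- t)" by simp
  then show ?thesis by (simp add: tent_test_def)
next
  case False
  then have "max (exp (- t)) (exp (- 2)) = exp (- 2)" by simp
  then show ?thesis using False assms by (simp add: tent_test_def tent_eq_0)
qed

lemma continuous_tent_test: "0 < \<delta> \<Longrightarrow> continuous_on UNIV (tent_test \<delta>)"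
  unfolding tent_test_def tent_def
  by (intro continuous_intros) (auto simp: max_def)

lemma (in laplace_convergence) tested_tent: "0 < \<delta> \<Longrightarrow> tested (tent_test \<delta>)"
proof -
  assume \<delta>: "0 < \<delta>"
  have "continuous_on {0..1} (tent_test \<delta>)"
    using continuous_tent_test[OF \<delta>] by (rule continuous_on_subset) simp
  then have "bounded (tent_test \<delta> ` {0..1})"
    by (intro compact_imp_bounded compact_continuous_image) simp_all
  then show ?thesis
    using continuous_tent_test[OF \<delta>]
    by (auto simp: tested_def bounded_iff intro: borel_measurable_continuous_onI)
qed

lemma (in laplace_convergence) tent_tendsto:
  assumes \<delta>: "0 < \<delta>" "\<delta> \<le> 1"
  shows "(\<lambda>n. (\<Sum>j. tent \<delta> (real j / real n) * \<alpha> n j) / real n) \<longlonglongrightarrow> (LBINT t:{0<..}. tent \<delta> t * f t)"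
    and "set_integrable lborel {0<..} (\<lambda>t. tent \<delta> t * f t)"
    and "0 < n \<Longrightarrow> Series.summable (\<lambda>j. tent \<delta> (real j / real n) * \<alpha> n j)"
proof -
  have "continuous_on {0..1} (tent_test \<delta>)"
    using continuous_tent_test[OF \<delta>(1)] by (rule continuous_on_subset) simp
  from approx_tendsto[OF this tested_tent[OF \<delta>(1)]]
  show "(\<lambda>n. (\<Sum>j. tent \<delta> (real j / real n) * \<alpha> n j) / real n) \<longlonglongrightarrow> (LBINT t:{0<..}. tent \<delta> t * f t)"
    unfolding approx_def[abs_def] lim_val_def tent_test_exp[OF \<delta>] .
  show "set_integrable lborel {0<..} (\<lambda>t. tent \<delta> t * f t)"
    using integrable_tested[OF tested_tent[OF \<delta>(1)]] unfolding tent_test_exp[OF \<delta>] .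
  show "0 < n \<Longrightarrow> Series.summable (\<lambda>j. tent \<delta> (real j / real n) * \<alpha> n j)"
    using summable_tested[OF tested_tent[OF \<delta>(1)], of n] unfolding tent_test_exp[OF \<delta>] .
qed

text \<open>This instance turns convergence against the tent into convergence of the Riemann sums of the
  tent itself, by which the weights are normalized in the Tauberian theorem.\<close>

lemma laplace_convergence_const: "laplace_convergence (\<lambda>_ _. 1) (\<lambda>_. 1)"
proof
  have int: "set_integrable lborel {0<..} (\<lambda>t. exp (- real (Suc k) * t))"
    and val: "(LBINT t:{0<..}. exp (- real (Suc k) * t)) = 1 / real (Suc k)" for k
  proof -
    have ei: "einterval 0 \<infinity> = {0::real<..}" by (auto simp: einterval_def)
    let ?F = "\<lambda>t. - exp (- real (Suc k) * t) / real (Suc k)"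
    have "((\<lambda>t. - exp (- a * t) / a) has_real_derivative exp (- a * t)) (at t)" if "a \<noteq> 0" for a t :: real
      by (rule derivative_eq_intros refl that)+ (use that in simp)
    then have d: "(?F has_real_derivative exp (- real (Suc k) * t)) (at t)" for t
      by (simp only: of_nat_eq_0_iff nat.simps not_False_eq_True)
    have lim_0: "((?F \<circ> real_of_ereal) \<longlongrightarrow> - 1 / real (Suc k)) (at_right 0)"
      unfolding zero_ereal_def ereal_tendsto_simps by (auto intro!: tendsto_eq_intros)
    have "filterlim (\<lambda>t. - real (Suc k) * t) at_bot at_top"
      by (rule filterlim_tendsto_neg_mult_at_bot[OF tendsto_const _ filterlim_ident]) simp
    then have "((\<lambda>t. exp (- real (Suc k) * t)) \<longlongrightarrow> 0) at_top"
      by (rule filterlim_compose[OF exp_at_bot])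
    then have "(?F \<longlongrightarrow> - 0 / real (Suc k)) at_top"
      by (intro tendsto_divide tendsto_minus tendsto_const) simp_all
    then have lim_top: "((?F \<circ> real_of_ereal) \<longlongrightarrow> 0) (at_left \<infinity>)"
      unfolding ereal_tendsto_simps by simp
    show "set_integrable lborel {0<..} (\<lambda>t. exp (- real (Suc k) * t))"
      unfolding ei[symmetric]
      by (rule interval_integral_FTC_nonneg(1)[OF _ _ _ _ lim_0 lim_top])
        (use d in \<open>auto intro!: continuous_intros\<close>)
    have "(LBINT t=0..\<infinity>. exp (- real (Suc k) * t)) = 0 - - 1 / real (Suc k)"
      by (rule interval_integral_FTC_nonneg(2)[OF _ _ _ _ lim_0 lim_top])
        (use d in \<open>auto intro!: continuous_intros\<close>)
    then show "(LBINT t:{0<..}. exp (- real (Suc k) * t)) = 1 / real (Suc k)"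
      by (simp add: interval_lebesgue_integral_def ei)
  qed
  have pow: "exp (- t) ^ Suc k = exp (- real (Suc k) * t)" for t :: real and k
    using exp_of_nat_mult[of "Suc k" "- t"] by (simp only: mult_minus_left mult_minus_right)
  show "set_integrable lborel {0<..} (\<lambda>t::real. exp (- t) * 1)"
    using int[of 0] by simp
  have geo: "(\<lambda>j. exp (- (real j / real n)) ^ Suc k) sums (1 / (1 - exp (- real (Suc k) / real n)))"
    if "0 < n" for n k
  proof -
    have "exp (- (real j / real n)) ^ Suc k = exp (- real (Suc k) / real n) ^ j" for j
      unfolding pow using exp_of_nat_mult[of j "- real (Suc k) / real n"] by (simp add: mult_ac)
    moreover have "- real (Suc k) / real n < 0" using that by (intro divide_neg_pos) simp_all
    then have "norm (exp (- real (Suc k) / real n)) < 1" by simp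
    ultimately show ?thesis
      using geometric_sums[of "exp (- real (Suc k) / real n)"] by (simp only:)
  qed
  show "Series.summable (\<lambda>j. exp (- (real j / real n)) * 1)" if "0 < n" for n
    using sums_summable[OF geo[OF that, of 0]] by simp
  show "(\<lambda>n. (\<Sum>j. exp (- (real j / real n)) ^ Suc k * 1) / real n)
      \<longlonglongrightarrow> (LBINT t:{0<..}. exp (- t) ^ Suc k * 1)" for k
  proof -
    have "(\<lambda>n. 1 / (1 - exp (- real (Suc k) / real n)) / real n) \<longlonglongrightarrow> 1 / real (Suc k)"
      by real_asymp (simp add: inverse_eq_divide add.commute)
    moreover have "eventually (\<lambda>n. 1 / (1 - exp (- real (Suc k) / real n)) / real n
        = (\<Sum>j. exp (- (real j / real n)) ^ Suc k * 1) / real n) sequentially"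
      using eventually_gt_at_top[of 0]
    proof eventually_elim
      case (elim n)
      then show ?case using sums_unique[OF geo[OF elim, of k]] by simp
    qed
    ultimately have "(\<lambda>n. (\<Sum>j. exp (- (real j / real n)) ^ Suc k * 1) / real n) \<longlonglongrightarrow> 1 / real (Suc k)"
      by (rule Lim_transform_eventually)
    then show ?thesis using val[of k] unfolding pow by simp
  qed
qed auto

text \<open>By slow variation, \<open>\<alpha> n n\<close> is close to the normalized average of \<open>\<alpha> n\<close> against a narrow
  tent. That average converges to the one of \<open>f\<close>, which is close to \<open>f 1\<close> by continuity.\<close>

theorem (in laplace_convergence) tauberian:
  assumes cont: "isCont f 1"
    and slow: "\<And>e. 0 < e \<Longrightarrow> \<exists>\<delta>>0. eventually (\<lambda>n. \<forall>j. \<bar>real j - real n\<bar> \<le> \<delta> * real n \<longrightarrow> \<bar>\<alpha> n j - \<alpha> n n\<bar> \<le> e) sequentially"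
  shows "(\<lambda>n. \<alpha> n n) \<longlonglongrightarrow> f 1"
proof (rule LIMSEQ_I)
  fix r :: real assume r: "0 < r"
  define e where "e = r / 4"
  have e: "0 < e" using r by (simp add: e_def)
  obtain \<delta>1 where \<delta>1: "0 < \<delta>1"
    and slow1: "eventually (\<lambda>n. \<forall>j. \<bar>real j - real n\<bar> \<le> \<delta>1 * real n \<longrightarrow> \<bar>\<alpha> n j - \<alpha> n n\<bar> \<le> e) sequentially"
    using slow[OF e] by blast
  obtain \<delta>2 where \<delta>2: "0 < \<delta>2" and f_close: "\<And>t. \<bar>t - 1\<bar> < \<delta>2 \<Longrightarrow> \<bar>f t - f 1\<bar> < e"
    using cont e unfolding continuous_at_eps_delta by (auto simp: dist_real_def)
  define \<delta> where "\<delta> = min 1 (min \<delta>1 \<delta>2)"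
  have \<delta>: "0 < \<delta>" "\<delta> \<le> 1" "\<delta> \<le> \<delta>1" "\<delta> \<le> \<delta>2" using \<delta>1 \<delta>2 by (auto simp: \<delta>_def)
  interpret one: laplace_convergence "\<lambda>_ _. 1" "\<lambda>_. 1" by (rule laplace_convergence_const)
  define X where "X n = (\<Sum>j. tent \<delta> (real j / real n) * \<alpha> n j) / real n" for n
  define Y where "Y n = (\<Sum>j. tent \<delta> (real j / real n)) / real n" for n
  define x where "x = (LBINT t:{0<..}. tent \<delta> t * f t)"
  define y where "y = (LBINT t:{0<..}. tent \<delta> t)"
  have X: "X \<longlonglongrightarrow> x" using tent_tendsto(1)[OF \<delta>(1,2)] by (simp add: X_def[abs_def] x_def)
  have Y: "Y \<longlonglongrightarrow> y" using one.tent_tendsto(1)[OF \<delta>(1,2)] by (simp add: Y_def[abs_def] y_def)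
  have int_f: "set_integrable lborel {0<..} (\<lambda>t. tent \<delta> t * f t)"
    and int_1: "set_integrable lborel {0<..} (tent \<delta>)"
    using tent_tendsto(2)[OF \<delta>(1,2)] one.tent_tendsto(2)[OF \<delta>(1,2)] by simp_all
  have y_pos: "0 < y"
  proof -
    let ?g = "\<lambda>t. (1 / 2) * indicator {1 - \<delta> / 2..1 + \<delta> / 2} t :: real"
    have "(\<integral>t. ?g t \<partial>lborel) \<le> y"
      unfolding y_def set_lebesgue_integral_def
    proof (rule integral_mono)
      show "integrable lborel (\<lambda>t. indicator {0<..} t *\<^sub>R tent \<delta> t)"
        using int_1 by (simp add: set_integrable_def)
      show "?g t \<le> indicator {0<..} t *\<^sub>R tent \<delta> t" for t
      proof (cases "t \<in> {1 - \<delta> / 2..1 + \<delta> / 2}")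
        case True
        then have "t - 1 \<le> \<delta> / 2" "- (t - 1) \<le> \<delta> / 2" by auto
        then have "\<bar>t - 1\<bar> \<le> \<delta> / 2" by (rule abs_leI)
        then have "\<bar>t - 1\<bar> / \<delta> \<le> 1 / 2" using \<delta> by (simp add: pos_divide_le_eq)
        then have "1 / 2 \<le> tent \<delta> t" unfolding tent_def by linarith
        moreover have "0 < t" using True \<delta> by auto
        ultimately show ?thesis using True by simp
      qed (simp add: tent_nonneg)
    qed (use \<delta> in simp)
    moreover have "(\<integral>t. ?g t \<partial>lborel) = \<delta> / 2" using \<delta> by simp
    ultimately show ?thesis using \<delta> by simp
  qed
  have xy: "\<bar>x - f 1 * y\<bar> \<le> e * y"
  proof -
    have "x - f 1 * y = (LBINT t:{0<..}. tent \<delta> t * f t - f 1 * tent \<delta> t)"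
      using int_f int_1 by (simp add: x_def y_def)
    also have "\<bar>\<dots>\<bar> \<le> (LBINT t:{0<..}. e * tent \<delta> t)"
      unfolding set_lebesgue_integral_def real_norm_def[symmetric]
    proof (rule Bochner_Integration.integral_norm_bound_integral)
      show "integrable lborel (\<lambda>t. indicator {0<..} t *\<^sub>R (tent \<delta> t * f t - f 1 * tent \<delta> t))"
        using set_integral_diff(1)[OF int_f set_integrable_mult_right[OF int_1, of "f 1"]]
        by (simp add: set_integrable_def)
      show "integrable lborel (\<lambda>t. indicator {0<..} t *\<^sub>R (e * tent \<delta> t))"
        using set_integrable_mult_right[OF int_1, of e] by (simp add: set_integrable_def)
      fix t :: real
      have "\<bar>tent \<delta> t * f t - f 1 * tent \<delta> t\<bar> \<le> e * tent \<delta> t"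
      proof (cases "\<bar>t - 1\<bar> < \<delta>")
        case True
        then have "\<bar>f t - f 1\<bar> \<le> e" using f_close[of t] \<delta> by simp
        then have "tent \<delta> t * \<bar>f t - f 1\<bar> \<le> tent \<delta> t * e" by (intro mult_left_mono tent_nonneg)
        moreover have "tent \<delta> t * f t - f 1 * tent \<delta> t = tent \<delta> t * (f t - f 1)" by (simp add: algebra_simps)
        ultimately show ?thesis by (simp add: abs_mult tent_nonneg mult.commute)
      qed (use \<delta> in \<open>simp add: tent_eq_0\<close>)
      then show "norm (indicator {0<..} t *\<^sub>R (tent \<delta> t * f t - f 1 * tent \<delta> t)) \<le> indicator {0<..} t *\<^sub>R (e * tent \<delta> t)"
        by (cases "0 < t") simp_all
    qed
    finally show ?thesis by (simp add: y_def)
  qed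
  have XY: "eventually (\<lambda>n. \<bar>X n - \<alpha> n n * Y n\<bar> \<le> e * Y n) sequentially"
    using slow1 eventually_gt_at_top[of 0]
  proof eventually_elim
    case (elim n)
    let ?t = "\<lambda>j. tent \<delta> (real j / real n)"
    have S: "Series.summable (\<lambda>j. ?t j * \<alpha> n j)" "Series.summable ?t"
      using tent_tendsto(3)[OF \<delta>(1,2), of n] one.tent_tendsto(3)[OF \<delta>(1,2), of n] elim by simp_all
    have pt: "norm (?t j * \<alpha> n j - \<alpha> n n * ?t j) \<le> e * ?t j" for j
    proof (cases "\<bar>real j / real n - 1\<bar> < \<delta>")
      case True
      have "real j / real n - 1 = (real j - real n) / real n"
        using elim(2) by (simp add: diff_divide_distrib)
      then have "\<bar>real j / real n - 1\<bar> = \<bar>real j - real n\<bar> / real n"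
        by (simp add: abs_divide)
      then have "\<bar>real j - real n\<bar> \<le> \<delta> * real n"
        using True elim by (simp add: pos_divide_less_eq)
      also have "\<dots> \<le> \<delta>1 * real n" using \<delta> by (intro mult_right_mono) auto
      finally have "\<bar>\<alpha> n j - \<alpha> n n\<bar> \<le> e" using elim by blast
      then have "?t j * \<bar>\<alpha> n j - \<alpha> n n\<bar> \<le> ?t j * e" by (intro mult_left_mono tent_nonneg)
      moreover have "?t j * \<alpha> n j - \<alpha> n n * ?t j = ?t j * (\<alpha> n j - \<alpha> n n)" by (simp add: algebra_simps)
      ultimately show ?thesis by (simp add: abs_mult tent_nonneg mult.commute)
    qed (use \<delta> in \<open>simp add: tent_eq_0\<close>)
    have "\<bar>(\<Sum>j. ?t j * \<alpha> n j - \<alpha> n n * ?t j)\<bar> \<le> (\<Sum>j. e * ?t j)"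
      using norm_suminf_le[OF pt summable_mult[OF S(2)]] by simp
    then have "\<bar>(\<Sum>j. ?t j * \<alpha> n j) - \<alpha> n n * (\<Sum>j. ?t j)\<bar> \<le> e * (\<Sum>j. ?t j)"
      using suminf_diff[OF S(1) summable_mult[OF S(2), of "\<alpha> n n"]] suminf_mult[OF S(2), of e]
        suminf_mult[OF S(2), of "\<alpha> n n"] by simp
    then show ?case
      unfolding X_def Y_def using elim(2) by (simp add: divide_right_mono flip: diff_divide_distrib)
  qed
  have "(\<lambda>n. X n / Y n) \<longlonglongrightarrow> x / y" using y_pos by (intro tendsto_divide X Y) simp
  from tendstoD[OF this e] have "eventually (\<lambda>n. \<bar>X n / Y n - x / y\<bar> < e) sequentially"
    by (simp add: dist_real_def)
  moreover have "eventually (\<lambda>n. 0 < Y n) sequentially"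
    using order_tendstoD(1)[OF Y y_pos] .
  ultimately have "eventually (\<lambda>n. \<bar>\<alpha> n n - f 1\<bar> < r) sequentially"
    using XY
  proof eventually_elim
    case (elim n)
    have quot: "\<bar>u / v - a\<bar> \<le> e" if "0 < v" "\<bar>u - a * v\<bar> \<le> e * v" for u v a :: real
    proof -
      have "u / v - a = (u - a * v) / v" using that by (simp add: diff_divide_distrib)
      then show ?thesis using that by (simp add: pos_divide_le_eq)
    qed
    have "r = 4 * e" by (simp add: e_def)
    then show ?case
      using quot[OF y_pos xy] quot[OF elim(2,3)] elim(1) e by linarith
  qed
  then show "\<exists>no. \<forall>n\<ge>no. norm (\<alpha> n n - f 1) < r"
    by (simp add: eventually_sequentially)
qed

section \<open>The local limit theorem in a fixed environment\<close>

lemma scaled_position: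
  fixes g :: "nat \<Rightarrow> int"
  assumes "\<And>n. \<bar>real_of_int (g n) - x * sqrt (2 * real n)\<bar> \<le> 1"
  shows "(\<lambda>n. real_of_int (g n) / sqrt (real n)) \<longlonglongrightarrow> x * sqrt 2"
proof -
  have sqrt_top: "filterlim (\<lambda>n. sqrt (real n)) at_top sequentially"
    by (rule filterlim_compose[OF sqrt_at_top filterlim_real_sequentially])
  have "(\<lambda>n. (real_of_int (g n) - x * sqrt (2 * real n)) / sqrt (real n)) \<longlonglongrightarrow> 0"
  proof (rule Lim_null_comparison)
    show "eventually (\<lambda>n. norm ((real_of_int (g n) - x * sqrt (2 * real n)) / sqrt (real n)) \<le> 1 / sqrt (real n)) sequentially"
      using assms by (intro always_eventually) (auto simp: abs_divide intro!: divide_right_mono)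
    show "(\<lambda>n. 1 / sqrt (real n)) \<longlonglongrightarrow> 0"
      by (rule real_tendsto_divide_at_top[OF tendsto_const sqrt_top])
  qed
  from tendsto_add[OF this tendsto_const[of "x * sqrt 2"]]
  have "(\<lambda>n. (real_of_int (g n) - x * sqrt (2 * real n)) / sqrt (real n) + x * sqrt 2) \<longlonglongrightarrow> x * sqrt 2" by simp
  moreover have "eventually (\<lambda>n. (real_of_int (g n) - x * sqrt (2 * real n)) / sqrt (real n) + x * sqrt 2
      = real_of_int (g n) / sqrt (real n)) sequentially"
    using eventually_gt_at_top[of 0]
    by eventually_elim (simp add: real_sqrt_mult diff_divide_distrib)
  ultimately show ?thesis by (rule Lim_transform_eventually)
qed

context averaged_conductances
begin

text \<open>The return densities at time \<open>n div 8\<close> are of order \<open>1 / sqrt n\<close>, so a step in time near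
  \<open>n\<close> changes the kernel by at most a constant times \<open>1 / (n * sqrt n)\<close>. The divisor \<open>8\<close> leaves room for
  all \<open>j \<ge> n / 2\<close> to satisfy \<open>3 * k \<le> j\<close>.\<close>

lemma kernel_time_regularity:
  fixes g :: "nat \<Rightarrow> int"
  assumes L: "eventually (\<lambda>n. \<bar>real_of_int (g n)\<bar> \<le> L * sqrt (real n)) sequentially"
  shows "\<exists>K>0. eventually (\<lambda>n. \<forall>j. 2 * \<bar>real j - real n\<bar> \<le> real n \<longrightarrow>
    \<bar>kernel 0 (2 * j) (g n) - kernel 0 (2 * n) (g n)\<bar> \<le> K * \<bar>real j - real n\<bar> / (real n * sqrt (real n))) sequentially"
proof -
  obtain C where C: "0 < C" "eventually (\<lambda>n. \<forall>y. \<bar>real_of_int y\<bar> \<le> 4 * \<bar>L\<bar> * sqrt (real n) \<longrightarrow> return_density y n \<le> C / sqrt (real n)) sequentially"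
    using return_density_bound[of "4 * \<bar>L\<bar>"] by blast
  have div_top: "filterlim (\<lambda>n. n div 8) at_top (sequentially :: nat filter)"
    unfolding filterlim_at_top
  proof
    fix Z :: nat
    show "eventually (\<lambda>n. Z \<le> n div 8) sequentially"
      using eventually_ge_at_top[of "8 * Z"] by eventually_elim auto
  qed
  have ev: "eventually (\<lambda>n. \<forall>y. \<bar>real_of_int y\<bar> \<le> 4 * \<bar>L\<bar> * sqrt (real (n div 8)) \<longrightarrow> return_density y (n div 8) \<le> C / sqrt (real (n div 8))) sequentially"
    using C(2) div_top by (rule eventually_compose_filterlim)
  have "eventually (\<lambda>n. \<forall>j. 2 * \<bar>real j - real n\<bar> \<le> real n \<longrightarrow>
    \<bar>kernel 0 (2 * j) (g n) - kernel 0 (2 * n) (g n)\<bar> \<le> (64 * C) * \<bar>real j - real n\<bar> / (real n * sqrt (real n))) sequentially"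
    using ev L eventually_ge_at_top[of 16]
  proof eventually_elim
    case (elim n)
    define k where "k = n div 8"
    have k: "0 < k" "real n \<le> 16 * real k" "6 * k \<le> n" using elim(3) unfolding k_def by linarith+
    have sq: "sqrt (real n) \<le> 4 * sqrt (real k)"
    proof -
      have "sqrt (real n) \<le> sqrt (16 * real k)" using k by (intro real_sqrt_le_mono) simp
      then show ?thesis by (simp add: real_sqrt_mult)
    qed
    have "\<bar>real_of_int (g n)\<bar> \<le> \<bar>L\<bar> * sqrt (real n)"
      using elim(2) by (rule order_trans) (intro mult_right_mono, auto)
    also have "\<dots> \<le> \<bar>L\<bar> * (4 * sqrt (real k))" by (intro mult_left_mono sq) simp
    finally have "return_density (g n) k \<le> C / sqrt (real k)" using elim(1) by (simp add: k_def mult_ac)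
    moreover have "return_density 0 k \<le> C / sqrt (real k)" using elim(1) by (simp add: k_def)
    ultimately have "sqrt (return_density 0 k) * sqrt (return_density (g n) k) \<le> sqrt (C / sqrt (real k)) * sqrt (C / sqrt (real k))"
      using C(1) by (intro mult_mono real_sqrt_le_mono) (auto simp: return_density_nonneg)
    also have "\<dots> = C / sqrt (real k)" using C by simp
    finally have "sqrt (return_density 0 k) * sqrt (return_density (g n) k) / real k \<le> C / sqrt (real k) / real k"
      by (rule divide_right_mono) simp
    also have "\<dots> \<le> 64 * C / (real n * sqrt (real n))"
    proof -
      have "real n * sqrt (real n) \<le> (16 * real k) * (4 * sqrt (real k))"
        using k sq by (intro mult_mono) auto
      then have "64 * C / (64 * (real k * sqrt (real k))) \<le> 64 * C / (real n * sqrt (real n))"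
        using C k elim(3) by (intro divide_left_mono mult_pos_pos) auto
      then show ?thesis by (simp add: mult.commute)
    qed
    finally have D: "sqrt (return_density 0 k) * sqrt (return_density (g n) k) / real k \<le> 64 * C / (real n * sqrt (real n))" .
    have one_step: "\<bar>kernel 0 (2 * i) (g n) - kernel 0 (2 * Suc i) (g n)\<bar> \<le> 64 * C / (real n * sqrt (real n))" if "3 * k \<le> i" for i
      using kernel_time_step[OF that k(1), of 0 "g n"] D by linarith
    have tele: "\<bar>kernel 0 (2 * i) (g n) - kernel 0 (2 * j) (g n)\<bar> \<le> real (j - i) * (64 * C / (real n * sqrt (real n)))"
      if "3 * k \<le> i" "i \<le> j" for i j
      using that(2)
    proof (induction j rule: dec_induct)
      case (step j)
      have eq: "real (Suc j - i) = real (j - i) + 1" and j: "3 * k \<le> j" using step that by simp_all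
      show ?case using step.IH one_step[OF j] unfolding eq distrib_right by linarith
    qed simp
    show ?case
    proof (intro allI impI)
      fix j assume j: "2 * \<bar>real j - real n\<bar> \<le> real n"
      have "v \<le> 2 * u" if "2 * d \<le> v" "- (u - v) \<le> d" for u v d :: real
        using that by linarith
      from this[OF j abs_ge_minus_self] have "real n \<le> 2 * real j" .
      then have "n \<le> 2 * j" by linarith
      then have "3 * k \<le> j" "3 * k \<le> n" using k(3) by linarith+
      then have "\<bar>kernel 0 (2 * j) (g n) - kernel 0 (2 * n) (g n)\<bar> \<le> \<bar>real j - real n\<bar> * (64 * C / (real n * sqrt (real n)))"
        using tele[of j n] tele[of n j] by (cases "j \<le> n") (simp_all add: of_nat_diff abs_minus_commute)
      then show "\<bar>kernel 0 (2 * j) (g n) - kernel 0 (2 * n) (g n)\<bar> \<le> (64 * C) * \<bar>real j - real n\<bar> / (real n * sqrt (real n))"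
        by (simp add: mult.commute)
    qed
  qed
  then show ?thesis using C(1) by (intro exI[of _ "64 * C"]) auto
qed

text \<open>The Green function at \<open>s = exp (- (k + 1) / (2 n))\<close> and at an even site only sees even times, where
  \<open>s ^ (2 j) = exp (- (k + 1) j / n)\<close>. So its scaling limit is the convergence of the Laplace transforms of
  the rescaled kernel in the variable \<open>j / n\<close>. The density \<open>f\<close> is the one whose transform is that limit,
  and regularity in time gives slow variation.\<close>

theorem local_limit:
  fixes g :: "nat \<Rightarrow> int" and x :: real
  assumes g_even: "\<And>n. even (g n)" and g_near: "\<And>n. \<bar>real_of_int (g n) - x * sqrt (2 * real n)\<bar> \<le> 1"
  shows "(\<lambda>n. sqrt (2 * real n) * kernel 0 (2 * n) (g n))
    \<longlonglongrightarrow> 1 / sqrt pi * sqrt (B / A) * exp (- (A * B / 4 * x\<^sup>2))"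
proof -
  define \<alpha> where "\<alpha> n j = sqrt (2 * real n) * kernel 0 (2 * j) (g n)" for n j
  define b where "b = A * B * x\<^sup>2 / 4"
  define f where "f t = sqrt (B / (A * pi)) * (exp (- b / t) / sqrt t)" for t
  have b: "0 \<le> b" using A_pos B_pos by (simp add: b_def)
  have g_lim: "(\<lambda>n. real_of_int (g n) / sqrt (real n)) \<longlonglongrightarrow> x * sqrt 2"
    by (rule scaled_position[OF g_near])
  have sums: "(\<lambda>j. exp (- (real j / real n)) ^ Suc k * \<alpha> n j) sums
      (sqrt (2 * real n) * green (exp (- (real (Suc k) / 2) / real n)) 0 (g n))" if "0 < n" for n k
  proof -
    let ?s = "exp (- (real (Suc k) / 2) / real n)"
    have s: "0 < ?s" "?s < 1" using that by (auto simp: divide_neg_pos)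
    have pow: "?s ^ (2 * j) = exp (- (real j / real n)) ^ Suc k" for j
    proof -
      have "?s ^ (2 * j) = exp (real (2 * j) * (- (real (Suc k) / 2) / real n))" by (rule exp_of_nat_mult[symmetric])
      also have "real (2 * j) * (- (real (Suc k) / 2) / real n) = real (Suc k) * (- (real j / real n))" by simp
      also have "exp \<dots> = exp (- (real j / real n)) ^ Suc k" by (rule exp_of_nat_mult)
      finally show ?thesis .
    qed
    have "(\<lambda>j. sqrt (2 * real n) * (?s ^ (2 * j) * kernel 0 (2 * j) (g n))) sums (sqrt (2 * real n) * green ?s 0 (g n))"
      by (intro sums_mult green_sums_even s) (simp add: g_even)
    then show ?thesis unfolding pow \<alpha>_def by (simp only: mult_ac)
  qed
  interpret laplace_convergence \<alpha> f
  proof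
    show "0 \<le> \<alpha> n j" for n j by (simp add: \<alpha>_def kernel_nonneg)
    show "0 \<le> f t" if "0 < t" for t using that A_pos B_pos by (simp add: f_def)
    show "set_integrable lborel {0<..} (\<lambda>t. exp (- t) * f t)"
      using set_integrable_mult_right[OF laplace_heat_kernel(1)[of 1, OF _ b], of "sqrt (B / (A * pi))"]
      by (simp add: f_def mult_ac)
    show "summable (\<lambda>j. exp (- (real j / real n)) * \<alpha> n j)" if "0 < n" for n
      using sums_summable[OF sums[OF that, of 0]] by simp
    show "(\<lambda>n. (\<Sum>j. exp (- (real j / real n)) ^ Suc k * \<alpha> n j) / real n)
      \<longlonglongrightarrow> (LBINT t:{0<..}. exp (- t) ^ Suc k * f t)" for k
    proof -
      let ?l = "real (Suc k)"
      have "(LBINT t:{0<..}. exp (- t) ^ Suc k * f t)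
          = (LBINT t:{0<..}. sqrt (B / (A * pi)) * (exp (- ?l * t) * (exp (- b / t) / sqrt t)))"
      proof -
        have "exp (- t) ^ Suc k = exp (- ?l * t)" for t :: real
          using exp_of_nat_mult[of "Suc k" "- t"] by (simp only: mult_minus_left mult_minus_right)
        then show ?thesis by (simp only: f_def mult_ac)
      qed
      also have "\<dots> = sqrt (B / (A * pi)) * (sqrt (pi / ?l) * exp (- 2 * sqrt (b * ?l)))"
        by (subst set_integral_mult_right, subst laplace_heat_kernel(2)) (use b in simp_all)
      also have "\<dots> = sqrt 2 * (sqrt (B / (A * (?l / 2))) / 2 * exp (- \<bar>x * sqrt 2\<bar> * sqrt (?l / 2 * (A * B))))"
      proof -
        have "sqrt (B / (A * pi)) * sqrt (pi / ?l) = sqrt 2 * (sqrt (B / (A * (?l / 2))) / 2)"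
        proof -
          have "sqrt (B / (A * pi)) * sqrt (pi / ?l) = sqrt (B / (A * ?l))"
            by (simp flip: real_sqrt_mult)
          moreover have "sqrt 2 * sqrt (B / (A * (?l / 2))) = sqrt (4 * (B / (A * ?l)))"
            by (simp flip: real_sqrt_mult)
          moreover have "sqrt (4 * (B / (A * ?l))) = 2 * sqrt (B / (A * ?l))"
            by (simp only: real_sqrt_mult) simp
          ultimately show ?thesis by simp
        qed
        moreover have "2 * sqrt (b * ?l) = \<bar>x * sqrt 2\<bar> * sqrt (?l / 2 * (A * B))"
        proof -
          have "2 * sqrt (b * ?l) = sqrt (4 * (b * ?l))" by (simp only: real_sqrt_mult) simp
          also have "4 * (b * ?l) = (x * sqrt 2)\<^sup>2 * (?l / 2 * (A * B))"
            by (simp add: b_def power_mult_distrib)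
          also have "sqrt \<dots> = \<bar>x * sqrt 2\<bar> * sqrt (?l / 2 * (A * B))"
            by (simp only: real_sqrt_mult real_sqrt_abs)
          finally show ?thesis .
        qed
        ultimately show ?thesis by (simp only: mult_minus_left mult.assoc[symmetric])
      qed
      finally have val: "(LBINT t:{0<..}. exp (- t) ^ Suc k * f t) = \<dots>" .
      have "(\<lambda>n. sqrt 2 * (green (exp (- (?l / 2) / real n)) 0 (g n) / sqrt (real n)))
        \<longlonglongrightarrow> sqrt 2 * (sqrt (B / (A * (?l / 2))) / 2 * exp (- \<bar>x * sqrt 2\<bar> * sqrt (?l / 2 * (A * B))))"
        by (intro tendsto_mult tendsto_const green_scaling g_lim) simp
      moreover have "eventually (\<lambda>n. sqrt 2 * (green (exp (- (?l / 2) / real n)) 0 (g n) / sqrt (real n))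
        = (\<Sum>j. exp (- (real j / real n)) ^ Suc k * \<alpha> n j) / real n) sequentially"
        using eventually_gt_at_top[of 0]
      proof eventually_elim
        case (elim n)
        have "X / sqrt (real n) = sqrt (real n) * X / real n" for X
          using elim by (simp add: field_simps flip: mult.assoc)
        then show ?case
          unfolding sums_unique[OF sums[OF elim, of k], symmetric] by (simp add: real_sqrt_mult mult_ac)
      qed
      ultimately show ?thesis
        unfolding val by (rule Lim_transform_eventually)
    qed
  qed
  have "(\<lambda>n. \<alpha> n n) \<longlonglongrightarrow> f 1"
  proof (rule tauberian)
    show "isCont f 1" unfolding f_def by (intro continuous_intros) auto
    have "eventually (\<lambda>n. real_of_int \<bar>g n\<bar> / sqrt (real n) < \<bar>x * sqrt 2\<bar> + 1) sequentially"
      using order_tendstoD(2)[OF tendsto_rabs[OF g_lim], of "\<bar>x * sqrt 2\<bar> + 1"] by (simp add: abs_divide)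
    then have "eventually (\<lambda>n. \<bar>real_of_int (g n)\<bar> \<le> (\<bar>x * sqrt 2\<bar> + 1) * sqrt (real n)) sequentially"
      using eventually_gt_at_top[of 0] by eventually_elim (simp add: pos_divide_less_eq)
    from kernel_time_regularity[OF this] obtain K where K: "0 < K"
      and ev: "eventually (\<lambda>n. \<forall>j. 2 * \<bar>real j - real n\<bar> \<le> real n \<longrightarrow>
        \<bar>kernel 0 (2 * j) (g n) - kernel 0 (2 * n) (g n)\<bar> \<le> K * \<bar>real j - real n\<bar> / (real n * sqrt (real n))) sequentially"
      by blast
    fix e :: real assume e: "0 < e"
    define \<delta> where "\<delta> = min (1 / 2) (e / (sqrt 2 * K))"
    have \<delta>: "0 < \<delta>" "\<delta> \<le> 1 / 2" "\<delta> \<le> e / (sqrt 2 * K)"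
      unfolding \<delta>_def by (use e K in simp, rule min.cobounded1, rule min.cobounded2)
    have "eventually (\<lambda>n. \<forall>j. \<bar>real j - real n\<bar> \<le> \<delta> * real n \<longrightarrow> \<bar>\<alpha> n j - \<alpha> n n\<bar> \<le> e) sequentially"
      using ev eventually_gt_at_top[of 0]
    proof eventually_elim
      case (elim n)
      show ?case
      proof (intro allI impI)
        fix j assume j: "\<bar>real j - real n\<bar> \<le> \<delta> * real n"
        also have "\<dots> \<le> 1 / 2 * real n" using \<delta> by (intro mult_right_mono) auto
        finally have "2 * \<bar>real j - real n\<bar> \<le> real n" by simp
        then have "\<bar>kernel 0 (2 * j) (g n) - kernel 0 (2 * n) (g n)\<bar> \<le> K * \<bar>real j - real n\<bar> / (real n * sqrt (real n))"
          using elim(1) by blast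
        also have "\<dots> \<le> K * (\<delta> * real n) / (real n * sqrt (real n))"
          using j K by (intro divide_right_mono mult_left_mono) auto
        also have "\<dots> = K * \<delta> / sqrt (real n)" using elim(2) by simp
        finally have "sqrt (2 * real n) * \<bar>kernel 0 (2 * j) (g n) - kernel 0 (2 * n) (g n)\<bar> \<le> sqrt (2 * real n) * (K * \<delta> / sqrt (real n))"
          by (rule mult_left_mono) simp
        also have "\<dots> = (sqrt 2 * K) * \<delta>" using elim(2) by (simp add: real_sqrt_mult)
        also have "\<dots> \<le> e"
          using \<delta>(3) K by (simp add: pos_le_divide_eq mult.commute)
        finally show "\<bar>\<alpha> n j - \<alpha> n n\<bar> \<le> e"
          unfolding \<alpha>_def by (simp add: abs_mult flip: right_diff_distrib)
      qed
    qed
    then show "\<exists>\<delta>>0. eventually (\<lambda>n. \<forall>j. \<bar>real j - real n\<bar> \<le> \<delta> * real n \<longrightarrow> \<bar>\<alpha> n j - \<alpha> n n\<bar> \<le> e) sequentially"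
      using \<delta>(1) by blast
  qed
  moreover have "f 1 = 1 / sqrt pi * sqrt (B / A) * exp (- (A * B / 4 * x\<^sup>2))"
    by (simp add: f_def b_def real_sqrt_divide real_sqrt_mult)
  ultimately show ?thesis by (simp add: \<alpha>_def)
qed

end

section \<open>Birkhoff's ergodic theorem\<close>

locale measure_preserving_map = prob_space M for M :: "'a measure" +
  fixes T :: "'a \<Rightarrow> 'a"
  assumes T_meas [measurable]: "T \<in> measurable M M"
    and T_distr: "distr M M T = M"
begin

definition orbit_sum :: "('a \<Rightarrow> real) \<Rightarrow> nat \<Rightarrow> 'a \<Rightarrow> real" where
  "orbit_sum g n \<omega> = (\<Sum>k<n. g ((T ^^ k) \<omega>))"

lemma T_space: "\<omega> \<in> space M \<Longrightarrow> T \<omega> \<in> space M"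
  using T_meas by (rule measurable_space)

lemma T_pow_meas [measurable]: "(T ^^ k) \<in> measurable M M"
  by (induction k) (auto intro: measurable_comp[OF _ T_meas])

lemma orbit_sum_meas [measurable]: "g \<in> borel_measurable M \<Longrightarrow> orbit_sum g n \<in> borel_measurable M"
  unfolding orbit_sum_def[abs_def] by (intro borel_measurable_sum measurable_compose[OF T_pow_meas])

lemma orbit_sum_Suc: "orbit_sum g (Suc n) \<omega> = g \<omega> + orbit_sum g n (T \<omega>)"
  unfolding orbit_sum_def by (subst sum.lessThan_Suc_shift) (simp add: funpow_swap1)

lemma integrable_comp_T:
  fixes g :: "'a \<Rightarrow> real"
  shows "integrable M g \<Longrightarrow> integrable M (\<lambda>\<omega>. g (T \<omega>))"
  using integrable_distr_eq[OF T_meas, of g] by (simp add: T_distr)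

lemma integral_comp_T:
  fixes g :: "'a \<Rightarrow> real"
  shows "g \<in> borel_measurable M \<Longrightarrow> (\<integral>\<omega>. g (T \<omega>) \<partial>M) = (\<integral>\<omega>. g \<omega> \<partial>M)"
  using integral_distr[OF T_meas, of g] by (simp add: T_distr)

text \<open>The maximum of \<open>0\<close> and the first \<open>n\<close> orbit sums, in the recursive form that Garsia's proof of the
  maximal inequality uses.\<close>

primrec max_sum :: "('a \<Rightarrow> real) \<Rightarrow> nat \<Rightarrow> 'a \<Rightarrow> real" where
  "max_sum g 0 = (\<lambda>\<omega>. 0)"
| "max_sum g (Suc n) = (\<lambda>\<omega>. max 0 (g \<omega> + max_sum g n (T \<omega>)))"

lemma max_sum_nonneg: "0 \<le> max_sum g n \<omega>"
  by (cases n) auto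

lemma max_sum_mono: "max_sum g n \<omega> \<le> max_sum g (Suc n) \<omega>"
proof (induction n arbitrary: \<omega>)
  case (Suc n)
  show ?case using Suc[of "T \<omega>"] by (simp add: max_def split: if_splits)
qed simp

lemma orbit_sum_le_max_sum: "orbit_sum g n \<omega> \<le> max_sum g n \<omega>"
proof (induction n arbitrary: \<omega>)
  case (Suc n)
  show ?case using Suc[of "T \<omega>"] by (simp add: orbit_sum_Suc)
qed (simp add: orbit_sum_def)

lemma integrable_max_sum: "integrable M g \<Longrightarrow> integrable M (max_sum g n)"
  by (induction n) (auto intro!: Bochner_Integration.integrable_add integrable_comp_T)

text \<open>Where \<open>max_sum g n\<close> is positive, \<open>g\<close> is at least \<open>max_sum g n - max_sum g n \<circ> T\<close>, and the
  integral of the latter vanishes. These sets increase to a set of full measure.\<close>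

lemma maximal_ergodic_inequality:
  assumes g: "integrable M g" and pos: "AE \<omega> in M. \<exists>n. 0 < orbit_sum g n \<omega>"
  shows "0 \<le> (\<integral>\<omega>. g \<omega> \<partial>M)"
proof -
  have [measurable]: "g \<in> borel_measurable M" using g by simp
  have mx [measurable]: "max_sum g n \<in> borel_measurable M" for n
    using integrable_max_sum[OF g] by simp
  let ?I = "\<lambda>n \<omega>. indicator {\<omega>. 0 < max_sum g n \<omega>} \<omega> * g \<omega>"
  have I_int: "integrable M (?I n)" for n
    using g by (rule Bochner_Integration.integrable_bound) (simp, simp add: indicator_def)
  have nonneg: "0 \<le> (\<integral>\<omega>. ?I n \<omega> \<partial>M)" for n
  proof -
    have "(\<integral>\<omega>. max_sum g n \<omega> - max_sum g n (T \<omega>) \<partial>M) \<le> (\<integral>\<omega>. ?I n \<omega> \<partial>M)"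
    proof (rule integral_mono)
      show "integrable M (\<lambda>\<omega>. max_sum g n \<omega> - max_sum g n (T \<omega>))"
        by (intro Bochner_Integration.integrable_diff integrable_comp_T integrable_max_sum g)
      show "max_sum g n \<omega> - max_sum g n (T \<omega>) \<le> ?I n \<omega>" for \<omega>
      proof (cases "0 < max_sum g n \<omega>")
        case True
        then obtain k where k: "n = Suc k" by (cases n) auto
        then have "max_sum g n \<omega> = g \<omega> + max_sum g k (T \<omega>)"
          using True by (simp add: max_def split: if_splits)
        moreover have "max_sum g k (T \<omega>) \<le> max_sum g n (T \<omega>)"
          unfolding k by (rule max_sum_mono)
        ultimately show ?thesis using True by simp
      next
        case False
        then show ?thesis using max_sum_nonneg[of g n "T \<omega>"] by simp
      qed
    qed (rule I_int)
    moreover have "(\<integral>\<omega>. max_sum g n \<omega> - max_sum g n (T \<omega>) \<partial>M) = 0"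
      by (simp add: integrable_comp_T integrable_max_sum g integral_comp_T)
    ultimately show ?thesis by simp
  qed
  have "(\<lambda>n. \<integral>\<omega>. ?I n \<omega> \<partial>M) \<longlonglongrightarrow> (\<integral>\<omega>. g \<omega> \<partial>M)"
  proof (rule integral_dominated_convergence)
    show "integrable M (\<lambda>\<omega>. \<bar>g \<omega>\<bar>)" using g by simp
    show "AE \<omega> in M. (\<lambda>n. ?I n \<omega>) \<longlonglongrightarrow> g \<omega>"
      using pos
    proof eventually_elim
      case (elim \<omega>)
      then obtain n where n: "0 < orbit_sum g n \<omega>" by blast
      have "?I k \<omega> = g \<omega>" if "n \<le> k" for k
      proof -
        have "0 < max_sum g n \<omega>" using n orbit_sum_le_max_sum[of g n \<omega>] by simp
        also have "\<dots> \<le> max_sum g k \<omega>" using lift_Suc_mono_le[of "\<lambda>k. max_sum g k \<omega>", OF max_sum_mono that] .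
        finally show ?thesis by simp
      qed
      then show ?case by (intro tendsto_eventually) (auto simp: eventually_sequentially)
    qed
    show "AE \<omega> in M. norm (?I n \<omega>) \<le> \<bar>g \<omega>\<bar>" for n
      by (rule AE_I2) (simp add: indicator_def)
  qed simp_all
  then show ?thesis by (rule LIMSEQ_le_const) (use nonneg in blast)
qed

text \<open>Unboundedness of the orbit sums is a strictly invariant event, so by ergodicity it has probability
  \<open>0\<close> or \<open>1\<close>. Probability \<open>1\<close> would contradict the maximal inequality.\<close>

lemma orbit_sum_bounded:
  assumes erg: "ergodic M T" and g: "integrable M g" and neg: "(\<integral>\<omega>. g \<omega> \<partial>M) < 0"
  shows "AE \<omega> in M. \<exists>K. \<forall>n. orbit_sum g n \<omega> \<le> K"
proof -
  have [measurable]: "g \<in> borel_measurable M" using g by simp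
  define E where "E = {\<omega> \<in> space M. \<forall>K::nat. \<exists>n. real K < orbit_sum g n \<omega>}"
  have E [measurable]: "E \<in> sets M" unfolding E_def by measurable
  have "T -` E \<inter> space M = E"
  proof (rule set_eqI)
    fix \<omega>
    have "(\<forall>K::nat. \<exists>n. real K < orbit_sum g n (T \<omega>)) \<longleftrightarrow> (\<forall>K::nat. \<exists>n. real K < orbit_sum g n \<omega>)" (is "?L \<longleftrightarrow> ?R")
    proof
      assume L: ?L
      show ?R
      proof
        fix K :: nat
        obtain n where "real (K + nat \<lceil>\<bar>g \<omega>\<bar>\<rceil>) < orbit_sum g n (T \<omega>)" using L by blast
        then have "real K < orbit_sum g (Suc n) \<omega>" unfolding orbit_sum_Suc by (simp, linarith)
        then show "\<exists>n. real K < orbit_sum g n \<omega>" ..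
      qed
    next
      assume R: ?R
      show ?L
      proof
        fix K :: nat
        obtain n where n: "real (K + nat \<lceil>\<bar>g \<omega>\<bar>\<rceil>) < orbit_sum g n \<omega>" using R by blast
        moreover have "0 \<le> real (K + nat \<lceil>\<bar>g \<omega>\<bar>\<rceil>)" by simp
        moreover have "orbit_sum g 0 \<omega> = 0" by (simp add: orbit_sum_def)
        ultimately have "n \<noteq> 0" by (metis not_less)
        then obtain k where "n = Suc k" by (cases n) auto
        then have "real K < orbit_sum g k (T \<omega>)" using n by (simp add: orbit_sum_Suc) linarith
        then show "\<exists>n. real K < orbit_sum g n (T \<omega>)" ..
      qed
    qed
    then show "\<omega> \<in> T -` E \<inter> space M \<longleftrightarrow> \<omega> \<in> E" using T_space by (auto simp: E_def)
  qed
  then have "measure M E = 0 \<or> measure M E = 1" using erg E by (simp add: ergodic_def)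
  moreover have "measure M E \<noteq> 1"
  proof
    assume "measure M E = 1"
    then have "AE \<omega> in M. \<omega> \<in> E" using prob_eq_1[OF E] by simp
    then have "AE \<omega> in M. \<exists>n. 0 < orbit_sum g n \<omega>"
    proof eventually_elim
      case (elim \<omega>)
      then have "\<exists>n. real 0 < orbit_sum g n \<omega>" unfolding E_def by blast
      then show ?case by simp
    qed
    from maximal_ergodic_inequality[OF g this] neg show False by simp
  qed
  ultimately have "AE \<omega> in M. \<omega> \<notin> E" using prob_eq_0[OF E] by simp
  then show ?thesis
    using AE_space
  proof eventually_elim
    case (elim \<omega>)
    then obtain K :: nat where "\<And>n. \<not> real K < orbit_sum g n \<omega>" by (auto simp: E_def)
    then show ?case by (auto simp: not_less)
  qed
qed

lemma orbit_sum_upper: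
  assumes erg: "ergodic M T" and f: "integrable M f"
  shows "AE \<omega> in M. \<forall>e>0. \<exists>K. \<forall>n. orbit_sum f n \<omega> \<le> ((\<integral>\<omega>. f \<omega> \<partial>M) + e) * real n + K"
proof -
  have "AE \<omega> in M. \<exists>K. \<forall>n. orbit_sum (\<lambda>\<omega>. f \<omega> - ((\<integral>\<omega>. f \<omega> \<partial>M) + 1 / real (Suc i))) n \<omega> \<le> K" for i
    by (rule orbit_sum_bounded[OF erg]) (use f in \<open>simp_all add: prob_space\<close>)
  then have "AE \<omega> in M. \<forall>i. \<exists>K. \<forall>n. orbit_sum (\<lambda>\<omega>. f \<omega> - ((\<integral>\<omega>. f \<omega> \<partial>M) + 1 / real (Suc i))) n \<omega> \<le> K"
    by (simp add: AE_all_countable)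
  then show ?thesis
  proof eventually_elim
    case (elim \<omega>)
    show ?case
    proof (intro allI impI)
      fix e :: real assume "0 < e"
      then obtain i where i: "1 / real (Suc i) < e" using nat_approx_posE by blast
      obtain K where K: "\<And>n. orbit_sum (\<lambda>\<omega>. f \<omega> - ((\<integral>\<omega>. f \<omega> \<partial>M) + 1 / real (Suc i))) n \<omega> \<le> K"
        using elim by blast
      have "orbit_sum f n \<omega> \<le> ((\<integral>\<omega>. f \<omega> \<partial>M) + e) * real n + K" for n
      proof -
        have "orbit_sum f n \<omega> \<le> ((\<integral>\<omega>. f \<omega> \<partial>M) + 1 / real (Suc i)) * real n + K"
        proof -
          have "orbit_sum (\<lambda>\<omega>. f \<omega> - a) n \<omega> = orbit_sum f n \<omega> - a * real n" for a
            by (simp add: orbit_sum_def sum_subtractf)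
          then show ?thesis using K[of n] by simp
        qed
        moreover have "((\<integral>\<omega>. f \<omega> \<partial>M) + 1 / real (Suc i)) * real n \<le> ((\<integral>\<omega>. f \<omega> \<partial>M) + e) * real n"
          using i by (intro mult_right_mono) auto
        ultimately show ?thesis by linarith
      qed
      then show "\<exists>K. \<forall>n. orbit_sum f n \<omega> \<le> ((\<integral>\<omega>. f \<omega> \<partial>M) + e) * real n + K" by blast
    qed
  qed
qed

text \<open>This form of the ergodic theorem is the one that passes directly to sums over intervals.\<close>

theorem birkhoff:
  assumes erg: "ergodic M T" and f: "integrable M f"
  shows "AE \<omega> in M. \<forall>e>0. \<exists>K. \<forall>n. \<bar>orbit_sum f n \<omega> - (\<integral>\<omega>. f \<omega> \<partial>M) * real n\<bar> \<le> e * real n + K"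
  using orbit_sum_upper[OF erg f] orbit_sum_upper[OF erg Bochner_Integration.integrable_minus[OF f]]
proof eventually_elim
  case (elim \<omega>)
  show ?case
  proof (intro allI impI)
    fix e :: real assume e: "0 < e"
    obtain K where K: "\<And>n. orbit_sum f n \<omega> \<le> ((\<integral>\<omega>. f \<omega> \<partial>M) + e) * real n + K" using elim e by blast
    obtain K' where K': "\<And>n. orbit_sum (\<lambda>x. - f x) n \<omega> \<le> ((\<integral>\<omega>. - f \<omega> \<partial>M) + e) * real n + K'"
      using elim e by blast
    have "\<bar>orbit_sum f n \<omega> - (\<integral>\<omega>. f \<omega> \<partial>M) * real n\<bar> \<le> e * real n + max K K'" for n
    proof -
      have "orbit_sum (\<lambda>x. - f x) n \<omega> = - orbit_sum f n \<omega>" by (simp add: orbit_sum_def sum_negf)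
      then have "- orbit_sum f n \<omega> \<le> (- (\<integral>\<omega>. f \<omega> \<partial>M) + e) * real n + K'" using K'[of n] by simp
      then show ?thesis using K[of n] unfolding distrib_right by (intro abs_leI) linarith+
    qed
    then show "\<exists>K. \<forall>n. \<bar>orbit_sum f n \<omega> - (\<integral>\<omega>. f \<omega> \<partial>M) * real n\<bar> \<le> e * real n + K" by blast
  qed
qed

end

lemma inverse_measure_preserving:
  assumes "prob_space M" "invertible_measure_preserving M T"
  shows "measure_preserving_map M T" "measure_preserving_map M (the_inv_into (space M) T)"
    and "ergodic M T \<Longrightarrow> ergodic M (the_inv_into (space M) T)"
proof -
  let ?T' = "the_inv_into (space M) T"
  have bij: "bij_betw T (space M) (space M)" and T: "T \<in> measurable M M" and T': "?T' \<in> measurable M M"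
    and d: "distr M M T = M"
    using assms(2) by (auto simp: invertible_measure_preserving_def)
  have inv: "?T' (T \<omega>) = \<omega>" if "\<omega> \<in> space M" for \<omega>
    using bij that by (simp add: bij_betw_def the_inv_into_f_f)
  have inv': "T (?T' \<omega>) = \<omega>" if "\<omega> \<in> space M" for \<omega>
    using bij that by (auto simp: bij_betw_def intro!: f_the_inv_into_f)
  have "distr M M ?T' = distr (distr M M T) M ?T'" by (simp add: d)
  also have "\<dots> = distr M M (?T' \<circ> T)" by (rule distr_distr[OF T' T])
  also have "\<dots> = distr M M (\<lambda>x. x)" by (rule distr_cong) (auto simp: inv)
  finally have d': "distr M M ?T' = M" by simp
  interpret prob_space M by fact
  show "measure_preserving_map M T" "measure_preserving_map M ?T'"
    by unfold_locales (fact T d T' d')+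
  show "ergodic M ?T'" if erg: "ergodic M T"
    unfolding ergodic_def
  proof (intro ballI impI)
    fix A assume A: "A \<in> sets M" and inva: "?T' -` A \<inter> space M = A"
    have "T -` A \<inter> space M = A"
    proof (rule set_eqI)
      fix \<omega>
      show "\<omega> \<in> T -` A \<inter> space M \<longleftrightarrow> \<omega> \<in> A"
      proof (cases "\<omega> \<in> space M")
        case True
        then have "T \<omega> \<in> space M" using T by (rule measurable_space[rotated])
        then have "T \<omega> \<in> A \<longleftrightarrow> ?T' (T \<omega>) \<in> A" by (subst (1) inva[symmetric]) simp
        then have "T \<omega> \<in> A \<longleftrightarrow> \<omega> \<in> A" unfolding inv[OF True] .
        then show ?thesis using True by simp
      qed (use sets.sets_into_space[OF A] in auto)
    qed
    then show "measure M A = 0 \<or> measure M A = 1" using erg A by (simp add: ergodic_def)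
  qed
qed

section \<open>The kernel of the walk\<close>

text \<open>The Markov property is prescribed along histories of positive probability. The event
  \<open>S n w = x\<close> is the countable disjoint union of the histories that end in \<open>x\<close>.\<close>

lemma markov_chain_joint:
  fixes p :: "'s::countable \<Rightarrow> 's \<Rightarrow> real"
  assumes mc: "markov_chain p y P S" and p: "0 \<le> p x z"
  shows "\<P>(w in P. S (Suc n) w = z \<and> S n w = x) = \<P>(w in P. S n w = x) * p x z"
proof -
  interpret prob_space P using mc unfolding markov_chain_def by blast
  have S [measurable]: "S n \<in> measurable P (count_space UNIV)" for n
    using mc unfolding markov_chain_def by blast
  define H where "H = {s \<in> (PiE {..n} (\<lambda>_. UNIV :: 's set)). s n = x}"
  define X where "X s = {w \<in> space P. \<forall>k\<le>n. S k w = s k}" for s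
  define Z where "Z = {w \<in> space P. S (Suc n) w = z}"
  have X_meas [measurable]: "X s \<in> sets P" for s unfolding X_def by measurable
  have Z_meas [measurable]: "Z \<in> sets P" unfolding Z_def by measurable
  have H: "countable H"
    unfolding H_def by (rule countable_subset[OF _ countable_PiE[of "{..n}" "\<lambda>_. UNIV :: 's set"]]) auto
  have disj: "disjoint_family_on X H"
    unfolding disjoint_family_on_def
  proof (intro ballI impI)
    fix s t assume st: "s \<in> H" "t \<in> H" "s \<noteq> t"
    then obtain k where "s k \<noteq> t k" "k \<le> n"
      unfolding H_def by (auto simp: PiE_iff extensional_def fun_eq_iff) metis
    then show "X s \<inter> X t = {}" unfolding X_def by auto
  qed
  then have disj': "disjoint_family_on (\<lambda>s. X s \<inter> Z) H"
    by (rule disjoint_family_on_bisimulation) auto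
  have union: "{w \<in> space P. S n w = x} = (\<Union>s\<in>H. X s)"
  proof (intro set_eqI iffI)
    fix w assume w: "w \<in> {w \<in> space P. S n w = x}"
    then have "restrict (\<lambda>k. S k w) {..n} \<in> H" "w \<in> X (restrict (\<lambda>k. S k w) {..n})"
      by (auto simp: H_def X_def)
    then show "w \<in> (\<Union>s\<in>H. X s)" by blast
  qed (auto simp: H_def X_def)
  have joint: "{w \<in> space P. S (Suc n) w = z \<and> S n w = x} = (\<Union>s\<in>H. X s \<inter> Z)"
    using union unfolding Z_def by blast
  have step: "emeasure P (X s \<inter> Z) = ennreal (p x z) * emeasure P (X s)" if s: "s \<in> H" for s
  proof (cases "measure P (X s) > 0")
    case True
    then have "\<P>(w in P. S (Suc n) w = z \<bar> \<forall>k\<le>n. S k w = s k) = p x z"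
      using mc s unfolding markov_chain_def X_def H_def by auto
    moreover have "{w \<in> space P. S (Suc n) w = z \<and> (\<forall>k\<le>n. S k w = s k)} = X s \<inter> Z"
      by (auto simp: X_def Z_def)
    ultimately have "measure P (X s \<inter> Z) / measure P (X s) = p x z"
      unfolding cond_prob_def by (simp add: X_def)
    then have "measure P (X s \<inter> Z) = p x z * measure P (X s)"
      using True by (simp add: field_simps)
    then show ?thesis using p by (simp add: emeasure_eq_measure ennreal_mult)
  next
    case False
    then have "measure P (X s) = 0" using measure_nonneg[of P "X s"] by linarith
    moreover have "measure P (X s \<inter> Z) \<le> measure P (X s)" by (intro finite_measure_mono) auto
    ultimately have "measure P (X s \<inter> Z) = 0" using measure_nonneg[of P "X s \<inter> Z"] by linarith
    then show ?thesis using \<open>measure P (X s) = 0\<close> by (simp add: emeasure_eq_measure)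
  qed
  have "emeasure P (\<Union>s\<in>H. X s \<inter> Z) = (\<integral>\<^sup>+s. emeasure P (X s \<inter> Z) \<partial>count_space H)"
    by (rule emeasure_UN_countable) (auto simp: H disj')
  also have "\<dots> = (\<integral>\<^sup>+s. ennreal (p x z) * emeasure P (X s) \<partial>count_space H)"
    by (rule nn_integral_cong) (simp add: step)
  also have "\<dots> = ennreal (p x z) * (\<integral>\<^sup>+s. emeasure P (X s) \<partial>count_space H)"
    by (rule nn_integral_cmult) simp
  also have "(\<integral>\<^sup>+s. emeasure P (X s) \<partial>count_space H) = emeasure P (\<Union>s\<in>H. X s)"
    by (rule emeasure_UN_countable[symmetric]) (auto simp: H disj)
  finally show ?thesis
    unfolding joint[symmetric] union[symmetric] using p
    by (simp add: emeasure_eq_measure flip: ennreal_mult)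
qed

lemma markov_chain_step_nearest_neighbour:
  fixes p :: "int \<Rightarrow> int \<Rightarrow> real"
  assumes mc: "markov_chain p y P S" and p: "\<And>x z. 0 \<le> p x z"
    and nn: "\<And>x z. x \<noteq> z - 1 \<Longrightarrow> x \<noteq> z + 1 \<Longrightarrow> p x z = 0"
  shows "\<P>(w in P. S (Suc n) w = z)
    = \<P>(w in P. S n w = z - 1) * p (z - 1) z + \<P>(w in P. S n w = z + 1) * p (z + 1) z"
proof -
  interpret prob_space P using mc unfolding markov_chain_def by blast
  have S [measurable]: "S n \<in> measurable P (count_space UNIV)" for n
    using mc unfolding markov_chain_def by blast
  have "AE w in P. \<not> (S (Suc n) w = z \<and> S n w = x)" if "x \<noteq> z - 1" "x \<noteq> z + 1" for x
  proof -
    have "{w \<in> space P. S (Suc n) w = z \<and> S n w = x} \<in> events" by measurable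
    moreover have "\<P>(w in P. S (Suc n) w = z \<and> S n w = x) = 0"
      using markov_chain_joint[OF mc p, where x = x and z = z and n = n] nn[OF that] by simp
    ultimately show ?thesis using prob_eq_0[of "{w \<in> space P. S (Suc n) w = z \<and> S n w = x}"]
      by (auto elim: AE_mp)
  qed
  then have "AE w in P. \<forall>x. x \<noteq> z - 1 \<longrightarrow> x \<noteq> z + 1 \<longrightarrow> \<not> (S (Suc n) w = z \<and> S n w = x)"
    unfolding AE_all_countable by auto
  then have "AE w in P. (S (Suc n) w = z) = ((S (Suc n) w = z \<and> S n w = z - 1) \<or> (S (Suc n) w = z \<and> S n w = z + 1))"
    by eventually_elim blast
  then have "\<P>(w in P. S (Suc n) w = z)
      = \<P>(w in P. (S (Suc n) w = z \<and> S n w = z - 1) \<or> (S (Suc n) w = z \<and> S n w = z + 1))"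
    by (rule prob_eq_AE) measurable
  also have "{w \<in> space P. (S (Suc n) w = z \<and> S n w = z - 1) \<or> (S (Suc n) w = z \<and> S n w = z + 1)}
      = {w \<in> space P. S (Suc n) w = z \<and> S n w = z - 1} \<union> {w \<in> space P. S (Suc n) w = z \<and> S n w = z + 1}"
    by auto
  also have "measure P \<dots> = \<P>(w in P. S (Suc n) w = z \<and> S n w = z - 1) + \<P>(w in P. S (Suc n) w = z \<and> S n w = z + 1)"
    by (rule finite_measure_Union) auto
  finally show ?thesis by (simp only: markov_chain_joint[OF mc p])
qed

lemma conductance_walk_kernel:
  assumes walk: "conductance_walk M T c \<omega> y P S" and pos: "\<And>x. 0 < c (iterate M T x \<omega>)"
  shows "\<P>(w in P. S n w = x) = cbar M T c \<omega> x * conductances.kernel (\<lambda>x. c (iterate M T x \<omega>)) y n x"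
proof -
  interpret conductances "\<lambda>x. c (iterate M T x \<omega>)" by unfold_locales (rule pos)
  have cb: "cbar M T c \<omega> x = m x" for x by (simp add: cbar_def conductance_def m_def)
  let ?p = "\<lambda>x z. conductance M T c \<omega> x z / cbar M T c \<omega> x"
  have mc: "markov_chain ?p y P S" using walk by (simp add: conductance_walk_def)
  interpret prob_space P using mc unfolding markov_chain_def by blast
  have S [measurable]: "S n \<in> measurable P (count_space UNIV)" for n
    using mc unfolding markov_chain_def by blast
  have p: "0 \<le> ?p x z" for x z
    using less_imp_le[OF pos] less_imp_le[OF m_pos] by (simp add: conductance_def cb)
  have nn: "?p x z = 0" if "x \<noteq> z - 1" "x \<noteq> z + 1" for x z
    using that by (auto simp: conductance_def)
  have "\<P>(w in P. S n w = x) = m x * kernel y n x"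
  proof (induction n arbitrary: x)
    case 0
    have "AE w in P. S 0 w = y" using mc by (simp add: markov_chain_def)
    then have "AE w in P. (S 0 w = x) = (y = x)" by eventually_elim auto
    then have "\<P>(w in P. S 0 w = x) = \<P>(w in P. y = x)" by (rule prob_eq_AE) measurable
    then show ?case by (simp add: prob_space)
  next
    case (Suc n)
    have "\<P>(w in P. S (Suc n) w = x)
      = m (x - 1) * kernel y n (x - 1) * ?p (x - 1) x + m (x + 1) * kernel y n (x + 1) * ?p (x + 1) x"
      using markov_chain_step_nearest_neighbour[where p = ?p, OF mc p nn, of n x] unfolding Suc.IH .
    also have "?p (x - 1) x = c (iterate M T (x - 1) \<omega>) / m (x - 1)" by (simp add: conductance_def cb)
    also have "?p (x + 1) x = c (iterate M T x \<omega>) / m (x + 1)" by (simp add: conductance_def cb)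
    finally show ?case by (simp add: m_avg mult_ac)
  qed
  then show ?thesis by (simp add: cb)
qed

section \<open>Averages of a stationary environment\<close>

lemma isum_of_nat: "isum F (int n) = (\<Sum>k<n. F (int k))"
  by (induction n) (simp_all add: add.commute[of 1] isum_Suc)

lemma isum_minus_of_nat: "isum F (- int n) = - (\<Sum>k<n. F (- int k - 1))"
proof (induction n)
  case (Suc n)
  have "- int (Suc n) = - int n - 1" by simp
  then have "isum F (- int (Suc n)) = isum F (- int n - 1)" by (simp only:)
  also have "\<dots> = isum F (- int n) - F (- int n - 1)" using isum_Suc[of F "- int n - 1"] by simp
  also have "\<dots> = - (\<Sum>k<Suc n. F (- int k - 1))" using Suc by simp
  finally show ?case .
qed simp

lemma two_sided_average:
  fixes F :: "int \<Rightarrow> real" and I :: real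
  assumes R: "\<And>e. 0 < e \<Longrightarrow> \<exists>K. \<forall>n. \<bar>(\<Sum>k<n. F (int k)) - I * real n\<bar> \<le> e * real n + K"
    and L: "\<And>e. 0 < e \<Longrightarrow> \<exists>K. \<forall>n. \<bar>(\<Sum>k<n. F (- int k - 1)) - I * real n\<bar> \<le> e * real n + K"
    and e: "0 < e"
  shows "\<exists>K. \<forall>x. \<bar>isum F x - I * x\<bar> \<le> e * \<bar>real_of_int x\<bar> + K"
proof -
  obtain K where K: "\<And>n. \<bar>(\<Sum>k<n. F (int k)) - I * real n\<bar> \<le> e * real n + K" using R[OF e] by blast
  obtain K' where K': "\<And>n. \<bar>(\<Sum>k<n. F (- int k - 1)) - I * real n\<bar> \<le> e * real n + K'" using L[OF e] by blast
  have "\<bar>isum F x - I * x\<bar> \<le> e * \<bar>real_of_int x\<bar> + max K K'" for x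
  proof (cases x rule: int_cases2)
    case (nonneg n)
    then show ?thesis using K[of n] by (simp add: isum_of_nat)
  next
    case (nonpos n)
    then show ?thesis using K'[of n] by (simp add: isum_minus_of_nat abs_minus_commute add.commute)
  qed
  then show ?thesis by blast
qed

lemma nearest_even_dist:
  assumes "nearest_even k r"
  shows "\<bar>real_of_int k - r\<bar> \<le> 1"
proof -
  have "\<bar>r - real_of_int k\<bar> \<le> \<bar>r - real_of_int (2 * round (r / 2))\<bar>"
    using assms unfolding nearest_even_def by (metis dvd_triv_left)
  moreover have "\<bar>real_of_int (round (r / 2)) - r / 2\<bar> \<le> 1 / 2" by (rule of_int_round_abs_le)
  moreover have "\<bar>r - real_of_int (2 * round (r / 2))\<bar> = 2 * \<bar>real_of_int (round (r / 2)) - r / 2\<bar>"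
  proof -
    have "r - real_of_int (2 * round (r / 2)) = - (2 * (real_of_int (round (r / 2)) - r / 2))" by simp
    then show ?thesis by (simp only: abs_minus_cancel abs_mult abs_numeral)
  qed
  ultimately show ?thesis by (simp only: abs_minus_commute[of r])
qed

lemma (in prob_space) integral_pos:
  fixes f :: "'a \<Rightarrow> real"
  assumes f: "integrable M f" and pos: "\<And>\<omega>. \<omega> \<in> space M \<Longrightarrow> 0 < f \<omega>"
  shows "0 < (\<integral>\<omega>. f \<omega> \<partial>M)"
proof -
  have nonneg: "AE \<omega> in M. 0 \<le> f \<omega>" by (rule AE_I2) (use pos less_imp_le in blast)
  have "(\<integral>\<omega>. f \<omega> \<partial>M) \<noteq> 0"
  proof
    assume "(\<integral>\<omega>. f \<omega> \<partial>M) = 0"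
    then have "AE \<omega> in M. f \<omega> = 0" using integral_nonneg_eq_0_iff_AE[OF f nonneg] by simp
    then have "AE \<omega> in M. False" using AE_space by eventually_elim (use pos in force)
    then show False by simp
  qed
  then show ?thesis using integral_nonneg_AE[OF nonneg] by simp
qed

text \<open>Negative positions are visited by the inverse map. The orbit of \<open>T\<^sup>-\<^sup>1\<close> starts at position
  \<open>0\<close>, which belongs to the right half-line, hence the shift by one.\<close>

lemma invertible_averages:
  fixes f :: "'a \<Rightarrow> real"
  assumes M: "prob_space M" and T: "invertible_measure_preserving M T" and erg: "ergodic M T"
    and f: "integrable M f"
  shows "AE \<omega> in M. \<forall>e>0. \<exists>K. \<forall>x. \<bar>isum (\<lambda>x. f (iterate M T x \<omega>)) x - (\<integral>\<omega>. f \<omega> \<partial>M) * x\<bar> \<le> e * \<bar>real_of_int x\<bar> + K"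
proof -
  let ?T' = "the_inv_into (space M) T"
  interpret R: measure_preserving_map M T by (rule inverse_measure_preserving(1)[OF M T])
  interpret L: measure_preserving_map M ?T' by (rule inverse_measure_preserving(2)[OF M T])
  have [measurable]: "f \<in> borel_measurable M" using f by simp
  have erg': "ergodic M ?T'" by (rule inverse_measure_preserving(3)[OF M T erg])
  show ?thesis
    using R.birkhoff[OF erg f] L.birkhoff[OF erg' L.integrable_comp_T[OF f]]
  proof eventually_elim
    case (elim \<omega>)
    show ?case
    proof (intro allI impI two_sided_average)
      show "\<exists>K. \<forall>n. \<bar>(\<Sum>k<n. f (iterate M T (int k) \<omega>)) - (\<integral>\<omega>. f \<omega> \<partial>M) * real n\<bar> \<le> e * real n + K" if "0 < e" for e
        using elim(1) that by (simp add: R.orbit_sum_def iterate_def)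
      show "\<exists>K. \<forall>n. \<bar>(\<Sum>k<n. f (iterate M T (- int k - 1) \<omega>)) - (\<integral>\<omega>. f \<omega> \<partial>M) * real n\<bar> \<le> e * real n + K" if "0 < e" for e
      proof -
        have "iterate M T (- int k - 1) \<omega> = ?T' ((?T' ^^ k) \<omega>)" for k
        proof -
          have "nat (- (- int k - 1)) = Suc k" by simp
          then show ?thesis by (simp add: iterate_def del: nat_minus_as_int)
        qed
        then show ?thesis using elim(2) that by (simp add: L.orbit_sum_def L.integral_comp_T)
      qed
    qed
  qed
qed

lemma iterate_space:
  assumes T: "invertible_measure_preserving M T" and \<omega>: "\<omega> \<in> space M"
  shows "iterate M T x \<omega> \<in> space M"
proof -
  have "T \<in> measurable M M" "the_inv_into (space M) T \<in> measurable M M"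
    using T by (auto simp: invertible_measure_preserving_def)
  then have "(T ^^ n) \<omega> \<in> space M" "(the_inv_into (space M) T ^^ n) \<omega> \<in> space M" for n
    by (induction n) (use \<omega> in \<open>auto intro: measurable_space\<close>)
  then show ?thesis by (simp add: iterate_def)
qed

lemma iterate_pred:
  assumes T: "invertible_measure_preserving M T" and \<omega>: "\<omega> \<in> space M"
  shows "iterate M T (- 1) (iterate M T x \<omega>) = iterate M T (x - 1) \<omega>"
proof (cases "0 < x")
  case True
  then obtain n where n: "x = int (Suc n)" by (metis zero_less_imp_eq_int gr0_implies_Suc)
  have "inj_on T (space M)" using T by (auto simp: invertible_measure_preserving_def bij_betw_def)
  moreover have "(T ^^ n) \<omega> \<in> space M" using iterate_space[OF T \<omega>, of "int n"] by (simp add: iterate_def)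
  moreover have "iterate M T (int (Suc n)) \<omega> = T ((T ^^ n) \<omega>)"
    unfolding iterate_def nat_int by simp
  moreover have "int (Suc n) - 1 = int n" by simp
  ultimately show ?thesis unfolding n by (simp add: iterate_def the_inv_into_f_f)
next
  case False
  then obtain n where n: "x = - int n" by (metis not_less nonpos_int_cases)
  have "nat (- (x - 1)) = Suc n" using n by simp
  then show ?thesis unfolding n by (auto simp: iterate_def simp del: nat_minus_as_int)
qed

lemma cbar_iterate:
  assumes T: "invertible_measure_preserving M T" and \<omega>: "\<omega> \<in> space M"
  shows "cbar M T c (iterate M T x \<omega>) 0 = cbar M T c \<omega> x"
  by (simp add: cbar_def conductance_def iterate_pred[OF T \<omega>]) (simp add: iterate_def)

section \<open>The quenched local limit theorem\<close>

theorem mainTheorem2: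
  fixes M :: "'a measure" and T :: "'a \<Rightarrow> 'a" and c :: "'a \<Rightarrow> real"
    and P :: "'a \<Rightarrow> int \<Rightarrow> 'p measure" and S :: "nat \<Rightarrow> 'p \<Rightarrow> int"
  assumes "prob_space M"
    and "invertible_measure_preserving M T"
    and "ergodic M T"
    and "c \<in> borel_measurable M"
    and "\<And>\<omega>. \<omega> \<in> space M \<Longrightarrow> 0 < c \<omega>"
    and "\<And>\<omega> y. \<omega> \<in> space M \<Longrightarrow> conductance_walk M T c \<omega> y (P \<omega> y) S"
    and "integrable M (\<lambda>\<omega>. cbar M T c \<omega> 0)"
    and "integrable M (\<lambda>\<omega>. 1 / c \<omega>)"
  shows "AE \<omega> in M. \<forall>x0::real. \<forall>g::nat \<Rightarrow> int.
    (\<forall>n. nearest_even (g n) (x0 * sqrt (2 * real n))) \<longrightarrow>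
    (\<lambda>n. sqrt (2 * real n) *
         (\<P>(w in P \<omega> 0. S (2 * n) w = g n) / cbar M T c \<omega> (g n)))
      \<longlonglongrightarrow>
    1 / sqrt pi * sqrt ((\<integral>\<omega>. 1 / c \<omega> \<partial>M) / (\<integral>\<omega>. cbar M T c \<omega> 0 \<partial>M))
      * exp (- ((\<integral>\<omega>. cbar M T c \<omega> 0 \<partial>M) * (\<integral>\<omega>. 1 / c \<omega> \<partial>M) / 4 * x0\<^sup>2))"
proof -
  interpret prob_space M by fact
  define A where "A = (\<integral>\<omega>. cbar M T c \<omega> 0 \<partial>M)"
  define B where "B = (\<integral>\<omega>. 1 / c \<omega> \<partial>M)"
  note T = assms(2)
  have pos: "0 < c (iterate M T x \<omega>)" if "\<omega> \<in> space M" for x \<omega>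
    using assms(5) iterate_space[OF T that] by blast
  have A: "0 < A"
    unfolding A_def
  proof (rule integral_pos[OF assms(7)])
    fix \<omega> assume "\<omega> \<in> space M"
    then show "0 < cbar M T c \<omega> 0"
      using pos[of \<omega> 0] pos[of \<omega> "- 1"] by (simp add: cbar_def conductance_def)
  qed
  have B: "0 < B"
    unfolding B_def by (rule integral_pos[OF assms(8)]) (simp add: assms(5))
  show ?thesis
    unfolding A_def[symmetric] B_def[symmetric]
    using invertible_averages[OF assms(1-3,7), folded A_def] invertible_averages[OF assms(1-3,8), folded B_def] AE_space
  proof eventually_elim
    case (elim \<omega>)
    note \<omega> = elim(3)
    interpret conductances "\<lambda>x. c (iterate M T x \<omega>)" by unfold_locales (rule pos[OF \<omega>])
    have cb: "cbar M T c \<omega> x = m x" for x by (simp add: cbar_def conductance_def m_def)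
    interpret averaged_conductances "\<lambda>x. c (iterate M T x \<omega>)" A B
      using elim A B by unfold_locales (simp_all add: cbar_iterate[OF T \<omega>] cb)
    show ?case
    proof (intro allI impI)
      fix x0 :: real and g :: "nat \<Rightarrow> int"
      assume g: "\<forall>n. nearest_even (g n) (x0 * sqrt (2 * real n))"
      have "\<P>(w in P \<omega> 0. S (2 * n) w = g n) / cbar M T c \<omega> (g n) = kernel 0 (2 * n) (g n)" for n
        using conductance_walk_kernel[OF assms(6)[OF \<omega>] pos[OF \<omega>], of 0 "2 * n" "g n"] by (simp add: cb)
      moreover have "(\<lambda>n. sqrt (2 * real n) * kernel 0 (2 * n) (g n))
          \<longlonglongrightarrow> 1 / sqrt pi * sqrt (B / A) * exp (- (A * B / 4 * x0\<^sup>2))"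
        using g by (intro local_limit nearest_even_dist) (auto simp: nearest_even_def)
      ultimately show "(\<lambda>n. sqrt (2 * real n) * (\<P>(w in P \<omega> 0. S (2 * n) w = g n) / cbar M T c \<omega> (g n)))
          \<longlonglongrightarrow> 1 / sqrt pi * sqrt (B / A) * exp (- (A * B / 4 * x0\<^sup>2))"
        by (simp only:)
    qed
  qed
qed

end
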